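(* Let $\mathfrak g=A_n$ $(n\ge1)$ or $\mathfrak g=C_n$ $(n\ge3)$. For every dominant integral weight $\lambda$ of $\mathfrak g$, the assignment $Y\mapsto T_Y$ defines a map $\varphi:Y(\lambda)\to T(\lambda)$ which is an isomorphism of $U_q(\mathfrak g)$-crystals. That is, $\varphi$ is a bijection from the set $Y(\lambda)$ of Young walls onto the set $T(\lambda)$ of reverse-shape tableaux, which (with the convention $\varphi(0)=0$) commutes with the Kashiwara operators $\tilde e_i,\tilde f_i$ $(i=1,\dots,n)$ and preserves $\mathrm{wt}$, $\varepsilon_i$ and $\varphi_i$.
   Context: **Weights.** Let $\omega_i=\lambda_i=\epsilon_1+\dots+\epsilon_i$ $(1\le i\le n)$ be the fundamental weights of $\mathfrak g$ (for $A_n$, modulo $\epsilon_1+\dots+\epsilon_{n+1}$). Write $\lambda=\omega_{i_1}+\dots+\omega_{i_t}$ with $1\le i_1\le\dots\le i_t\le n$, and put $N=i_1+\dots+i_t$. **Tensor product rule (signature rule).** In a tensor product $b_1\otimes\dots\otimes b_N$ of crystal elements, write for each $b_j$ (in order) $\varepsilon_i(b_j)$ signs $-$ followed by $\varphi_i(b_j)$ signs $+$. Cancel successively all pairs $(+,-)$ to get $(-,\dots,-,+,\dots,+)$, the $i$-signature. $\tilde e_i$ acts on the factor of the right-most remaining $-$, and $\tilde f_i$ on the factor of the left-most remaining $+$; the result is $0$ if there is no such sign. $\varepsilon_i$ and $\varphi_i$ are the numbers of remaining $-$ and $+$. **Vector crystals $\mathbf B$.** For $A_n$: $1\xrightarrow{1}2\xrightarrow{2}\cdots\xrightarrow{n}n+1$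 with $\mathrm{wt}(j)=\epsilon_j$. For $C_n$: $1\xrightarrow{1}2\xrightarrow{2}\cdots\xrightarrow{n-1}n\xrightarrow{n}\overline n\xrightarrow{n-1}\cdots\xrightarrow{1}\overline1$ with $\mathrm{wt}(j)=\epsilon_j$, $\mathrm{wt}(\overline j)=-\epsilon_j$. **Tableaux $T(\lambda)$.** The shape has, from left to right, columns of lengths $i_1\le\dots\le i_t$, all bottom-justified; rows are numbered from bottom to top. (If row $j$ from the bottom has length $l_j$, then $\lambda=\sum_jl_j\epsilon_j$.) - $A_n$: fillings with entries in $\{1,\dots,n+1\}$, weakly increasing along rows from left to right and strictly increasing down columns. - $C_n$: fillings with entries in $\{1\prec\dots\prec n\prec\overline n\prec\dots\prec\overline1\}$ such that (a) entries weakly increase along rows from left to right; (b) entries strictly increase down columns; (c) (1CC) if a column of length $M$ has $a$ in row $p$ and $\overline a$ in row $q$ with $p>q$, then $p-q-1\ge M-a$; (d) for adjacent columns $C$ (left) and $C'$ (right): (2CC-1) if $a$ is in row $p$ of $C$ and $\overline a$ is in row $q$ of $C'$ with $p>q$, then $p-q\le n-a$; (2CC-2) if $a$ is in row $p$ of $C$ and $\overline a$ is in row $q$ of $C'$ with $p>q$, and if $b$ and $\overline b$ both lie in $C$, or both lie in $C'$, in rows $r$ and $s$ respectively with $p\ge r>s\ge q$, then $(p-r)+(s-q)<b-a$. A tableau is identified with an element of $\mathbf B^{\otimes N}$ by reading columns from right to left, each from top to bottom. The crystal structure on $T(\lambda)$ is induced from the tensor product. **Young walls.** Columns are numbered $1,2,3,\dots$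 from right to left; each column is a stack of colored blocks. A Young wall is obtained by adding finitely many blocks to a ground-state wall so that there is no free space immediately to the right of any block, except in the right-most column. *Type $A_n^{(1)}$ (for $\mathfrak g=A_n$).* All blocks are unit cubes. The ground-state wall is the empty wall of weight $\Lambda_c$, where $c\equiv N\pmod{n+1}$, $0\le c\le n$. The block at height $h\ge1$ (counted from the bottom) in column $m$ has color $c-m+h \bmod (n+1)$, in $\{0,1,\dots,n\}$. Every Young wall is proper. A wall is reduced if no column can be lowered by $n+1$ blocks so that the result is still a Young wall. *Type $A_{2n-1}^{(2)}$ (for $\mathfrak g=C_n$).* Going upwards the layers repeat with period $(0|1),2,3,\dots,n-1,n,n-1,\dots,3,2$. The blocks $2,\dots,n$ have unit height and unit thickness. A $(0|1)$ layer has unit height and consists of one $0$-block and one $1$-block, each of half-unit thickness, one in the front half and one in the back half. In every $(0|1)$ layer of a given column the front color is the same, and front colors alternate between $0$ and $1$ in consecutive columns. A layer can be started only when the layer below is complete; the two blocks of a $(0|1)$ layer may be added in either order. The ground-state wall is $Y_{\Lambda_0}$ if $N$ is even and $Y_{\Lambda_1}$ if $N$ is odd: every column consists of the front block of one $(0|1)$ layer at the bottom. This front block has color $0$ in column $N$ and colors alternate (for $N=0$: color $1$ in column $1$). The no-free-space rule is applied to front and back halves separately. A column is full if its height is an integer multiple of the unit length and its top is of unit thickness. A wall is proper if no two full columns have the same height. It is reduced if no column can be lowered by one complete period (removing one $0$-, one $1$-, one $n$-block and two blocks of each color $2,\dots,n-1$ from its top part, and not removing ground-state blocks) so that the result is still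 a proper Young wall. **Kashiwara operators on proper walls.** A block of color $i$ at the top of a column is a removable $i$-block if its removal leaves a proper wall. A place on top of a column is an $i$-admissible slot if adding an $i$-block there gives a proper wall. To each column assign: - $--$ if it is twice $i$-removable; - $-$ if it is once $i$-removable and not $i$-admissible; - $-+$ if it is once $i$-removable and once $i$-admissible; - $+$ if it is once $i$-admissible and not $i$-removable; - $++$ if it is twice $i$-admissible; - nothing otherwise. Read the columns from left to right and cancel all $(+,-)$ pairs. $\tilde e_i$ removes the $i$-block of the right-most remaining $-$, and $\tilde f_i$ adds an $i$-block at the left-most remaining $+$ (the result is $0$ if there is none). $\varepsilon_i,\varphi_i$ are the numbers of remaining $-$, $+$. Here $\mathrm{wt}(Y)=\Lambda-\sum_ik_i\alpha_i$, where $\Lambda$ is the weight of the ground-state wall and $k_i$ is the number of added $i$-blocks, viewed as a weight of $\mathfrak g$ through its values on $h_1,\dots,h_n$. **Letter of a column.** For $A_n$: a column whose top block has color $j$ $(0\le j\le n)$ has letter $j+1$; an empty column $m$ is treated as having top color $c-m\bmod(n+1)$, i.e. the color the pattern would have at height $0$. For $C_n$: - the top layer is $(0|1)$ with only its $0$-block: letter $1$; with only its $1$-block: letter $\overline1$; with both: letter $2$; - the top block has color $j-1$ $(3\le j\le n)$ and lies between a $(0|1)$ layer below and the next $n$-block above: letter $j$; - the top block has color $n$: letter $\overline n$; - the top block has color $j$ $(2\le j\le n-1)$ and lies between an $n$-block below and the next $(0|1)$ layer above: letter $\overline j$. **The set $Y(\lambda)$.** The highest weight wall $H_\lambda$ is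 defined as follows. - $A_n$: for $1\le k\le t$, each of the columns $i_1+\dots+i_{k-1}+1,\dots,i_1+\dots+i_k$ has height $\sum_{j=k+1}^t(n+1-i_j)$; all columns with number $>N$ are empty. - $C_n$: number the periods so that period $1$ begins with the lowest $(0|1)$ layer. For $1\le k\le t$ and $1\le a\le i_k$, column $i_1+\dots+i_{k-1}+a$ has letter $i_k+1-a$ with its top in period $t-k+1$; all columns with number $>N$ are as in the ground-state wall. $Y(\lambda)$ is the connected component containing $H_\lambda$ of the crystal of reduced proper Young walls with respect to $\tilde e_i,\tilde f_i$, $i=1,\dots,n$ (the $0$-arrows being deleted). Its crystal structure is the restricted one. **The tableau $T_Y$.** For $Y\in Y(\lambda)$, $1\le k\le t$, $1\le a\le i_k$, the box of $T_Y$ in the $k$-th column from the left and $a$-th row from the bottom contains the letter of column number $i_1+\dots+i_{k-1}+a$ of $Y$. *)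

theory Defs
  imports "HOL-Library.Multiset"
begin

section \<open>Weights\<close>

datatype cartan = TypeA | TypeC

text \<open>
  An integral weight of \<open>A\<^sub>n\<close> or \<open>C\<^sub>n\<close> is represented by its values on the simple coroots
  \<open>h\<^sub>1, \<dots>, h\<^sub>n\<close>, extended by \<open>0\<close> to the other indices.  In these coordinates
  \<open>\<epsilon>\<^sub>j\<close> is given by the same formula in both types (\<open>j \<le> n + 1\<close> for \<open>A\<^sub>n\<close>, \<open>j \<le> n\<close> for \<open>C\<^sub>n\<close>,
  where \<open>h\<^sub>n\<close> takes the value \<open>1\<close> on \<open>\<epsilon>\<^sub>n\<close>), and in type \<open>A\<^sub>n\<close> the quotient by
  \<open>\<epsilon>\<^sub>1 + \<dots> + \<epsilon>\<^bsub>n+1\<^esub>\<close> is automatic.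
\<close>

type_synonym weight = "nat \<Rightarrow> int"

definition eps_weight :: "nat \<Rightarrow> nat \<Rightarrow> weight" where
  "eps_weight n j = (\<lambda>i. if i \<in> {1..n} then of_bool (j = i) - of_bool (j = Suc i) else 0)"

definition fund_weight :: "nat \<Rightarrow> nat \<Rightarrow> weight" where
  "fund_weight n i = (\<lambda>j. \<Sum>k\<in>{1..i}. eps_weight n k j)"

definition dominant_weight :: "nat \<Rightarrow> weight \<Rightarrow> bool" where
  "dominant_weight n lam \<longleftrightarrow> (\<forall>i\<in>{1..n}. 0 \<le> lam i) \<and> (\<forall>i. i \<notin> {1..n} \<longrightarrow> lam i = 0)"

text \<open>
  The list \<open>i\<^sub>1 \<le> \<dots> \<le> i\<^sub>t\<close> with \<open>lam = \<omega>\<^bsub>i\<^sub>1\<^esub> + \<dots> + \<omega>\<^bsub>i\<^sub>t\<^esub>\<close>; see \<open>fund_parts_iff\<close>.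
\<close>

definition fund_parts :: "nat \<Rightarrow> weight \<Rightarrow> nat list" where
  "fund_parts n lam = concat (map (\<lambda>i. replicate (nat (lam i)) i) [1..<Suc n])"

lemma fund_weight_eq:
  assumes "i \<le> n"
  shows "fund_weight n i j = of_bool (i = j \<and> j \<in> {1..n})"
proof (cases "j \<in> {1..n}")
  case False
  then show ?thesis by (auto simp: fund_weight_def eps_weight_def)
next
  case True
  have "(\<Sum>k\<in>{1..i}. (of_bool (k = j) - of_bool (k = Suc j) :: int))
      = of_bool (j \<in> {1..i}) - of_bool (Suc j \<in> {1..i})"
    by (simp add: sum_subtractf of_bool_def)
  with True show ?thesis by (auto simp: fund_weight_def eps_weight_def)
qed

lemma sum_fund_weight:
  assumes "set is \<subseteq> {1..n}"
  shows "(\<Sum>i\<leftarrow>is. fund_weight n i j) = (if j \<in> {1..n} then int (count_list is j) else 0)"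
  using assms by (induction "is") (auto simp: fund_weight_eq)

lemma count_list_concat: "count_list (concat xss) x = (\<Sum>xs\<leftarrow>xss. count_list xs x)"
  by (induction xss) auto

lemma count_list_replicate: "count_list (replicate k y) x = (if x = y then k else 0)"
  by (induction k) auto

lemma sum_list_single:
  "distinct xs \<Longrightarrow> (\<Sum>i\<leftarrow>xs. if x = i then f i else 0) = (if x \<in> set xs then f x else (0::nat))"
  by (induction xs) auto

lemma count_fund_parts: "count_list (fund_parts n lam) j = (if j \<in> {1..n} then nat (lam j) else 0)"
  by (simp add: fund_parts_def count_list_concat comp_def count_list_replicate
      sum_list_single del: upt_Suc)

lemma sorted_fund_parts: "sorted (fund_parts n lam)"
proof -
  have "sorted (concat (map (\<lambda>i. replicate (nat (lam i)) i) [1..<m]))" for m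
    by (induction m) (auto simp: sorted_append)
  then show ?thesis by (simp add: fund_parts_def del: upt_Suc)
qed

lemma fund_parts_iff:
  assumes "dominant_weight n lam"
  shows "is = fund_parts n lam \<longleftrightarrow>
    sorted is \<and> set is \<subseteq> {1..n} \<and> lam = (\<lambda>j. \<Sum>i\<leftarrow>is. fund_weight n i j)"
proof -
  have sub: "set (fund_parts n lam) \<subseteq> {1..n}"
    by (auto simp: fund_parts_def)
  have lam: "lam = (\<lambda>j. \<Sum>i\<leftarrow>fund_parts n lam. fund_weight n i j)"
    using assms by (auto simp: fun_eq_iff sum_fund_weight[OF sub] count_fund_parts dominant_weight_def)
  show ?thesis
  proof (intro iffI; (elim conjE)?)
    assume "is = fund_parts n lam"
    then show "sorted is \<and> set is \<subseteq> {1..n} \<and> lam = (\<lambda>j. \<Sum>i\<leftarrow>is. fund_weight n i j)"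
      using sub lam sorted_fund_parts by blast
  next
    assume *: "sorted is" "set is \<subseteq> {1..n}" "lam = (\<lambda>j. \<Sum>i\<leftarrow>is. fund_weight n i j)"
    have "count_list is j = count_list (fund_parts n lam) j" for j
    proof (cases "j \<in> {1..n}")
      case True
      then show ?thesis
        by (subst count_fund_parts, subst *(3)) (simp add: sum_fund_weight[OF *(2)])
    next
      case False
      then show ?thesis
        using *(2) sub by (metis count_list_0_iff subsetD)
    qed
    then have "mset is = mset (fund_parts n lam)"
      by (simp add: multiset_eq_iff count_mset)
    then show "is = fund_parts n lam"
      using *(1) sorted_fund_parts by (metis properties_for_sort)
  qed
qed

section \<open>Crystals\<close>

text \<open>\<open>None\<close> plays the role of the element \<open>0\<close> adjoined to a crystal.\<close>

record 'b crystal =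
  elems :: "'b set"
  wt :: "'b \<Rightarrow> weight"
  e_op :: "nat \<Rightarrow> 'b \<Rightarrow> 'b option"
  f_op :: "nat \<Rightarrow> 'b \<Rightarrow> 'b option"
  e_len :: "nat \<Rightarrow> 'b \<Rightarrow> nat"
  f_len :: "nat \<Rightarrow> 'b \<Rightarrow> nat"

definition ops_closed :: "nat \<Rightarrow> 'b crystal \<Rightarrow> bool" where
  "ops_closed n B \<longleftrightarrow> (\<forall>i\<in>{1..n}. \<forall>b\<in>elems B.
     set_option (e_op B i b) \<subseteq> elems B \<and> set_option (f_op B i b) \<subseteq> elems B)"

definition crystal_iso :: "nat \<Rightarrow> 'a crystal \<Rightarrow> 'b crystal \<Rightarrow> ('a \<Rightarrow> 'b) \<Rightarrow> bool" where
  "crystal_iso n B B' h \<longleftrightarrow>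
     ops_closed n B \<and> ops_closed n B' \<and>
     bij_betw h (elems B) (elems B') \<and>
     (\<forall>b\<in>elems B. wt B' (h b) = wt B b) \<and>
     (\<forall>i\<in>{1..n}. \<forall>b\<in>elems B.
        map_option h (e_op B i b) = e_op B' i (h b) \<and>
        map_option h (f_op B i b) = f_op B' i (h b) \<and>
        e_len B' i (h b) = e_len B i b \<and>
        f_len B' i (h b) = f_len B i b)"

section \<open>Signatures\<close>

datatype sign = Minus | Plus

text \<open>
  Each sign carries the place it comes from.  If the list to the right is already reduced, i.e.
  of the form \<open>- \<dots> - + \<dots> +\<close>, then a new \<open>+\<close> on the left cancels with its first sign exactly
  when that sign is a \<open>-\<close>.
\<close>

fun push_sign :: "'p \<times> sign \<Rightarrow> ('p \<times> sign) list \<Rightarrow> ('p \<times> sign) list" where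
  "push_sign (p, Plus) ((q, Minus) # s) = s"
| "push_sign x s = x # s"

definition cancel :: "('p \<times> sign) list \<Rightarrow> ('p \<times> sign) list" where
  "cancel s = foldr push_sign s []"

definition places :: "sign \<Rightarrow> ('p \<times> sign) list \<Rightarrow> 'p list" where
  "places c s = map fst (filter (\<lambda>x. snd x = c) (cancel s))"

definition rightmost_minus :: "('p \<times> sign) list \<Rightarrow> 'p option" where
  "rightmost_minus s = (if places Minus s = [] then None else Some (last (places Minus s)))"

definition leftmost_plus :: "('p \<times> sign) list \<Rightarrow> 'p option" where
  "leftmost_plus s = (if places Plus s = [] then None else Some (hd (places Plus s)))"

section \<open>Vector crystals and tensor powers\<close>

text \<open>\<open>Bar j\<close> is the barred letter, used only for \<open>C\<^sub>n\<close>.\<close>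

datatype letter = Unb nat | Bar nat

fun letter_less :: "letter \<Rightarrow> letter \<Rightarrow> bool"  (infix "\<prec>" 50) where
  "Unb i \<prec> Unb j \<longleftrightarrow> i < j"
| "Unb i \<prec> Bar j \<longleftrightarrow> True"
| "Bar i \<prec> Unb j \<longleftrightarrow> False"
| "Bar i \<prec> Bar j \<longleftrightarrow> j < i"

definition letter_le :: "letter \<Rightarrow> letter \<Rightarrow> bool"  (infix "\<preceq>" 50) where
  "x \<preceq> y \<longleftrightarrow> x \<prec> y \<or> x = y"

definition alphabet :: "cartan \<Rightarrow> nat \<Rightarrow> letter set" where
  "alphabet g n = (case g of TypeA \<Rightarrow> Unb ` {1..Suc n} | TypeC \<Rightarrow> Unb ` {1..n} \<union> Bar ` {1..n})"

fun vec_wt :: "nat \<Rightarrow> letter \<Rightarrow> weight" where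
  "vec_wt n (Unb j) = eps_weight n j"
| "vec_wt n (Bar j) = (\<lambda>i. - eps_weight n j i)"

fun vec_f :: "cartan \<Rightarrow> nat \<Rightarrow> nat \<Rightarrow> letter \<Rightarrow> letter option" where
  "vec_f g n i (Unb j) =
     (if j = i then Some (if g = TypeC \<and> i = n then Bar n else Unb (Suc i)) else None)"
| "vec_f g n i (Bar j) =
     (if g = TypeC \<and> i < n \<and> j = Suc i then Some (Bar i) else None)"

fun vec_e :: "cartan \<Rightarrow> nat \<Rightarrow> nat \<Rightarrow> letter \<Rightarrow> letter option" where
  "vec_e g n i (Unb j) =
     (if j = Suc i \<and> \<not> (g = TypeC \<and> i = n) then Some (Unb i) else None)"
| "vec_e g n i (Bar j) =
     (if g = TypeC \<and> i = n \<and> j = n then Some (Unb n)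
      else if g = TypeC \<and> i < n \<and> j = i then Some (Bar (Suc i)) else None)"

lemma vec_e_iff_vec_f: "vec_e g n i b = Some b' \<longleftrightarrow> vec_f g n i b' = Some b"
  by (cases b; cases b') auto

text \<open>All \<open>i\<close>-strings of the vector crystals have length at most one.\<close>

definition vec_signs :: "cartan \<Rightarrow> nat \<Rightarrow> nat \<Rightarrow> letter \<Rightarrow> sign list" where
  "vec_signs g n i b =
     (if vec_e g n i b \<noteq> None then [Minus] else []) @ (if vec_f g n i b \<noteq> None then [Plus] else [])"

definition word_signature :: "cartan \<Rightarrow> nat \<Rightarrow> nat \<Rightarrow> letter list \<Rightarrow> (nat \<times> sign) list" where
  "word_signature g n i w = concat (map (\<lambda>p. map (Pair p) (vec_signs g n i (w ! p))) [0..<length w])"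

definition word_e :: "cartan \<Rightarrow> nat \<Rightarrow> nat \<Rightarrow> letter list \<Rightarrow> letter list option" where
  "word_e g n i w = map_option (\<lambda>p. w[p := the (vec_e g n i (w ! p))])
     (rightmost_minus (word_signature g n i w))"

definition word_f :: "cartan \<Rightarrow> nat \<Rightarrow> nat \<Rightarrow> letter list \<Rightarrow> letter list option" where
  "word_f g n i w = map_option (\<lambda>p. w[p := the (vec_f g n i (w ! p))])
     (leftmost_plus (word_signature g n i w))"

section \<open>Tableaux of reverse shape\<close>

text \<open>
  A tableau is the list of its columns from left to right, and each column is listed from
  bottom to top: the entry in the \<open>k\<close>-th column from the left and the \<open>a\<close>-th row from the bottom
  is \<open>T ! (k - 1) ! (a - 1)\<close>.
\<close>

type_synonym tableau = "letter list list"

definition entry :: "letter list \<Rightarrow> nat \<Rightarrow> letter \<Rightarrow> bool" where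
  "entry C p x \<longleftrightarrow> p \<in> {1..length C} \<and> C ! (p - 1) = x"

definition one_cc :: "letter list \<Rightarrow> bool" where
  "one_cc C \<longleftrightarrow> (\<forall>a p q. entry C p (Unb a) \<and> entry C q (Bar a) \<and> q < p \<longrightarrow>
     int p - int q - 1 \<ge> int (length C) - int a)"

definition two_cc_1 :: "nat \<Rightarrow> letter list \<Rightarrow> letter list \<Rightarrow> bool" where
  "two_cc_1 n C C' \<longleftrightarrow> (\<forall>a p q. entry C p (Unb a) \<and> entry C' q (Bar a) \<and> q < p \<longrightarrow>
     int p - int q \<le> int n - int a)"

definition two_cc_2 :: "letter list \<Rightarrow> letter list \<Rightarrow> bool" where
  "two_cc_2 C C' \<longleftrightarrow> (\<forall>a b p q r s.
     entry C p (Unb a) \<and> entry C' q (Bar a) \<and> q < p \<and>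
     (entry C r (Unb b) \<and> entry C s (Bar b) \<or> entry C' r (Unb b) \<and> entry C' s (Bar b)) \<and>
     q \<le> s \<and> s < r \<and> r \<le> p \<longrightarrow>
     (int p - int r) + (int s - int q) < int b - int a)"

definition tableaux :: "cartan \<Rightarrow> nat \<Rightarrow> nat list \<Rightarrow> tableau set" where
  "tableaux g n is = {T. map length T = is \<and>
     (\<forall>C\<in>set T. set C \<subseteq> alphabet g n) \<and>
     (\<forall>C\<in>set T. \<forall>p q x y. entry C p x \<and> entry C q y \<and> q < p \<longrightarrow> x \<prec> y) \<and>
     (\<forall>k. Suc k < length T \<longrightarrow> (\<forall>p x y. entry (T ! k) p x \<and> entry (T ! Suc k) p y \<longrightarrow> x \<preceq> y)) \<and>
     (g = TypeC \<longrightarrow>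
        (\<forall>C\<in>set T. one_cc C) \<and>
        (\<forall>k. Suc k < length T \<longrightarrow>
           two_cc_1 n (T ! k) (T ! Suc k) \<and> two_cc_2 (T ! k) (T ! Suc k)))}"

text \<open>Columns from right to left, each from top to bottom.\<close>

definition reading :: "tableau \<Rightarrow> letter list" where
  "reading T = concat (map rev (rev T))"

definition unread :: "nat list \<Rightarrow> letter list \<Rightarrow> tableau" where
  "unread is w = (THE T. map length T = is \<and> reading T = w)"

lemma ex1_unread:
  assumes "length w = sum_list is"
  shows "\<exists>!T. map length T = is \<and> reading T = w"
  using assms
proof (induction "is" arbitrary: w)
  case Nil
  then show ?case by (auto simp: reading_def)
next
  case (Cons i "is")
  let ?u = "take (sum_list is) w" and ?v = "drop (sum_list is) w"
  from Cons.prems have u: "length ?u = sum_list is" and v: "length ?v = i" by auto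
  from Cons.IH[OF u] obtain T where T: "map length T = is" "reading T = ?u"
    and uniq: "\<And>T'. map length T' = is \<Longrightarrow> reading T' = ?u \<Longrightarrow> T' = T" by blast
  have len: "length (reading T') = sum_list (map length T')" for T'
    by (induction T') (auto simp: reading_def)
  show ?case
  proof (rule ex1I[of _ "rev ?v # T"], goal_cases)
    case 1
    have "reading (rev ?v # T) = ?u @ ?v" using T(2) by (simp add: reading_def)
    then show ?case using T(1) v by simp
  next
    case (2 T')
    then obtain C T'' where T': "T' = C # T''" "length C = i" "map length T'' = is" by auto
    with 2 have "reading T'' @ rev C = ?u @ ?v" by (simp add: reading_def)
    moreover have "length (reading T'') = length ?u" using len[of T''] T'(3) u by simp
    ultimately have "reading T'' = ?u" "rev C = ?v" by (metis append_eq_append_conv)+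
    then show ?case using uniq T' by (metis rev_rev_ident)
  qed
qed

definition tableau_crystal :: "cartan \<Rightarrow> nat \<Rightarrow> weight \<Rightarrow> tableau crystal" where
  "tableau_crystal g n lam = \<lparr>
     elems = tableaux g n (fund_parts n lam),
     wt = (\<lambda>T i. \<Sum>x\<leftarrow>reading T. vec_wt n x i),
     e_op = (\<lambda>i T. map_option (unread (map length T)) (word_e g n i (reading T))),
     f_op = (\<lambda>i T. map_option (unread (map length T)) (word_f g n i (reading T))),
     e_len = (\<lambda>i T. length (places Minus (word_signature g n i (reading T)))),
     f_len = (\<lambda>i T. length (places Plus (word_signature g n i (reading T)))) \<rparr>"

section \<open>Young walls\<close>

text \<open>
  A column is given by the heights of its front half and its back half, ground-state blocks
  included; a wall assigns a column to each number \<open>m \<ge> 1\<close>, counted from right to left, and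
  the irrelevant number \<open>0\<close> gets the ground-state column.  The ground-state wall is determined
  by \<open>g\<close>, \<open>n\<close> and \<open>N\<close>.
\<close>

type_synonym column = "nat \<times> nat"
type_synonym wall = "nat \<Rightarrow> column"

definition period :: "cartan \<Rightarrow> nat \<Rightarrow> nat" where
  "period g n = (case g of TypeA \<Rightarrow> n + 1 | TypeC \<Rightarrow> 2 * n - 2)"

definition ground_column :: "cartan \<Rightarrow> column" where
  "ground_column g = (case g of TypeA \<Rightarrow> (0, 0) | TypeC \<Rightarrow> (1, 0))"

text \<open>Layers are numbered from \<open>1\<close> upwards; a split layer is a \<open>(0|1)\<close> layer.\<close>

definition split_layer :: "cartan \<Rightarrow> nat \<Rightarrow> nat \<Rightarrow> bool" where
  "split_layer g n h \<longleftrightarrow> g = TypeC \<and> h \<ge> 1 \<and> (h - 1) mod period g n = 0"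

text \<open>
  The color of the block of layer \<open>h\<close> in column \<open>m\<close>, which is the front block if the layer is
  split.  For \<open>C\<^sub>n\<close> the parity is such that the front color is \<open>0\<close> in column \<open>N\<close>.  For \<open>A\<^sub>n\<close> the value at
  \<open>h = 0\<close> is the letter convention for empty columns.
\<close>

definition front_color :: "cartan \<Rightarrow> nat \<Rightarrow> nat \<Rightarrow> nat \<Rightarrow> nat \<Rightarrow> nat" where
  "front_color g n N m h = (case g of
     TypeA \<Rightarrow> nat ((int (N mod (n + 1)) - int m + int h) mod int (n + 1))
   | TypeC \<Rightarrow> (let r = (h - 1) mod period g n in
       if r = 0 then (m + N) mod 2 else if r < n then r + 1 else 2 * n - 1 - r))"

definition back_color :: "cartan \<Rightarrow> nat \<Rightarrow> nat \<Rightarrow> nat \<Rightarrow> nat \<Rightarrow> nat" where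
  "back_color g n N m h = 1 - front_color g n N m h"

definition column_ok :: "cartan \<Rightarrow> nat \<Rightarrow> column \<Rightarrow> bool" where
  "column_ok g n x \<longleftrightarrow> (case x of (f, b) \<Rightarrow>
     fst (ground_column g) \<le> f \<and>
     (f = b \<or> f = Suc b \<and> split_layer g n f \<or> b = Suc f \<and> split_layer g n b))"

definition young_wall :: "cartan \<Rightarrow> nat \<Rightarrow> wall \<Rightarrow> bool" where
  "young_wall g n Y \<longleftrightarrow>
     Y 0 = ground_column g \<and> finite {m. Y m \<noteq> ground_column g} \<and>
     (\<forall>m\<ge>1. column_ok g n (Y m) \<and>
        fst (Y (Suc m)) \<le> fst (Y m) \<and> snd (Y (Suc m)) \<le> snd (Y m))"

definition full_column :: "column \<Rightarrow> bool" where
  "full_column x \<longleftrightarrow> fst x = snd x"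

definition proper :: "cartan \<Rightarrow> nat \<Rightarrow> wall \<Rightarrow> bool" where
  "proper g n Y \<longleftrightarrow> young_wall g n Y \<and>
     (g = TypeC \<longrightarrow> (\<forall>l\<ge>1. \<forall>m\<ge>1. l \<noteq> m \<and> full_column (Y l) \<and> full_column (Y m) \<longrightarrow> Y l \<noteq> Y m))"

text \<open>
  Lowering a column by \<open>period g n\<close> layers removes one complete period from its top part;
  ground-state blocks are kept because of \<open>column_ok\<close>.
\<close>

definition reduced :: "cartan \<Rightarrow> nat \<Rightarrow> wall \<Rightarrow> bool" where
  "reduced g n Y \<longleftrightarrow> (\<forall>m\<ge>1. \<forall>f b.
     Y m = (f + period g n, b + period g n) \<longrightarrow> \<not> proper g n (Y(m := (f, b))))"

text \<open>
  \<open>puts_block g n N i m x y\<close>: column \<open>y\<close> is obtained from \<open>x\<close>, as the column with number \<open>m\<close>,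
  by putting one block of color \<open>i\<close> on its top.
\<close>

inductive puts_block ::
    "cartan \<Rightarrow> nat \<Rightarrow> nat \<Rightarrow> nat \<Rightarrow> nat \<Rightarrow> column \<Rightarrow> column \<Rightarrow> bool" for g n N i m where
  unit_block: "\<not> split_layer g n (Suc f) \<Longrightarrow> front_color g n N m (Suc f) = i \<Longrightarrow>
    puts_block g n N i m (f, f) (Suc f, Suc f)"
| front_block: "split_layer g n (Suc f) \<Longrightarrow> b = f \<or> b = Suc f \<Longrightarrow> front_color g n N m (Suc f) = i \<Longrightarrow>
    puts_block g n N i m (f, b) (Suc f, b)"
| back_block: "split_layer g n (Suc b) \<Longrightarrow> f = b \<or> f = Suc b \<Longrightarrow> back_color g n N m (Suc b) = i \<Longrightarrow>
    puts_block g n N i m (f, b) (f, Suc b)"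

definition remove_block :: "cartan \<Rightarrow> nat \<Rightarrow> nat \<Rightarrow> nat \<Rightarrow> nat \<Rightarrow> wall \<Rightarrow> wall" where
  "remove_block g n N i m Y = Y(m := (THE x. puts_block g n N i m x (Y m)))"

definition add_block :: "cartan \<Rightarrow> nat \<Rightarrow> nat \<Rightarrow> nat \<Rightarrow> nat \<Rightarrow> wall \<Rightarrow> wall" where
  "add_block g n N i m Y = Y(m := (THE x. puts_block g n N i m (Y m) x))"

definition removable :: "cartan \<Rightarrow> nat \<Rightarrow> nat \<Rightarrow> nat \<Rightarrow> nat \<Rightarrow> wall \<Rightarrow> bool" where
  "removable g n N i m Y \<longleftrightarrow>
     (\<exists>x. puts_block g n N i m x (Y m)) \<and> proper g n (remove_block g n N i m Y)"

definition admissible :: "cartan \<Rightarrow> nat \<Rightarrow> nat \<Rightarrow> nat \<Rightarrow> nat \<Rightarrow> wall \<Rightarrow> bool" where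
  "admissible g n N i m Y \<longleftrightarrow>
     (\<exists>x. puts_block g n N i m (Y m) x) \<and> proper g n (add_block g n N i m Y)"

definition column_signs :: "cartan \<Rightarrow> nat \<Rightarrow> nat \<Rightarrow> nat \<Rightarrow> wall \<Rightarrow> nat \<Rightarrow> sign list" where
  "column_signs g n N i Y m =
     (let r1 = removable g n N i m Y;
          r2 = (r1 \<and> removable g n N i m (remove_block g n N i m Y));
          a1 = admissible g n N i m Y;
          a2 = (a1 \<and> admissible g n N i m (add_block g n N i m Y))
      in if r2 then [Minus, Minus]
         else if r1 \<and> \<not> a1 then [Minus]
         else if r1 \<and> a1 \<and> \<not> a2 then [Minus, Plus]
         else if a1 \<and> \<not> a2 \<and> \<not> r1 then [Plus]
         else if a2 then [Plus, Plus]
         else [])"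

text \<open>
  Only finitely many columns have signs, so the columns are read from left to right by listing
  the numbers of those with signs in decreasing order.
\<close>

definition wall_signature :: "cartan \<Rightarrow> nat \<Rightarrow> nat \<Rightarrow> nat \<Rightarrow> wall \<Rightarrow> (nat \<times> sign) list" where
  "wall_signature g n N i Y =
     concat (map (\<lambda>m. map (Pair m) (column_signs g n N i Y m))
       (rev (sorted_list_of_set {m. 1 \<le> m \<and> column_signs g n N i Y m \<noteq> []})))"

definition wall_e :: "cartan \<Rightarrow> nat \<Rightarrow> nat \<Rightarrow> nat \<Rightarrow> wall \<Rightarrow> wall option" where
  "wall_e g n N i Y = map_option (\<lambda>m. remove_block g n N i m Y)
     (rightmost_minus (wall_signature g n N i Y))"

definition wall_f :: "cartan \<Rightarrow> nat \<Rightarrow> nat \<Rightarrow> nat \<Rightarrow> wall \<Rightarrow> wall option" where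
  "wall_f g n N i Y = map_option (\<lambda>m. add_block g n N i m Y)
     (leftmost_plus (wall_signature g n N i Y))"

text \<open>
  \<open>affine_cartan g n j i\<close> is the value of \<open>h\<^sub>j\<close> on \<open>\<alpha>\<^sub>i\<close>, for \<open>A\<^sub>n\<^sup>(\<^sup>1\<^sup>)\<close> (\<open>n \<ge> 1\<close>) and
  \<open>A\<^bsub>2n-1\<^esub>\<^sup>(\<^sup>2\<^sup>)\<close> (\<open>n \<ge> 3\<close>).  In the second case the nodes \<open>0\<close> and \<open>1\<close> are both joined to \<open>2\<close>, and the
  nodes \<open>1, \<dots>, n\<close> form the diagram \<open>C\<^sub>n\<close> with long root \<open>\<alpha>\<^sub>n\<close>.  In the first case with \<open>n = 1\<close> both
  congruences hold for \<open>i \<noteq> j\<close>, which gives the entry \<open>-2\<close>.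
\<close>

definition affine_cartan :: "cartan \<Rightarrow> nat \<Rightarrow> nat \<Rightarrow> nat \<Rightarrow> int" where
  "affine_cartan g n j i = (case g of
     TypeA \<Rightarrow> 2 * of_bool (i = j) - of_bool (Suc i mod Suc n = j) - of_bool (Suc j mod Suc n = i)
   | TypeC \<Rightarrow>
       if i = j then 2
       else if {i, j} = {0, 1} then 0
       else if {i, j} = {0, 2} then - 1
       else if i = 0 \<or> j = 0 then 0
       else if j = n - 1 \<and> i = n then - 2
       else if i = Suc j \<or> j = Suc i then - 1
       else 0)"

text \<open>The number of \<open>i\<close>-blocks of a column lying above the ground-state column.\<close>

definition column_blocks :: "cartan \<Rightarrow> nat \<Rightarrow> nat \<Rightarrow> nat \<Rightarrow> nat \<Rightarrow> column \<Rightarrow> nat" where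
  "column_blocks g n N i m x =
     card {h. fst (ground_column g) < h \<and> h \<le> fst x \<and> front_color g n N m h = i} +
     card {h. split_layer g n h \<and> h \<le> snd x \<and> back_color g n N m h = i}"

definition added_blocks :: "cartan \<Rightarrow> nat \<Rightarrow> nat \<Rightarrow> wall \<Rightarrow> nat \<Rightarrow> nat" where
  "added_blocks g n N Y i =
     (\<Sum>m\<in>{m. 1 \<le> m \<and> Y m \<noteq> ground_column g}. column_blocks g n N i m (Y m))"

definition ground_index :: "cartan \<Rightarrow> nat \<Rightarrow> nat \<Rightarrow> nat" where
  "ground_index g n N = (case g of TypeA \<Rightarrow> N mod (n + 1) | TypeC \<Rightarrow> N mod 2)"

definition wall_wt :: "cartan \<Rightarrow> nat \<Rightarrow> nat \<Rightarrow> wall \<Rightarrow> weight" where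
  "wall_wt g n N Y = (\<lambda>j. if j \<in> {1..n} then
       of_bool (j = ground_index g n N)
         - (\<Sum>i\<in>{0..n}. int (added_blocks g n N Y i) * affine_cartan g n j i)
     else 0)"

definition column_letter :: "cartan \<Rightarrow> nat \<Rightarrow> nat \<Rightarrow> nat \<Rightarrow> column \<Rightarrow> letter" where
  "column_letter g n N m x = (case x of (f, b) \<Rightarrow> (case g of
     TypeA \<Rightarrow> Unb (front_color g n N m f + 1)
   | TypeC \<Rightarrow>
       if b < f then (if front_color g n N m f = 0 then Unb 1 else Bar 1)
       else if f < b then (if back_color g n N m b = 0 then Unb 1 else Bar 1)
       else if split_layer g n f then Unb 2
       else let r = (f - 1) mod period g n; j = front_color g n N m f in
         if j = n then Bar n
         else if r < n - 1 then Unb (j + 1) else Bar j))"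

section \<open>The set of Young walls attached to a dominant weight\<close>

text \<open>
  Wall columns are grouped into \<open>t\<close> consecutive blocks of lengths \<open>i\<^sub>1, \<dots>, i\<^sub>t\<close>.  Blocks are
  numbered from \<open>0\<close>, so the \<open>a\<close>-th column of block \<open>k\<close> has number \<open>block_start is k + a\<close>.
\<close>

definition block_start :: "nat list \<Rightarrow> nat \<Rightarrow> nat" where
  "block_start is k = sum_list (take k is)"

definition block_of :: "nat list \<Rightarrow> nat \<Rightarrow> nat" where
  "block_of is m = (LEAST k. m \<le> block_start is (Suc k))"

definition top_period :: "cartan \<Rightarrow> nat \<Rightarrow> column \<Rightarrow> nat" where
  "top_period g n x = (max (fst x) (snd x) - 1) div period g n + 1"

definition hw_wall :: "cartan \<Rightarrow> nat \<Rightarrow> nat list \<Rightarrow> wall" where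
  "hw_wall g n is m =
     (if m \<notin> {1..sum_list is} then ground_column g
      else let k = block_of is m; a = m - block_start is k; t = length is in
        (case g of
           TypeA \<Rightarrow> let h = (\<Sum>j\<in>{Suc k..<t}. n + 1 - is ! j) in (h, h)
         | TypeC \<Rightarrow> (THE x. column_ok g n x \<and>
             column_letter g n (sum_list is) m x = Unb (is ! k + 1 - a) \<and>
             top_period g n x = t - k)))"

text \<open>
  The column in the definite description exists and is unique.  The letter \<open>1\<close> in the first
  period needs the \<open>0\<close>-block as ground-state block; it is only used for column \<open>N\<close>.
\<close>

lemma ex1_hw_column:
  assumes "2 \<le> n" "1 \<le> j" "j \<le> n" "1 \<le> p" "p = 1 \<and> j = 1 \<Longrightarrow> even (m + N)"
  shows "\<exists>!x. column_ok TypeC n x \<and> column_letter TypeC n N m x = Unb j \<and> top_period TypeC n x = p"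
proof -
  let ?P = "2 * n - 2"
  define h where "h = Suc ((p - 1) * ?P + (j - 2))"
  have P: "?P > 0" and jP: "j - 2 < ?P" using assms(1,3) by auto
  have hm: "(h - 1) mod ?P = j - 2" "(h - 1) div ?P = p - 1" "h \<ge> 1"
    using P jP by (simp_all add: h_def)
  have h_uniq: "h' = h" if "h' \<ge> 1" "(h' - 1) mod ?P = j - 2" "(h' - 1) div ?P = p - 1" for h'
    using that hm by (metis div_mult_mod_eq Suc_pred' less_eq_Suc_le One_nat_def)
  show ?thesis
  proof (cases "j = 1")
    case False
    with assms have j: "2 \<le> j" by simp
    show ?thesis
    proof (rule ex1I[of _ "(h, h)"], goal_cases)
      case 1
      have "Suc (Suc (j - 2)) = j" using j by simp
      then show ?case using hm j assms
        by (auto simp: column_ok_def ground_column_def column_letter_def split_layer_def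
            period_def front_color_def top_period_def Let_def)
    next
      case (2 x)
      obtain f b where x: "x = (f, b)" by force
      with 2 j have fb: "f = b" "f \<ge> 1"
        by (auto simp: column_ok_def ground_column_def column_letter_def split: if_splits)
      from 2 x fb have "(f - 1) mod ?P = j - 2"
        using assms(1) j by (auto simp: column_letter_def split_layer_def period_def
            front_color_def Let_def split: if_splits)
      moreover from 2 x fb have "(f - 1) div ?P = p - 1"
        by (auto simp: top_period_def period_def)
      ultimately show ?case using h_uniq fb x by simp
    qed
  next
    case True
    have s: "split_layer TypeC n h" using hm True by (simp add: split_layer_def period_def)
    have c: "front_color TypeC n N m h = (m + N) mod 2"
      using hm True by (simp add: front_color_def period_def)
    define x where "x = (if even (m + N) then (h, h - 1) else (h - 1, h))"
    have h2: "h \<ge> 2" if "odd (m + N)"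
      using that assms(4,5) True P by (cases "p = 1") (auto simp: h_def)
    show ?thesis
    proof (rule ex1I[of _ x], goal_cases)
      case 1
      have "column_ok TypeC n x"
        using s hm h2 by (auto simp: x_def column_ok_def ground_column_def)
      moreover have "column_letter TypeC n N m x = Unb j"
        using c hm True by (auto simp: x_def column_letter_def back_color_def mod2_eq_if)
      moreover have "top_period TypeC n x = p"
        using hm assms(4) by (auto simp: x_def top_period_def period_def)
      ultimately show ?case by blast
    next
      case (2 y)
      obtain f b where y: "y = (f, b)" by force
      have ne: "f \<noteq> b"
        using 2 y True by (auto simp: column_letter_def Let_def split: if_splits)
          (auto simp: column_ok_def ground_column_def split_layer_def front_color_def
            period_def Let_def mod_eq_0_iff_dvd split: if_splits)
      define g where "g = max f b"
      have sg: "split_layer TypeC n g"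
        using 2 y ne by (auto simp: column_ok_def g_def max_def)
      then have "(g - 1) mod ?P = j - 2" "g \<ge> 1"
        using True by (auto simp: split_layer_def period_def)
      moreover have "(g - 1) div ?P = p - 1"
        using 2 y by (auto simp: top_period_def period_def g_def)
      ultimately have gh: "g = h" using h_uniq by blast
      have "f = Suc b \<or> b = Suc f" using 2 y ne by (auto simp: column_ok_def)
      then show ?case
        using 2 y gh c True
        by (auto simp: x_def g_def max_def column_letter_def back_color_def mod2_eq_if
            split: if_splits)
    qed
  qed
qed

inductive_set wall_component :: "cartan \<Rightarrow> nat \<Rightarrow> nat \<Rightarrow> wall \<Rightarrow> wall set" for g n N H where
  start: "H \<in> wall_component g n N H"
| e_step: "Y \<in> wall_component g n N H \<Longrightarrow> i \<in> {1..n} \<Longrightarrow> wall_e g n N i Y = Some Y' \<Longrightarrow>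
    proper g n Y' \<Longrightarrow> reduced g n Y' \<Longrightarrow> Y' \<in> wall_component g n N H"
| f_step: "Y \<in> wall_component g n N H \<Longrightarrow> i \<in> {1..n} \<Longrightarrow> wall_f g n N i Y = Some Y' \<Longrightarrow>
    proper g n Y' \<Longrightarrow> reduced g n Y' \<Longrightarrow> Y' \<in> wall_component g n N H"

definition wall_crystal :: "cartan \<Rightarrow> nat \<Rightarrow> weight \<Rightarrow> wall crystal" where
  "wall_crystal g n lam = (let is = fund_parts n lam; N = sum_list is in \<lparr>
     elems = wall_component g n N (hw_wall g n is),
     wt = wall_wt g n N,
     e_op = wall_e g n N,
     f_op = wall_f g n N,
     e_len = (\<lambda>i Y. length (places Minus (wall_signature g n N i Y))),
     f_len = (\<lambda>i Y. length (places Plus (wall_signature g n N i Y))) \<rparr>)"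

definition tableau_of_wall :: "cartan \<Rightarrow> nat \<Rightarrow> weight \<Rightarrow> wall \<Rightarrow> tableau" where
  "tableau_of_wall g n lam Y = (let is = fund_parts n lam in
     map (\<lambda>k. map (\<lambda>a. let m = block_start is k + a in column_letter g n (sum_list is) m (Y m))
         [1..<Suc (is ! k)])
       [0..<length is])"

end

theory Submission
  imports Defs
begin

text \<open>
  Reading off the letters of its columns turns a wall into a filling of the shape of \<open>\<lambda>\<close>.  Every
  filling with strictly increasing columns comes from exactly one wall in which column \<open>m\<close> keeps
  the period of the block of \<open>m\<close>, and this wall is proper.  Its signature is the signature of the
  reading word with some adjacent pairs \<open>+-\<close> left out: the blocks that properness does not allow to
  be put or removed belong to neighbouring columns with letters \<open>i\<close> and \<open>f\<^sub>i i\<close>, whose signs cancel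
  anyway.  So the operators on walls and on words agree.

  It remains to see that the tableaux form one connected component.  For a column \<open>C\<close> let \<open>\<alpha>\<^sub>C(a)\<close> and
  \<open>\<beta>\<^sub>C(a)\<close> count the entries \<open>1, \<dots>, a\<close> and their barred versions, and put
  \<open>d\<^sub>C(b) = b - \<alpha>\<^sub>C(b) - \<beta>\<^sub>C(b)\<close>.  Then (1CC) says \<open>d\<^sub>C \<ge> 0\<close>, and for adjacent columns \<open>C, D\<close>
  weak increase along rows together with (2CC) says
  \<open>\<alpha>\<^sub>C(a) + \<beta>\<^sub>D(a) - a + d\<^sub>C(b) \<ge> 0\<close> and \<open>\<alpha>\<^sub>C(a) + \<beta>\<^sub>D(a) - a + d\<^sub>D(b) + |D| - |C| \<ge> 0\<close> for all
  \<open>a \<le> b \<le> n\<close>.  The operators \<open>e\<^sub>i, f\<^sub>i\<close> change these functions only at the index \<open>i\<close>, and the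
  signature rule gives just enough information on the letters \<open>i, i + 1\<close> and their barred versions
  to keep the inequalities.  A tableau annihilated by all \<open>e\<^sub>i\<close> has columns \<open>1, \<dots>, k\<close>.  Finally,
  no column of the wall of a tableau can be lowered by a period, by the weak increase along
  rows and because a column with \<open>1\<close> and \<open>Bar 1\<close> violates (1CC).
\<close>

section \<open>Signatures\<close>

text \<open>The row form of (1CC) and (2CC) is hard to follow through an operator, because moving
  one letter can create or destroy several of the configurations it mentions. The inequalities
  provide a reserve instead: when a move of color \<open>i\<close> endangers one of them at
  \<open>i\<close>, those at \<open>i - 1\<close> and \<open>i + 1\<close> either leave room for the
  change or force the column or a neighbour to contain a letter whose sign contradicts the choice of
  the moved letter. For this reason cancellation is expressed by signs of partial sums, which
  restrict well to single columns and to adjacent pairs.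

  Wall columns are numbered from right to left and tableau rows from bottom to top, so the letters
  of the wall columns 1, 2, ... form \<open>concat T\<close>, and its reverse is the reading word.
  The comparison of the operators works with column strictness alone (\<open>fill\<close>). The
  tableau conditions enter through closure under the operators and through reducedness, which must
  be known for every tableau because each step inside the component has to end in a reduced
  wall.\<close>

definition net :: "('p \<times> sign) list \<Rightarrow> int" where
  "net s = (\<Sum>x\<leftarrow>s. if snd x = Minus then 1 else - 1)"

lemma net_simps [simp]:
  "net [] = 0" "net ((p, Minus) # s) = net s + 1" "net ((p, Plus) # s) = net s - 1"
  "net (s @ s') = net s + net s'"
  by (simp_all add: net_def)

text \<open>A ballot condition: a minus survives exactly when some prefix has more minus than plus
  signs. Unlike the cancelled list, partial sums pass easily to parts of a word.\<close>

definition no_minus_left :: "('p \<times> sign) list \<Rightarrow> bool" where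
  "no_minus_left v \<longleftrightarrow> (\<forall>v1 v2. v = v1 @ v2 \<longrightarrow> net v1 \<le> 0)"

definition no_plus_left :: "('p \<times> sign) list \<Rightarrow> bool" where
  "no_plus_left u \<longleftrightarrow> (\<forall>u1 u2. u = u1 @ u2 \<longrightarrow> 0 \<le> net u2)"

lemma cancel_Cons: "cancel (x # s) = push_sign x (cancel s)"
  by (simp add: cancel_def)

lemma filter_map_Pair [simp]:
  "filter (\<lambda>x. snd x = c) (map (\<lambda>p. (p, d)) A) = (if c = d then map (\<lambda>p. (p, d)) A else [])"
  by (induction A) auto

lemma cancel_form:
  "cancel s = map (\<lambda>p. (p, Minus)) (places Minus s) @ map (\<lambda>p. (p, Plus)) (places Plus s)"
proof (induction s)
  case Nil
  then show ?case by (simp add: cancel_def places_def)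
next
  case (Cons x s)
  obtain p c where x: "x = (p, c)" by force
  obtain A B where AB: "cancel s = map (\<lambda>p. (p, Minus)) A @ map (\<lambda>p. (p, Plus)) B"
    using Cons.IH by blast
  show ?case
    by (cases c; cases A; cases B) (simp_all add: places_def cancel_Cons x AB comp_def)
qed

lemma places_simps [simp]:
  "places c [] = []"
  "places Minus ((p, Minus) # s) = p # places Minus s"
  "places Plus ((p, Minus) # s) = places Plus s"
  "places Minus ((p, Plus) # s) = tl (places Minus s)"
  "places Plus ((p, Plus) # s) = (if places Minus s = [] then p # places Plus s else places Plus s)"
proof -
  obtain A B where AB: "cancel s = map (\<lambda>p. (p, Minus)) A @ map (\<lambda>p. (p, Plus)) B"
    using cancel_form by blast
  show "places c [] = []" by (simp add: places_def cancel_def)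
  show "places Minus ((p, Minus) # s) = p # places Minus s"
    "places Plus ((p, Minus) # s) = places Plus s"
    "places Minus ((p, Plus) # s) = tl (places Minus s)"
    "places Plus ((p, Plus) # s) = (if places Minus s = [] then p # places Plus s else places Plus s)"
    by (cases A; cases B; simp add: places_def cancel_Cons AB comp_def)+
qed

text \<open>The number of surviving minus signs is the largest net of a prefix. The goal is the case
  \<open>k = 0\<close>, but a plus in front turns the bound \<open>k\<close> into
  \<open>Suc k\<close>, so the induction runs over all \<open>k\<close>.\<close>

lemma length_places_Minus_le_iff:
  "length (places Minus s) \<le> k \<longleftrightarrow> (\<forall>v1 v2. s = v1 @ v2 \<longrightarrow> net v1 \<le> int k)"
proof (induction s arbitrary: k)
  case Nil
  then show ?case by simp
next
  case (Cons x s)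
  obtain p c where x: "x = (p, c)" by force
  have split: "(\<forall>v1 v2. x # s = v1 @ v2 \<longrightarrow> P v1) \<longleftrightarrow>
      P [] \<and> (\<forall>v1 v2. s = v1 @ v2 \<longrightarrow> P (x # v1))" for P
    by (auto simp: Cons_eq_append_conv)
  show ?case
  proof (cases c)
    case Plus
    have "length (places Minus (x # s)) \<le> k \<longleftrightarrow> length (places Minus s) \<le> Suc k"
      by (simp add: x Plus) arith
    then show ?thesis unfolding split by (simp add: Cons.IH x Plus algebra_simps)
  next
    case Minus
    show ?thesis
    proof (cases k)
      case 0
      then show ?thesis unfolding split using Minus
        by (simp add: x) (rule exI[of _ "[]"], simp)
    next
      case (Suc k')
      then show ?thesis unfolding split by (simp add: Cons.IH x Minus)
    qed
  qed
qed

lemma places_Minus_Nil_iff: "places Minus s = [] \<longleftrightarrow> no_minus_left s"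
  using length_places_Minus_le_iff[of s 0] by (simp add: no_minus_left_def)

lemma no_plus_left_Cons: "no_plus_left (x # u) \<longleftrightarrow> no_plus_left u \<and> 0 \<le> net (x # u)"
  by (auto simp: no_plus_left_def Cons_eq_append_conv)

text \<open>A list in which every plus cancels leaves only minus signs, as many as its net, and they
  stand to the left of whatever survives from \<open>t\<close>.\<close>

lemma no_plus_left_append:
  assumes "no_plus_left u"
  shows "places Plus (u @ t) = places Plus t \<and>
    (\<exists>xs. places Minus (u @ t) = xs @ places Minus t \<and> int (length xs) = net u)"
  using assms
proof (induction u)
  case Nil
  then show ?case by simp
next
  case (Cons x u)
  obtain p c where x: "x = (p, c)" by force
  from Cons obtain xs where IH: "places Plus (u @ t) = places Plus t"
    "places Minus (u @ t) = xs @ places Minus t" "int (length xs) = net u" "0 \<le> net (x # u)"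
    by (auto simp: no_plus_left_Cons)
  show ?case
  proof (cases c)
    case Minus
    then show ?thesis using IH by (auto simp: x intro!: exI[of _ "p # xs"])
  next
    case Plus
    with IH x obtain y ys where "xs = y # ys" by (cases xs) auto
    then show ?thesis using IH Plus by (auto simp: x)
  qed
qed

text \<open>The sign acted upon separates a part without surviving plus from a part without
  surviving minus. The same separation describes \<open>rightmost_minus\<close>, and this symmetry
  makes the two operators mutually inverse.\<close>

lemma leftmost_plus_iff:
  "leftmost_plus s = Some p \<longleftrightarrow>
    (\<exists>u v. s = u @ (p, Plus) # v \<and> no_plus_left u \<and> no_minus_left v)"
proof
  assume "\<exists>u v. s = u @ (p, Plus) # v \<and> no_plus_left u \<and> no_minus_left v"
  then obtain u v where "s = u @ (p, Plus) # v" "no_plus_left u" "no_minus_left v" by blast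
  then show "leftmost_plus s = Some p"
    using no_plus_left_append[of u "(p, Plus) # v"]
    by (auto simp: leftmost_plus_def places_Minus_Nil_iff[symmetric])
next
  show "leftmost_plus s = Some p \<Longrightarrow>
    \<exists>u v. s = u @ (p, Plus) # v \<and> no_plus_left u \<and> no_minus_left v"
  proof (induction s)
    case Nil
    then show ?case by (simp add: leftmost_plus_def)
  next
    case (Cons x s)
    obtain q c where x: "x = (q, c)" by force
    show ?case
    proof (cases "c = Plus \<and> places Minus s = []")
      case True
      with Cons.prems show ?thesis
        by (intro exI[of _ "[]"] exI[of _ s])
          (simp add: x leftmost_plus_def places_Minus_Nil_iff no_plus_left_def)
    next
      case False
      then have "leftmost_plus s = Some p" using Cons.prems
        by (cases c) (auto simp: x leftmost_plus_def)
      with Cons.IH obtain u v where uv: "s = u @ (p, Plus) # v" "no_plus_left u" "no_minus_left v"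
        by blast
      \<comment> \<open>For a plus in front, the excluded case means that some minus of
        \<open>s\<close> survives, and the surviving ones are the \<open>net u\<close> minus signs
        left by \<open>u\<close>.\<close>
      have "c = Plus \<Longrightarrow> net u > 0"
        using no_plus_left_append[OF uv(2), of "(p, Plus) # v"] False uv
        by (cases "places Minus s") (auto simp: places_Minus_Nil_iff[symmetric])
      moreover have "net u \<ge> 0" using uv(2) by (auto simp: no_plus_left_def)
      ultimately have "no_plus_left (x # u)" using uv(2)
        by (cases c) (auto simp: x no_plus_left_Cons)
      then show ?thesis using uv by (metis append_Cons)
    qed
  qed
qed

lemma rightmost_minus_iff:
  "rightmost_minus s = Some p \<longleftrightarrow>
    (\<exists>u v. s = u @ (p, Minus) # v \<and> no_plus_left u \<and> no_minus_left v)"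
proof
  assume "\<exists>u v. s = u @ (p, Minus) # v \<and> no_plus_left u \<and> no_minus_left v"
  then obtain u v where "s = u @ (p, Minus) # v" "no_plus_left u" "no_minus_left v" by blast
  then show "rightmost_minus s = Some p"
    using no_plus_left_append[of u "(p, Minus) # v"]
    by (auto simp: rightmost_minus_def places_Minus_Nil_iff[symmetric])
next
  show "rightmost_minus s = Some p \<Longrightarrow>
    \<exists>u v. s = u @ (p, Minus) # v \<and> no_plus_left u \<and> no_minus_left v"
  proof (induction s)
    case Nil
    then show ?case by (simp add: rightmost_minus_def)
  next
    case (Cons x s)
    obtain q c where x: "x = (q, c)" by force
    show ?case
    proof (cases "c = Minus \<and> places Minus s = []")
      case True
      with Cons.prems show ?thesis
        by (intro exI[of _ "[]"] exI[of _ s])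
          (simp add: x rightmost_minus_def places_Minus_Nil_iff no_plus_left_def)
    next
      case False
      then have "rightmost_minus s = Some p" using Cons.prems
        by (cases c; cases "places Minus s") (auto simp: x rightmost_minus_def split: if_splits)
      with Cons obtain u v where uv: "s = u @ (p, Minus) # v" "no_plus_left u" "no_minus_left v"
        by (auto simp: rightmost_minus_def)
      obtain xs where xs: "places Minus s = xs @ [p]" "int (length xs) = net u"
        using no_plus_left_append[OF uv(2), of "(p, Minus) # v"] uv
        by (auto simp: places_Minus_Nil_iff[symmetric])
      have "c = Plus \<Longrightarrow> net u > 0"
        using xs Cons.prems by (cases xs) (auto simp: x rightmost_minus_def)
      moreover have "net u \<ge> 0" using uv(2) by (auto simp: no_plus_left_def)
      ultimately have "no_plus_left (x # u)" using uv(2)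
        by (cases c) (auto simp: x no_plus_left_Cons)
      then show ?thesis using uv by (metis append_Cons)
    qed
  qed
qed

lemma rightmost_minus_None_iff: "rightmost_minus s = None \<longleftrightarrow> no_minus_left s"
  by (simp add: rightmost_minus_def places_Minus_Nil_iff)

section \<open>Signatures of words\<close>

definition letter_net :: "cartan \<Rightarrow> nat \<Rightarrow> nat \<Rightarrow> letter \<Rightarrow> int" where
  "letter_net g n i x = of_bool (vec_e g n i x \<noteq> None) - of_bool (vec_f g n i x \<noteq> None)"

definition word_net :: "cartan \<Rightarrow> nat \<Rightarrow> nat \<Rightarrow> letter list \<Rightarrow> int" where
  "word_net g n i w = (\<Sum>x\<leftarrow>w. letter_net g n i x)"

lemma word_net_simps [simp]:
  "word_net g n i [] = 0"
  "word_net g n i (x # w) = letter_net g n i x + word_net g n i w"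
  "word_net g n i (w @ w') = word_net g n i w + word_net g n i w'"
  by (simp_all add: word_net_def)

lemma vec_signs_cases:
  obtains "vec_e g n i x = None" "vec_f g n i x = None" "vec_signs g n i x = []"
    "letter_net g n i x = 0"
  | "vec_e g n i x \<noteq> None" "vec_f g n i x = None" "vec_signs g n i x = [Minus]"
    "letter_net g n i x = 1"
  | "vec_e g n i x = None" "vec_f g n i x \<noteq> None" "vec_signs g n i x = [Plus]"
    "letter_net g n i x = - 1"
proof -
  have "vec_e g n i x = None \<or> vec_f g n i x = None" by (cases x) auto
  then show ?thesis using that
    by (cases "vec_e g n i x"; cases "vec_f g n i x") (auto simp: vec_signs_def letter_net_def)
qed

fun signature_from :: "cartan \<Rightarrow> nat \<Rightarrow> nat \<Rightarrow> nat \<Rightarrow> letter list \<Rightarrow> (nat \<times> sign) list" where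
  "signature_from g n i k [] = []"
| "signature_from g n i k (x # w) =
     map (Pair k) (vec_signs g n i x) @ signature_from g n i (Suc k) w"

lemma word_signature_eq: "word_signature g n i w = signature_from g n i 0 w"
proof -
  have "concat (map (\<lambda>p. map (Pair p) (vec_signs g n i ((u @ w) ! p))) [length u..<length (u @ w)])
      = signature_from g n i (length u) w" for u
  proof (induction w arbitrary: u)
    case (Cons x w)
    show ?case using Cons.IH[of "u @ [x]"]
      by (simp add: upt_conv_Cons nth_append del: upt_Suc)
  qed simp
  from this[of "[]"] show ?thesis by (simp add: word_signature_def)
qed

lemma signature_from_append:
  "signature_from g n i k (u @ v) = signature_from g n i k u @ signature_from g n i (k + length u) v"
  by (induction u arbitrary: k) simp_all

lemma net_signature_from: "net (signature_from g n i k w) = word_net g n i w"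
proof (induction w arbitrary: k)
  case (Cons x w)
  then show ?case by (cases rule: vec_signs_cases[of g n i x]) auto
qed simp

text \<open>A letter carries at most one sign, so no cut of the sign list falls inside a
  letter.\<close>

lemma signature_from_splitD:
  assumes "signature_from g n i k w = s @ t"
  shows "\<exists>u v. w = u @ v \<and> s = signature_from g n i k u \<and> t = signature_from g n i (k + length u) v"
  using assms
proof (induction w arbitrary: k s)
  case (Cons x w)
  show ?case
  proof (cases s)
    case Nil
    then show ?thesis using Cons.prems by (intro exI[of _ "[]"] exI[of _ "x # w"]) simp
  next
    case (Cons y s')
    show ?thesis
    proof (cases "vec_signs g n i x = []")
      case True
      then have "signature_from g n i (Suc k) w = s @ t" using Cons.prems by simp
      from Cons.IH[OF this] obtain u v where "w = u @ v" "s = signature_from g n i (Suc k) u"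
        "t = signature_from g n i (Suc k + length u) v" by blast
      then show ?thesis using True by (intro exI[of _ "x # u"] exI[of _ v]) simp
    next
      case False
      then obtain c where c: "vec_signs g n i x = [c]" by (cases rule: vec_signs_cases[of g n i x]) auto
      then have y: "y = (k, c)" and "signature_from g n i (Suc k) w = s' @ t"
        using Cons.prems Cons by auto
      from Cons.IH[OF this(2)] obtain u v where "w = u @ v" "s' = signature_from g n i (Suc k) u"
        "t = signature_from g n i (Suc k + length u) v" by blast
      then show ?thesis using c y Cons by (intro exI[of _ "x # u"] exI[of _ v]) simp
    qed
  qed
qed simp

lemma signature_from_ConsD:
  assumes "signature_from g n i k w = (p, c) # t"
  shows "\<exists>u x v. w = u @ x # v \<and> signature_from g n i k u = [] \<and> p = k + length u \<and>
    vec_signs g n i x = [c] \<and> t = signature_from g n i (Suc p) v"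
  using assms
proof (induction w arbitrary: k)
  case (Cons x w)
  show ?case
  proof (cases "vec_signs g n i x = []")
    case True
    then have "signature_from g n i (Suc k) w = (p, c) # t" using Cons.prems by simp
    from Cons.IH[OF this] obtain u y v where "w = u @ y # v" "signature_from g n i (Suc k) u = []"
      "p = Suc k + length u" "vec_signs g n i y = [c]" "t = signature_from g n i (Suc p) v" by blast
    then show ?thesis using True by (intro exI[of _ "x # u"] exI[of _ y] exI[of _ v]) simp
  next
    case False
    then obtain c' where "vec_signs g n i x = [c']" by (cases rule: vec_signs_cases[of g n i x]) auto
    then show ?thesis using Cons.prems by (intro exI[of _ "[]"] exI[of _ x] exI[of _ w]) auto
  qed
qed simp

definition no_minus_word :: "cartan \<Rightarrow> nat \<Rightarrow> nat \<Rightarrow> letter list \<Rightarrow> bool" where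
  "no_minus_word g n i v \<longleftrightarrow> (\<forall>v1 v2. v = v1 @ v2 \<longrightarrow> word_net g n i v1 \<le> 0)"

definition no_plus_word :: "cartan \<Rightarrow> nat \<Rightarrow> nat \<Rightarrow> letter list \<Rightarrow> bool" where
  "no_plus_word g n i u \<longleftrightarrow> (\<forall>u1 u2. u = u1 @ u2 \<longrightarrow> 0 \<le> word_net g n i u2)"

lemma no_minus_left_signature_from:
  "no_minus_left (signature_from g n i k v) \<longleftrightarrow> no_minus_word g n i v"
  unfolding no_minus_left_def no_minus_word_def
  by (metis signature_from_splitD signature_from_append net_signature_from)

lemma no_plus_left_signature_from:
  "no_plus_left (signature_from g n i k u) \<longleftrightarrow> no_plus_word g n i u"
  unfolding no_plus_left_def no_plus_word_def
  by (metis signature_from_splitD signature_from_append net_signature_from)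

lemma signature_split_iff:
  "(\<exists>s t. word_signature g n i w = s @ (p, c) # t \<and> no_plus_left s \<and> no_minus_left t) \<longleftrightarrow>
    (\<exists>u x v. w = u @ x # v \<and> p = length u \<and> vec_signs g n i x = [c] \<and>
      no_plus_word g n i u \<and> no_minus_word g n i v)" (is "?L \<longleftrightarrow> ?R")
proof
  assume ?L
  then obtain s t where st: "signature_from g n i 0 w = s @ (p, c) # t" "no_plus_left s"
    "no_minus_left t" by (auto simp: word_signature_eq)
  from signature_from_splitD[OF st(1)] obtain u v where uv: "w = u @ v"
    "s = signature_from g n i 0 u" "signature_from g n i (length u) v = (p, c) # t" by auto
  from signature_from_ConsD[OF uv(3)] obtain u' x v' where *: "v = u' @ x # v'"
    "signature_from g n i (length u) u' = []" "p = length u + length u'"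
    "vec_signs g n i x = [c]" "t = signature_from g n i (Suc p) v'" by blast
  have "s = signature_from g n i 0 (u @ u')" using uv * by (simp add: signature_from_append)
  then show ?R using uv(1) * st(2,3)
    by (intro exI[of _ "u @ u'"] exI[of _ x] exI[of _ v'])
      (simp add: no_plus_left_signature_from no_minus_left_signature_from)
next
  assume ?R
  then obtain u x v where "w = u @ x # v" "p = length u" "vec_signs g n i x = [c]"
    "no_plus_word g n i u" "no_minus_word g n i v" by blast
  then show ?L
    by (intro exI[of _ "signature_from g n i 0 u"] exI[of _ "signature_from g n i (Suc p) v"])
      (simp add: word_signature_eq signature_from_append no_plus_left_signature_from
        no_minus_left_signature_from)
qed

lemma vec_signs_iff:
  "vec_signs g n i x = [Plus] \<longleftrightarrow> vec_f g n i x \<noteq> None"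
  "vec_signs g n i x = [Minus] \<longleftrightarrow> vec_e g n i x \<noteq> None"
  by (cases rule: vec_signs_cases[of g n i x]; auto)+

lemma leftmost_plus_word_iff:
  "leftmost_plus (word_signature g n i w) = Some p \<longleftrightarrow>
    (\<exists>u x y v. w = u @ x # v \<and> p = length u \<and> vec_f g n i x = Some y \<and>
      no_plus_word g n i u \<and> no_minus_word g n i v)"
  unfolding leftmost_plus_iff signature_split_iff vec_signs_iff by (metis not_None_eq)

lemma rightmost_minus_word_iff:
  "rightmost_minus (word_signature g n i w) = Some p \<longleftrightarrow>
    (\<exists>u x y v. w = u @ x # v \<and> p = length u \<and> vec_e g n i x = Some y \<and>
      no_plus_word g n i u \<and> no_minus_word g n i v)"
  unfolding rightmost_minus_iff signature_split_iff vec_signs_iff by (metis not_None_eq)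

lemma word_f_iff:
  "word_f g n i w = Some w' \<longleftrightarrow>
    (\<exists>u x y v. w = u @ x # v \<and> w' = u @ y # v \<and> vec_f g n i x = Some y \<and>
      no_plus_word g n i u \<and> no_minus_word g n i v)"
proof -
  have "word_f g n i w = Some w' \<longleftrightarrow> (\<exists>p. leftmost_plus (word_signature g n i w) = Some p \<and>
      w' = w[p := the (vec_f g n i (w ! p))])"
    by (auto simp: word_f_def)
  then show ?thesis unfolding leftmost_plus_word_iff by fastforce
qed

lemma word_e_iff:
  "word_e g n i w = Some w' \<longleftrightarrow>
    (\<exists>u x y v. w = u @ x # v \<and> w' = u @ y # v \<and> vec_e g n i x = Some y \<and>
      no_plus_word g n i u \<and> no_minus_word g n i v)"
proof -
  have "word_e g n i w = Some w' \<longleftrightarrow> (\<exists>p. rightmost_minus (word_signature g n i w) = Some p \<and>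
      w' = w[p := the (vec_e g n i (w ! p))])"
    by (auto simp: word_e_def)
  then show ?thesis unfolding rightmost_minus_word_iff by fastforce
qed

lemma word_e_iff_word_f: "word_e g n i w = Some w' \<longleftrightarrow> word_f g n i w' = Some w"
  unfolding word_e_iff word_f_iff vec_e_iff_vec_f by blast

lemma word_e_None_iff: "word_e g n i w = None \<longleftrightarrow> no_minus_word g n i w"
  by (simp add: word_e_def rightmost_minus_None_iff word_signature_eq no_minus_left_signature_from)

section \<open>Tableau conditions as inequalities between counting functions\<close>

lemma letter_less_irrefl [simp]: "\<not> x \<prec> x"
  by (cases x) auto

lemma letter_less_trans: "x \<prec> y \<Longrightarrow> y \<prec> z \<Longrightarrow> x \<prec> z"
  by (cases x; cases y; cases z) auto

lemma letter_le_iff_not_less: "x \<preceq> y \<longleftrightarrow> \<not> y \<prec> x"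
  by (cases x; cases y) (auto simp: letter_le_def)

lemma letter_le_trans: "x \<preceq> y \<Longrightarrow> y \<preceq> z \<Longrightarrow> x \<preceq> z"
  by (auto simp: letter_le_def intro: letter_less_trans)

lemma letter_le_simps [simp]:
  "x \<preceq> x" "Unb i \<preceq> Unb j \<longleftrightarrow> i \<le> j" "Unb i \<preceq> Bar j" "\<not> Bar i \<preceq> Unb j" "Bar i \<preceq> Bar j \<longleftrightarrow> j \<le> i"
  by (auto simp: letter_le_def)

section \<open>Columns as strictly decreasing lists\<close>

abbreviation decreasing :: "letter list \<Rightarrow> bool" where
  "decreasing \<equiv> sorted_wrt (\<lambda>x y. y \<prec> x)"

lemma decreasing_distinct: "decreasing C \<Longrightarrow> distinct C"
  by (induction C) auto

text \<open>Columns are listed from the bottom, hence decreasing, so the entries \<succeq> z fill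
  the lowest rows. For an entry \<open>x\<close> of the column, \<open>upper x C\<close> is
  therefore its row.\<close>

definition upper :: "letter \<Rightarrow> letter list \<Rightarrow> nat" where
  "upper z C = length (filter (\<lambda>y. z \<preceq> y) C)"

lemma upper_le_length: "upper z C \<le> length C"
  by (simp add: upper_def)

lemma less_upper_iff:
  "decreasing C \<Longrightarrow> p < length C \<Longrightarrow> p < upper z C \<longleftrightarrow> z \<preceq> C ! p"
proof (induction C arbitrary: p)
  case (Cons x C)
  show ?case
  proof (cases "z \<preceq> x")
    case True
    then show ?thesis using Cons by (cases p) (auto simp: upper_def)
  next
    case False
    then have "\<not> z \<preceq> y" if "y \<in> set (x # C)" for y
      using that Cons.prems by (auto simp: letter_le_iff_not_less intro: letter_less_trans)
    then have "upper z (x # C) = 0" "\<not> z \<preceq> (x # C) ! p"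
      using Cons.prems(2) nth_mem[of p "x # C"] by (auto simp: upper_def filter_empty_conv simp del: nth_mem)
    then show ?thesis by simp
  qed
qed simp

lemma entry_iff_upper:
  assumes "decreasing C"
  shows "entry C p x \<longleftrightarrow> x \<in> set C \<and> p = upper x C"
proof -
  have *: "p = upper x C" if "entry C p x" for p
  proof -
    from that have p: "p \<ge> 1" "p \<le> length C" "C ! (p - 1) = x" by (auto simp: entry_def)
    then have 1: "p - 1 < upper x C" using less_upper_iff[OF assms, of "p - 1" x] by simp
    have "\<not> p < upper x C"
    proof
      assume a: "p < upper x C"
      then have "p < length C" using upper_le_length[of x C] by simp
      with a have "x \<preceq> C ! p" using less_upper_iff[OF assms] by blast
      moreover have "C ! p \<prec> C ! (p - 1)"
        using sorted_wrt_nth_less[OF assms, of "p - 1" p] \<open>p < length C\<close> p(1) by simp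
      ultimately show False using p by (simp add: letter_le_iff_not_less)
    qed
    with 1 show ?thesis by simp
  qed
  have "\<exists>p. entry C p x" if x: "x \<in> set C"
  proof -
    from x obtain j where "j < length C" "C ! j = x" by (auto simp: in_set_conv_nth)
    then have "entry C (Suc j) x" by (simp add: entry_def)
    then show ?thesis ..
  qed
  moreover have "x \<in> set C" if "entry C p x" for p
    using that by (auto simp: entry_def)
  ultimately show ?thesis using * by blast
qed

text \<open>With rows counted from 0, the entry in row \<open>p\<close> is \<succeq> z iff
  \<open>p < upper z C\<close>. So comparing bottom-justified columns row by row amounts to
  comparing the functions \<open>upper\<close>.\<close>

lemma rows_imp_upper_le:
  assumes "decreasing C" "decreasing D" "length C \<le> length D"
    and "\<And>p. p < length C \<Longrightarrow> C ! p \<preceq> D ! p"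
  shows "upper z C \<le> upper z D"
proof (cases "upper z C")
  case (Suc p)
  then have p: "p < upper z C" "p < length C" using upper_le_length[of z C] by auto
  then have "z \<preceq> D ! p"
    using less_upper_iff[OF assms(1)] assms(4) letter_le_trans by blast
  then show ?thesis using p assms less_upper_iff[of D p z] Suc by simp
qed simp

lemma upper_le_imp_rows:
  assumes "decreasing C" "decreasing D" "length C \<le> length D"
    and "\<And>z. z \<in> set C \<Longrightarrow> upper z C \<le> upper z D" and "p < length C"
  shows "C ! p \<preceq> D ! p"
proof -
  have "p < upper (C ! p) C" using assms less_upper_iff by simp
  also have "\<dots> \<le> upper (C ! p) D" using assms by simp
  finally show ?thesis using assms less_upper_iff[of D p "C ! p"] by simp
qed

section \<open>Counting functions of a column\<close>

fun unb_upto :: "letter set \<Rightarrow> nat \<Rightarrow> int" where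
  "unb_upto S 0 = 0"
| "unb_upto S (Suc a) = unb_upto S a + of_bool (Unb (Suc a) \<in> S)"

fun bar_upto :: "letter set \<Rightarrow> nat \<Rightarrow> int" where
  "bar_upto S 0 = 0"
| "bar_upto S (Suc a) = bar_upto S a + of_bool (Bar (Suc a) \<in> S)"

text \<open>
  In terms of \<open>slack\<close> the condition (1CC) reads \<open>0 \<le> slack (set C) b\<close>: a column breaking this for some
  \<open>b\<close> contains both \<open>Unb b\<close> and \<open>Bar b\<close> for the least such \<open>b\<close>.
\<close>

definition slack :: "letter set \<Rightarrow> nat \<Rightarrow> int" where
  "slack S b = int b - unb_upto S b - bar_upto S b"

lemma slack_simps [simp]:
  "slack S 0 = 0"
  "slack S (Suc b) = slack S b + 1 - of_bool (Unb (Suc b) \<in> S) - of_bool (Bar (Suc b) \<in> S)"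
  by (simp_all add: slack_def)

lemma unb_upto_mono: "a \<le> b \<Longrightarrow> unb_upto S a \<le> unb_upto S b \<and> unb_upto S b \<le> unb_upto S a + int (b - a)"
  by (induction b) (auto simp: le_Suc_eq of_bool_def)

lemma bar_upto_mono: "a \<le> b \<Longrightarrow> bar_upto S a \<le> bar_upto S b \<and> bar_upto S b \<le> bar_upto S a + int (b - a)"
  by (induction b) (auto simp: le_Suc_eq of_bool_def)

lemma alphabet_not_0: "set C \<subseteq> alphabet g n \<Longrightarrow> Unb 0 \<notin> set C \<and> Bar 0 \<notin> set C"
  by (cases g) (auto simp: alphabet_def)

lemma upper_Bar:
  assumes "decreasing C" "Bar 0 \<notin> set C"
  shows "int (upper (Bar a) C) = bar_upto (set C) a"
proof -
  have "int (card {y \<in> set C. Bar a \<preceq> y}) = bar_upto (set C) a"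
  proof (induction a)
    case 0
    have "Bar 0 \<preceq> y \<Longrightarrow> y = Bar 0" for y by (cases y) auto
    then have "{y \<in> set C. Bar 0 \<preceq> y} = {}" using assms(2) by auto
    then show ?case by simp
  next
    case (Suc a)
    have "Bar (Suc a) \<preceq> y \<longleftrightarrow> Bar a \<preceq> y \<or> y = Bar (Suc a)" for y by (cases y) auto
    then have "{y \<in> set C. Bar (Suc a) \<preceq> y} = {y \<in> set C. Bar a \<preceq> y} \<union> (if Bar (Suc a) \<in> set C then {Bar (Suc a)} else {})"
      by auto
    then show ?case using Suc by (simp add: card_insert_if)
  qed
  then show ?thesis
    using decreasing_distinct[OF assms(1)]
    by (simp add: upper_def distinct_card[symmetric] del: distinct_card)
qed

lemma upper_Unb:
  assumes "decreasing C" "Unb 0 \<notin> set C"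
  shows "int (upper (Unb (Suc a)) C) = int (length C) - unb_upto (set C) a"
proof -
  have "int (card {y \<in> set C. Unb (Suc a) \<preceq> y}) = int (card (set C)) - unb_upto (set C) a"
  proof (induction a)
    case 0
    have "Unb (Suc 0) \<preceq> y" if "y \<in> set C" for y
    proof (cases y)
      case (Unb j)
      then have "j \<noteq> 0" using that assms(2) by (cases j) auto
      then show ?thesis using Unb by simp
    qed simp
    then have "{y \<in> set C. Unb (Suc 0) \<preceq> y} = set C" by auto
    then show ?case by simp
  next
    case (Suc a)
    have "Unb (Suc a) \<preceq> y \<longleftrightarrow> Unb (Suc (Suc a)) \<preceq> y \<or> y = Unb (Suc a)" for y by (cases y) auto
    then have "{y \<in> set C. Unb (Suc a) \<preceq> y} = {y \<in> set C. Unb (Suc (Suc a)) \<preceq> y} \<union> (if Unb (Suc a) \<in> set C then {Unb (Suc a)} else {})"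
      by auto
    then show ?case using Suc by (cases "Unb (Suc a) \<in> set C") (simp_all add: card_insert_if)
  qed
  then show ?thesis
    using decreasing_distinct[OF assms(1)]
    by (simp add: upper_def distinct_card[symmetric] del: distinct_card)
qed

lemma upper_Unb':
  assumes "decreasing C" "Unb 0 \<notin> set C" "Unb a \<in> set C"
  shows "int (upper (Unb a) C) = int (length C) - unb_upto (set C) a + 1"
  using assms upper_Unb[of C "a - 1"] by (cases a) auto

text \<open>No letter lies strictly between \<open>Unb n\<close> and \<open>Bar n\<close>, so
  counting from \<open>Unb (Suc n)\<close> and counting from \<open>Bar n\<close> give the same
  number.\<close>

lemma unb_plus_bar:
  assumes "decreasing C" "set C \<subseteq> alphabet TypeC n"
  shows "unb_upto (set C) n + bar_upto (set C) n = int (length C)"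
proof -
  have z: "Unb 0 \<notin> set C" "Bar 0 \<notin> set C" using alphabet_not_0[OF assms(2)] by auto
  have "Unb (Suc n) \<preceq> y \<longleftrightarrow> Bar n \<preceq> y" if "y \<in> set C" for y
    using assms(2) that by (auto simp: alphabet_def)
  then have "upper (Unb (Suc n)) C = upper (Bar n) C"
    unfolding upper_def by (metis (mono_tags, lifting) filter_cong)
  then show ?thesis using upper_Unb[OF assms(1) z(1), of n] upper_Bar[OF assms(1) z(2), of n] by simp
qed

text \<open>Barred letters exceed unbarred ones and lie in lower rows. Hence \<open>q < p\<close> in
  (1CC) and \<open>s < r\<close> in (2CC-2), which compare entries of one column, hold by
  themselves.\<close>

lemma upper_Bar_less_Unb:
  assumes "decreasing C" "Unb a \<in> set C"
  shows "upper (Bar b) C < upper (Unb a) C"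
proof -
  have "set (filter (\<lambda>y. Bar b \<preceq> y) C) \<subset> set (filter (\<lambda>y. Unb a \<preceq> y) C)"
  proof -
    have "Bar b \<preceq> y \<Longrightarrow> Unb a \<preceq> y" for y by (cases y) auto
    moreover have "Unb a \<in> set (filter (\<lambda>y. Unb a \<preceq> y) C)" "Unb a \<notin> set (filter (\<lambda>y. Bar b \<preceq> y) C)"
      using assms(2) by auto
    ultimately show ?thesis by (intro psubsetI) (auto simp del: letter_le_simps)
  qed
  from psubset_card_mono[OF _ this] show ?thesis
    using decreasing_distinct[OF assms(1)] by (simp add: upper_def distinct_card del: set_filter)
qed

lemma one_cc_iff_slack:
  assumes "decreasing C" "set C \<subseteq> alphabet TypeC n"
  shows "one_cc C \<longleftrightarrow> (\<forall>b\<le>n. 0 \<le> slack (set C) b)"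
proof -
  have z: "Unb 0 \<notin> set C" "Bar 0 \<notin> set C" using alphabet_not_0[OF assms(2)] by auto
  have *: "one_cc C \<longleftrightarrow> (\<forall>a. Unb a \<in> set C \<and> Bar a \<in> set C \<longrightarrow> 0 \<le> slack (set C) a)"
    unfolding one_cc_def entry_iff_upper[OF assms(1)]
    using upper_Bar_less_Unb[OF assms(1)]
    by (auto simp: upper_Unb'[OF assms(1) z(1)] upper_Bar[OF assms(1) z(2)] slack_def)
  show ?thesis
  proof
    assume cc: "one_cc C"
    have "0 \<le> slack (set C) b" for b
    proof (induction b)
      case (Suc b)
      show ?case
      proof (cases "Unb (Suc b) \<in> set C \<and> Bar (Suc b) \<in> set C")
        case True
        then show ?thesis using cc unfolding * by blast
      next
        case False
        then show ?thesis using Suc by (auto simp: of_bool_def)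
      qed
    qed simp
    then show "\<forall>b\<le>n. 0 \<le> slack (set C) b" by blast
  next
    assume "\<forall>b\<le>n. 0 \<le> slack (set C) b"
    then show "one_cc C" unfolding * using assms(2) by (auto simp: alphabet_def)
  qed
qed

section \<open>Conditions on single columns and on adjacent pairs\<close>

definition col_adm :: "cartan \<Rightarrow> nat \<Rightarrow> letter list \<Rightarrow> bool" where
  "col_adm g n C \<longleftrightarrow> decreasing C \<and> set C \<subseteq> alphabet g n \<and>
     (g = TypeC \<longrightarrow> (\<forall>b\<le>n. 0 \<le> slack (set C) b))"

text \<open>
  (2CC-1) needs no inequality of its own: it follows from the first one with \<open>b = n\<close>.
\<close>

definition pair_adm :: "cartan \<Rightarrow> nat \<Rightarrow> letter list \<Rightarrow> letter list \<Rightarrow> bool" where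
  "pair_adm g n C D \<longleftrightarrow> (case g of
     TypeA \<Rightarrow> \<forall>a. int (length C) - unb_upto (set C) a \<le> int (length D) - unb_upto (set D) a
   | TypeC \<Rightarrow> \<forall>a b. a \<le> b \<and> b \<le> n \<longrightarrow>
       0 \<le> unb_upto (set C) a + bar_upto (set D) a - int a + slack (set C) b \<and>
       0 \<le> unb_upto (set C) a + bar_upto (set D) a - int a + slack (set D) b
           + int (length D) - int (length C))"

definition rows_weak :: "letter list \<Rightarrow> letter list \<Rightarrow> bool" where
  "rows_weak C D \<longleftrightarrow> (\<forall>p x y. entry C p x \<and> entry D p y \<longrightarrow> x \<preceq> y)"

lemma rows_weak_iff:
  assumes "length C \<le> length D"
  shows "rows_weak C D \<longleftrightarrow> (\<forall>p<length C. C ! p \<preceq> D ! p)"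
proof
  assume r: "rows_weak C D"
  show "\<forall>p<length C. C ! p \<preceq> D ! p"
  proof (intro allI impI)
    fix p assume "p < length C"
    then have "entry C (Suc p) (C ! p)" "entry D (Suc p) (D ! p)" using assms by (auto simp: entry_def)
    then show "C ! p \<preceq> D ! p" using r unfolding rows_weak_def by blast
  qed
next
  assume "\<forall>p<length C. C ! p \<preceq> D ! p"
  then have "C ! (p - 1) \<preceq> D ! (p - 1)" if "p \<in> {1..length C}" for p
    using that by (metis One_nat_def Suc_le_eq Suc_pred atLeastAtMost_iff)
  then show "rows_weak C D" unfolding rows_weak_def entry_def by blast
qed

lemma pair_adm_TypeA:
  assumes "decreasing C" "decreasing D" "length C \<le> length D"
    and "set C \<subseteq> alphabet TypeA n" "set D \<subseteq> alphabet TypeA n"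
  shows "rows_weak C D \<longleftrightarrow> pair_adm TypeA n C D"
proof -
  have z: "Unb 0 \<notin> set C" "Unb 0 \<notin> set D" using alphabet_not_0 assms by blast+
  have u: "int (length C) - unb_upto (set C) a \<le> int (length D) - unb_upto (set D) a \<longleftrightarrow>
      upper (Unb (Suc a)) C \<le> upper (Unb (Suc a)) D" for a
    using upper_Unb[OF assms(1) z(1), of a] upper_Unb[OF assms(2) z(2), of a] by linarith
  show ?thesis
    unfolding rows_weak_iff[OF assms(3)] pair_adm_def cartan.case u
  proof
    assume "\<forall>p<length C. C ! p \<preceq> D ! p"
    then show "\<forall>a. upper (Unb (Suc a)) C \<le> upper (Unb (Suc a)) D"
      using rows_imp_upper_le[OF assms(1-3)] by blast
  next
    assume a: "\<forall>a. upper (Unb (Suc a)) C \<le> upper (Unb (Suc a)) D"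
    have "upper x C \<le> upper x D" if x: "x \<in> set C" for x
    proof -
      obtain j where "x = Unb j" "j \<ge> 1" using assms(4) x by (auto simp: alphabet_def)
      then show ?thesis using a[rule_format, of "j - 1"] by simp
    qed
    then show "\<forall>p<length C. C ! p \<preceq> D ! p"
      using upper_le_imp_rows[OF assms(1-3)] by blast
  qed
qed

lemma pair_adm_TypeC:
  assumes CD: "decreasing C" "decreasing D" "length C \<le> length D"
    and al: "set C \<subseteq> alphabet TypeC n" "set D \<subseteq> alphabet TypeC n"
  shows "rows_weak C D \<and> two_cc_1 n C D \<and> two_cc_2 C D \<longleftrightarrow> pair_adm TypeC n C D"
proof -
  \<comment> \<open>For \<open>E = C\<close> the length terms cancel, so \<open>F\<close> stands for
    both inequalities of \<open>pair_adm\<close>.\<close>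
  define F where "F E a b = unb_upto (set C) a + bar_upto (set D) a - int a + slack (set E) b
    + int (length E) - int (length C)" for E a b
  have dec: "decreasing E" and alE: "set E \<subseteq> alphabet TypeC n" if "E \<in> {C, D}" for E
    using that CD al by auto
  have z: "Unb 0 \<notin> set E" "Bar 0 \<notin> set E" if "E \<in> {C, D}" for E
    using alphabet_not_0[OF alE[OF that]] by auto
  have up: "int (upper (Bar a) E) = bar_upto (set E) a"
    "Unb a \<in> set E \<Longrightarrow> int (upper (Unb a) E) = int (length E) - unb_upto (set E) a + 1"
    "int (upper (Unb (Suc a)) E) = int (length E) - unb_upto (set E) a" if "E \<in> {C, D}" for E a
    using upper_Bar upper_Unb' upper_Unb dec[OF that] z[OF that] by auto
  have mono: "unb_upto (set E) a \<le> unb_upto (set E) b" "bar_upto (set E) a \<le> bar_upto (set E) b"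
    "unb_upto (set E) b \<le> unb_upto (set E) a + int b - int a"
    "bar_upto (set E) b \<le> bar_upto (set E) a + int b - int a" if "a \<le> b" for E a b
    using unb_upto_mono[OF that, of "set E"] bar_upto_mono[OF that, of "set E"] that by auto
  \<comment> \<open>On the diagonal, \<open>F C a a\<close> is the difference of the values of
    \<open>upper\<close> at \<open>Bar a\<close>, and \<open>F D a a\<close> the difference of its
    values at \<open>Unb (Suc a)\<close>.\<close>
  have rows: "rows_weak C D \<longleftrightarrow> (\<forall>E\<in>{C, D}. \<forall>a\<le>n. 0 \<le> F E a a)"
  proof
    assume "rows_weak C D"
    then have "upper x C \<le> upper x D" for x
      using rows_imp_upper_le[OF CD] unfolding rows_weak_iff[OF CD(3)] by blast
    from this[of "Bar _"] this[of "Unb (Suc _)"] show "\<forall>E\<in>{C, D}. \<forall>a\<le>n. 0 \<le> F E a a"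
      using up(1,3)[of C] up(1,3)[of D] by (auto simp: F_def slack_def)
        (smt (verit) of_nat_le_iff)+
  next
    assume R: "\<forall>E\<in>{C, D}. \<forall>a\<le>n. 0 \<le> F E a a"
    have "upper x C \<le> upper x D" if x: "x \<in> set C" for x
    proof (cases x)
      case (Unb j)
      then have "j \<noteq> 0" "j \<le> n" using x al(1) by (auto simp: alphabet_def)
      then obtain a where "j = Suc a" "a \<le> n" by (cases j) auto
      then show ?thesis using R up(3)[of C a] up(3)[of D a] Unb by (auto simp: F_def slack_def)
    next
      case (Bar j)
      then have "j \<le> n" using x al(1) by (auto simp: alphabet_def)
      then show ?thesis using R up(1)[of C j] up(1)[of D j] Bar by (auto simp: F_def slack_def)
    qed
    then show "rows_weak C D"
      unfolding rows_weak_iff[OF CD(3)] using upper_le_imp_rows[OF CD] by blast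
  qed
  \<comment> \<open>The rows of (2CC-2) in terms of counts. Of the chain only
    \<open>q \<le> s\<close> and \<open>r \<le> p\<close> remain: \<open>s < r\<close> holds inside
    a column, and then \<open>q < p\<close> follows.\<close>
  define config where "config E a b \<longleftrightarrow> Unb a \<in> set C \<and> Bar a \<in> set D \<and> Unb b \<in> set E \<and> Bar b \<in> set E \<and>
    bar_upto (set D) a \<le> bar_upto (set E) b \<and>
    int (length E) - unb_upto (set E) b \<le> int (length C) - unb_upto (set C) a" for E a b
  have cc2: "two_cc_2 C D \<longleftrightarrow> (\<forall>E\<in>{C, D}. \<forall>a b. config E a b \<longrightarrow>
    (int (length C) - unb_upto (set C) a) - (int (length E) - unb_upto (set E) b)
      + (bar_upto (set E) b - bar_upto (set D) a) < int b - int a)"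
  proof -
    have E: "(\<forall>p q r s. (Unb a \<in> set C \<and> p = upper (Unb a) C) \<and> (Bar a \<in> set D \<and> q = upper (Bar a) D) \<and> q < p \<and>
        ((Unb b \<in> set E \<and> r = upper (Unb b) E) \<and> Bar b \<in> set E \<and> s = upper (Bar b) E) \<and>
        q \<le> s \<and> s < r \<and> r \<le> p \<longrightarrow> int p - int r + (int s - int q) < int b - int a) \<longleftrightarrow>
      (config E a b \<longrightarrow> (int (length C) - unb_upto (set C) a) - (int (length E) - unb_upto (set E) b)
        + (bar_upto (set E) b - bar_upto (set D) a) < int b - int a)" if "E \<in> {C, D}" for E a b
      unfolding config_def
      using up(1,2)[of C a] up(1,2)[of D a] up(1,2)[OF that, of b] upper_Bar_less_Unb[OF dec[OF that], of b b]
      by (simp, linarith)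
    have "two_cc_2 C D \<longleftrightarrow> (\<forall>E\<in>{C, D}. \<forall>a b. \<forall>p q r s.
        (Unb a \<in> set C \<and> p = upper (Unb a) C) \<and> (Bar a \<in> set D \<and> q = upper (Bar a) D) \<and> q < p \<and>
        ((Unb b \<in> set E \<and> r = upper (Unb b) E) \<and> Bar b \<in> set E \<and> s = upper (Bar b) E) \<and>
        q \<le> s \<and> s < r \<and> r \<le> p \<longrightarrow> int p - int r + (int s - int q) < int b - int a)"
      unfolding two_cc_2_def entry_iff_upper[OF CD(1)] entry_iff_upper[OF CD(2)] by blast
    then show ?thesis using E by blast
  qed
  have pa: "pair_adm TypeC n C D \<longleftrightarrow> (\<forall>E\<in>{C, D}. \<forall>a b. a \<le> b \<and> b \<le> n \<longrightarrow> 0 \<le> F E a b)"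
    by (auto simp: pair_adm_def F_def)
  show ?thesis
  proof (intro iffI; (elim conjE)?)
    assume r: "rows_weak C D" and c2: "two_cc_2 C D"
    text \<open>A violation with \<open>b - a\<close> minimal exhibits a configuration forbidden by (2CC-2).\<close>
    have "b \<le> n \<longrightarrow> 0 \<le> F E a b" if E: "E \<in> {C, D}" and "a \<le> b" for E a b
      using that(2)
    proof (induction "b - a" arbitrary: a b rule: less_induct)
      case less
      show ?case
      proof (intro impI, rule ccontr)
        assume bn: "b \<le> n" and neg: "\<not> 0 \<le> F E a b"
        then have ab: "a < b" using r E less.prems unfolding rows by (metis le_neq_implies_less)
        then obtain b0 where b0: "b = Suc b0" "a \<le> b0" by (cases b) auto
        have IH: "0 \<le> F E (Suc a) b" "0 \<le> F E a b0"
          using less.hyps[of b "Suc a"] less.hyps[of b0 a] bn b0 ab by auto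
        \<comment> \<open>The violation at \<open>(a, b)\<close> disappears at
          \<open>(Suc a, b)\<close> and at \<open>(a, b0)\<close>. Each of these steps thus raises
          \<open>F\<close> by one, which happens only if both letters concerned are present.\<close>
        have 1: "Unb (Suc a) \<in> set C \<and> Bar (Suc a) \<in> set D"
          using IH(1) neg unfolding F_def by (auto simp: of_bool_def split: if_splits)
        have 2: "Unb b \<in> set E \<and> Bar b \<in> set E"
          using IH(2) neg unfolding F_def b0 slack_simps by (auto simp: of_bool_def split: if_splits)
        have s: "unb_upto (set C) (Suc a) = unb_upto (set C) a + 1" "bar_upto (set D) (Suc a) = bar_upto (set D) a + 1"
          using 1 by simp_all
        have "config E (Suc a) b"
          using E 1 2 neg mono[of a b E] mono[of "Suc a" b E] ab s unfolding config_def F_def slack_def by auto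
        then have "(int (length C) - unb_upto (set C) (Suc a)) - (int (length E) - unb_upto (set E) b)
            + (bar_upto (set E) b - bar_upto (set D) (Suc a)) < int b - int (Suc a)"
          using c2 E unfolding cc2 by blast
        then show False using IH(1) neg s unfolding F_def slack_def by linarith
      qed
    qed
    then show "pair_adm TypeC n C D" unfolding pa by blast
  next
    assume "pair_adm TypeC n C D"
    then have R: "0 \<le> F E a b" if "E \<in> {C, D}" "a \<le> b" "b \<le> n" for E a b
      using that unfolding pa by blast
    have pred: "\<exists>a0. a = Suc a0 \<and> unb_upto (set C) a = unb_upto (set C) a0 + 1 \<and>
        bar_upto (set D) a = bar_upto (set D) a0 + 1 \<and> a \<le> n"
      if "Unb a \<in> set C" "Bar a \<in> set D" for a
      using that z al(1) by (cases a) (auto simp: alphabet_def)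
    have "two_cc_1 n C D"
      unfolding two_cc_1_def entry_iff_upper[OF CD(1)] entry_iff_upper[OF CD(2)]
    proof (intro allI impI, elim conjE)
      fix a p q assume *: "Unb a \<in> set C" "p = upper (Unb a) C" "Bar a \<in> set D" "q = upper (Bar a) D"
      obtain a0 where a0: "a = Suc a0" "unb_upto (set C) a = unb_upto (set C) a0 + 1"
        "bar_upto (set D) a = bar_upto (set D) a0 + 1" "a \<le> n" using pred[OF *(1,3)] by blast
      then show "int p - int q \<le> int n - int a"
        using R[of C a0 n] up(2)[of C a] up(1)[of D a] * unb_plus_bar[OF CD(1) al(1)]
        by (simp add: F_def slack_def)
    qed
    moreover have "two_cc_2 C D"
      unfolding cc2
    proof (intro ballI allI impI)
      fix E a b assume E: "E \<in> {C, D}" and c: "config E a b"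
      obtain a0 where a0: "a = Suc a0" "unb_upto (set C) a = unb_upto (set C) a0 + 1"
        "bar_upto (set D) a = bar_upto (set D) a0 + 1" "a \<le> n" using pred c by (auto simp: config_def)
      have "a0 \<le> b"
      proof (rule ccontr)
        assume "\<not> a0 \<le> b"
        then show False using mono[of b a0 E] E c a0(2,3) unfolding config_def by auto
      qed
      moreover have "b \<le> n" using c alE[OF E] by (auto simp: config_def alphabet_def)
      ultimately show "(int (length C) - unb_upto (set C) a) - (int (length E) - unb_upto (set E) b)
          + (bar_upto (set E) b - bar_upto (set D) a) < int b - int a"
        using R[OF E] a0 by (force simp: F_def slack_def)
    qed
    ultimately show "rows_weak C D \<and> two_cc_1 n C D \<and> two_cc_2 C D" using R unfolding rows by blast
  qed
qed

lemma decreasing_iff_entry: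
  "decreasing C \<longleftrightarrow> (\<forall>p q x y. entry C p x \<and> entry C q y \<and> q < p \<longrightarrow> x \<prec> y)"
proof
  assume *: "\<forall>p q x y. entry C p x \<and> entry C q y \<and> q < p \<longrightarrow> x \<prec> y"
  show "decreasing C"
    unfolding sorted_wrt_iff_nth_less
  proof (intro allI impI)
    fix i j assume "i < j" "j < length C"
    then have "entry C (Suc j) (C ! j)" "entry C (Suc i) (C ! i)" by (auto simp: entry_def)
    then show "C ! j \<prec> C ! i" using * \<open>i < j\<close> by blast
  qed
qed (auto simp: entry_def sorted_wrt_iff_nth_less)

lemma tableaux_iff:
  assumes "sorted is"
  shows "T \<in> tableaux g n is \<longleftrightarrow> map length T = is \<and> (\<forall>C\<in>set T. col_adm g n C) \<and>
    (\<forall>k. Suc k < length T \<longrightarrow> pair_adm g n (T ! k) (T ! Suc k))"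
proof (cases "map length T = is \<and> (\<forall>C\<in>set T. decreasing C \<and> set C \<subseteq> alphabet g n)")
  case False
  then show ?thesis
    unfolding tableaux_def col_adm_def decreasing_iff_entry[symmetric] by auto
next
  case True
  have dec: "\<forall>p q x y. entry C p x \<and> entry C q y \<and> q < p \<longrightarrow> x \<prec> y" if "C \<in> set T" for C
    using True that by (auto simp: entry_def sorted_wrt_iff_nth_less)
  have len: "length (T ! k) \<le> length (T ! Suc k)" if "Suc k < length T" for k
  proof -
    have "is ! k \<le> is ! Suc k" using assms True that by (intro sorted_nth_mono) auto
    then show ?thesis using True that by (metis Suc_lessD nth_map)
  qed
  have cc: "one_cc C \<longleftrightarrow> (\<forall>b\<le>n. 0 \<le> slack (set C) b)" if "C \<in> set T" "g = TypeC" for C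
    using one_cc_iff_slack True that by blast
  have pr: "rows_weak (T ! k) (T ! Suc k) \<and> (g = TypeC \<longrightarrow> two_cc_1 n (T ! k) (T ! Suc k) \<and>
      two_cc_2 (T ! k) (T ! Suc k)) \<longleftrightarrow> pair_adm g n (T ! k) (T ! Suc k)" if "Suc k < length T" for k
  proof -
    have "T ! k \<in> set T" "T ! Suc k \<in> set T" using that by auto
    then show ?thesis
      using pair_adm_TypeA[of "T ! k" "T ! Suc k" n] pair_adm_TypeC[of "T ! k" "T ! Suc k" n]
        len[OF that] True by (cases g) auto
  qed
  show ?thesis
  proof
    assume t: "T \<in> tableaux g n is"
    have "col_adm g n C" if C: "C \<in> set T" for C
      using t True cc[OF C] C by (simp add: tableaux_def col_adm_def)
    moreover have "pair_adm g n (T ! k) (T ! Suc k)" if k: "Suc k < length T" for k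
    proof -
      have "rows_weak (T ! k) (T ! Suc k)"
        using t k unfolding tableaux_def rows_weak_def by blast
      moreover have "g = TypeC \<longrightarrow> two_cc_1 n (T ! k) (T ! Suc k) \<and> two_cc_2 (T ! k) (T ! Suc k)"
        using t k unfolding tableaux_def by blast
      ultimately show ?thesis using pr[OF k] by blast
    qed
    ultimately show "map length T = is \<and> (\<forall>C\<in>set T. col_adm g n C) \<and>
        (\<forall>k. Suc k < length T \<longrightarrow> pair_adm g n (T ! k) (T ! Suc k))" using True by blast
  next
    assume t: "map length T = is \<and> (\<forall>C\<in>set T. col_adm g n C) \<and>
        (\<forall>k. Suc k < length T \<longrightarrow> pair_adm g n (T ! k) (T ! Suc k))"
    have "\<forall>k. Suc k < length T \<longrightarrow> rows_weak (T ! k) (T ! Suc k)"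
      "g = TypeC \<longrightarrow> (\<forall>k. Suc k < length T \<longrightarrow> two_cc_1 n (T ! k) (T ! Suc k) \<and> two_cc_2 (T ! k) (T ! Suc k))"
      using t pr by blast+
    moreover have "g = TypeC \<longrightarrow> (\<forall>C\<in>set T. one_cc C)"
      using t cc by (auto simp: col_adm_def)
    ultimately show "T \<in> tableaux g n is"
      unfolding tableaux_def mem_Collect_eq rows_weak_def using True dec by simp
  qed
qed

section \<open>Letters surviving the cancellation\<close>

definition set_net :: "cartan \<Rightarrow> nat \<Rightarrow> nat \<Rightarrow> letter set \<Rightarrow> int" where
  "set_net g n i S = (\<Sum>x\<in>S. letter_net g n i x)"

lemma word_net_distinct: "distinct w \<Longrightarrow> word_net g n i w = set_net g n i (set w)"
  by (simp add: word_net_def set_net_def sum_list_distinct_conv_sum_set)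

lemma set_net_TypeA:
  "finite S \<Longrightarrow> set_net TypeA n i S = of_bool (Unb (Suc i) \<in> S) - of_bool (Unb i \<in> S)"
proof (induction S rule: finite_induct)
  case (insert x S)
  then show ?case by (cases x) (auto simp: set_net_def letter_net_def)
qed (simp add: set_net_def)

lemma set_net_TypeC:
  "finite S \<Longrightarrow> i < n \<Longrightarrow> set_net TypeC n i S =
    of_bool (Unb (Suc i) \<in> S) - of_bool (Unb i \<in> S) + of_bool (Bar i \<in> S) - of_bool (Bar (Suc i) \<in> S)"
proof (induction S rule: finite_induct)
  case (insert x S)
  then show ?case by (cases x) (auto simp: set_net_def letter_net_def)
qed (simp add: set_net_def)

lemma set_net_TypeC_n:
  "finite S \<Longrightarrow> set_net TypeC n n S = of_bool (Bar n \<in> S) - of_bool (Unb n \<in> S)"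
proof (induction S rule: finite_induct)
  case (insert x S)
  then show ?case by (cases x) (auto simp: set_net_def letter_net_def)
qed (simp add: set_net_def)

text \<open>In an increasing word a threshold cuts out a prefix or a suffix. The partial sum
  conditions thereby become conditions on sets of letters, which \<open>set_net\<close> evaluates by
  membership of the few letters of color \<open>i\<close>.\<close>

lemma increasing_filter:
  assumes "sorted_wrt (\<prec>) u"
  shows "u = filter (\<lambda>y. \<not> z \<preceq> y) u @ filter (\<lambda>y. z \<preceq> y) u \<and>
    u = filter (\<lambda>y. y \<preceq> z) u @ filter (\<lambda>y. \<not> y \<preceq> z) u"
  using assms
proof (induction u)
  case (Cons x u)
  have *: "z \<preceq> x \<Longrightarrow> y \<in> set u \<Longrightarrow> z \<preceq> y" "\<not> x \<preceq> z \<Longrightarrow> y \<in> set u \<Longrightarrow> \<not> y \<preceq> z" for y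
    using Cons.prems by (auto simp: letter_le_iff_not_less intro: letter_less_trans)
  have "x # u = filter (\<lambda>y. \<not> z \<preceq> y) (x # u) @ filter (\<lambda>y. z \<preceq> y) (x # u)"
  proof (cases "z \<preceq> x")
    case True
    then have "filter (\<lambda>y. \<not> z \<preceq> y) u = []" "filter (\<lambda>y. z \<preceq> y) u = u"
      using *(1) by (auto simp: filter_empty_conv filter_id_conv)
    then show ?thesis using True by simp
  qed (use Cons in simp)
  moreover have "x # u = filter (\<lambda>y. y \<preceq> z) (x # u) @ filter (\<lambda>y. \<not> y \<preceq> z) (x # u)"
  proof (cases "x \<preceq> z")
    case False
    then have "filter (\<lambda>y. y \<preceq> z) u = []" "filter (\<lambda>y. \<not> y \<preceq> z) u = u"
      using *(2) by (auto simp: filter_empty_conv filter_id_conv)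
    then show ?thesis using False by simp
  qed (use Cons in simp)
  ultimately show ?case ..
qed simp

lemma no_plus_word_increasing:
  assumes "no_plus_word g n i (u0 @ u @ u1)" "sorted_wrt (\<prec>) u"
  shows "0 \<le> set_net g n i {y \<in> set u. z \<preceq> y} + word_net g n i u1"
proof -
  have "u0 @ u @ u1 = (u0 @ filter (\<lambda>y. \<not> z \<preceq> y) u) @ (filter (\<lambda>y. z \<preceq> y) u @ u1)"
    using increasing_filter[OF assms(2), of z] by (metis append.assoc)
  then have "0 \<le> word_net g n i (filter (\<lambda>y. z \<preceq> y) u @ u1)"
    using assms(1) unfolding no_plus_word_def by blast
  moreover have "distinct u" using assms(2) by (induction u) auto
  ultimately show ?thesis by (simp add: word_net_distinct)
qed

lemma no_minus_word_increasing:
  assumes "no_minus_word g n i (v1 @ v @ v0)" "sorted_wrt (\<prec>) v"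
  shows "word_net g n i v1 + set_net g n i {y \<in> set v. y \<preceq> z} \<le> 0"
proof -
  have "v1 @ v @ v0 = (v1 @ filter (\<lambda>y. y \<preceq> z) v) @ (filter (\<lambda>y. \<not> y \<preceq> z) v @ v0)"
    using increasing_filter[OF assms(2), of z] by (metis append.assoc)
  then have "word_net g n i (v1 @ filter (\<lambda>y. y \<preceq> z) v) \<le> 0"
    using assms(1) unfolding no_minus_word_def by blast
  moreover have "distinct v" using assms(2) by (induction v) auto
  ultimately show ?thesis by (simp add: word_net_distinct)
qed

text \<open>
  A letter \<open>x\<close> of a column with entries \<open>S\<close> survives the cancellation within the column
  (\<open>active\<close>), also against the right neighbour \<open>S'\<close> (\<open>active_left\<close>), which is read before,
  and against the left neighbour \<open>S'\<close> (\<open>active_right\<close>), which is read after.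
\<close>

definition active :: "cartan \<Rightarrow> nat \<Rightarrow> nat \<Rightarrow> letter set \<Rightarrow> letter \<Rightarrow> bool" where
  "active g n i S x \<longleftrightarrow> (\<forall>z. 0 \<le> set_net g n i {y \<in> S. z \<preceq> y \<and> y \<prec> x}) \<and>
     (\<forall>z. set_net g n i {y \<in> S. x \<prec> y \<and> y \<preceq> z} \<le> 0)"

definition active_left :: "cartan \<Rightarrow> nat \<Rightarrow> nat \<Rightarrow> letter set \<Rightarrow> letter set \<Rightarrow> letter \<Rightarrow> bool" where
  "active_left g n i S S' x \<longleftrightarrow>
     (\<forall>z. 0 \<le> set_net g n i {y \<in> S'. z \<preceq> y} + set_net g n i {y \<in> S. y \<prec> x})"

definition active_right :: "cartan \<Rightarrow> nat \<Rightarrow> nat \<Rightarrow> letter set \<Rightarrow> letter set \<Rightarrow> letter \<Rightarrow> bool" where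
  "active_right g n i S S' x \<longleftrightarrow>
     (\<forall>z. set_net g n i {y \<in> S. x \<prec> y} + set_net g n i {y \<in> S'. y \<preceq> z} \<le> 0)"

lemma increasing_rev: "decreasing C \<Longrightarrow> sorted_wrt (\<prec>) (rev C)"
  by (simp add: sorted_wrt_rev)

lemma decreasing_split_sets:
  assumes "decreasing (c1 @ x # c2)"
  shows "set c2 = {y \<in> set (c1 @ x # c2). y \<prec> x}" "set c1 = {y \<in> set (c1 @ x # c2). x \<prec> y}"
  using assms by (auto simp: sorted_wrt_append dest: letter_less_trans)

text \<open>The column is read as \<open>rev c2\<close>, \<open>x\<close>, \<open>rev c1\<close>;
  the part \<open>c2\<close> consists of the smaller letters, which lie above
  \<open>x\<close>.\<close>

lemma active_reading:
  assumes dec: "decreasing (c1 @ x # c2)"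
    and u: "no_plus_word g n i (u0 @ rev c2)" and v: "no_minus_word g n i (rev c1 @ v0)"
  shows "active g n i (set (c1 @ x # c2)) x"
  unfolding active_def
proof (intro conjI allI)
  fix z
  have d: "decreasing c1" "decreasing c2" using dec by (auto simp: sorted_wrt_append)
  have "{y \<in> set (c1 @ x # c2). z \<preceq> y \<and> y \<prec> x} = {y \<in> set (rev c2). z \<preceq> y}"
    using decreasing_split_sets[OF dec] unfolding set_rev by blast
  then show "0 \<le> set_net g n i {y \<in> set (c1 @ x # c2). z \<preceq> y \<and> y \<prec> x}"
    using no_plus_word_increasing[of g n i u0 "rev c2" "[]" z] u increasing_rev[OF d(2)] by simp
  have "{y \<in> set (c1 @ x # c2). x \<prec> y \<and> y \<preceq> z} = {y \<in> set (rev c1). y \<preceq> z}"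
    using decreasing_split_sets[OF dec] unfolding set_rev by blast
  then show "set_net g n i {y \<in> set (c1 @ x # c2). x \<prec> y \<and> y \<preceq> z} \<le> 0"
    using no_minus_word_increasing[of g n i "[]" "rev c1" v0 z] v increasing_rev[OF d(1)] by simp
qed

lemma active_left_reading:
  assumes dec: "decreasing (c1 @ x # c2)" "decreasing D"
    and u: "no_plus_word g n i (u0 @ rev D @ rev c2)"
  shows "active_left g n i (set (c1 @ x # c2)) (set D) x"
  unfolding active_left_def
proof
  fix z
  have d: "decreasing c2" using dec(1) by (auto simp: sorted_wrt_append)
  have "{y \<in> set (c1 @ x # c2). y \<prec> x} = set (rev c2)"
    using decreasing_split_sets[OF dec(1)] unfolding set_rev by blast
  moreover have "word_net g n i (rev c2) = set_net g n i (set (rev c2))"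
    using decreasing_distinct[OF d] by (intro word_net_distinct) simp
  ultimately show "0 \<le> set_net g n i {y \<in> set D. z \<preceq> y} + set_net g n i {y \<in> set (c1 @ x # c2). y \<prec> x}"
    using no_plus_word_increasing[OF u increasing_rev[OF dec(2)], of z] by simp
qed

lemma active_right_reading:
  assumes dec: "decreasing (c1 @ x # c2)" "decreasing D"
    and v: "no_minus_word g n i (rev c1 @ rev D @ v0)"
  shows "active_right g n i (set (c1 @ x # c2)) (set D) x"
  unfolding active_right_def
proof
  fix z
  have d: "decreasing c1" using dec(1) by (auto simp: sorted_wrt_append)
  have "{y \<in> set (c1 @ x # c2). x \<prec> y} = set (rev c1)"
    using decreasing_split_sets[OF dec(1)] unfolding set_rev by blast
  moreover have "word_net g n i (rev c1) = set_net g n i (set (rev c1))"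
    using decreasing_distinct[OF d] by (intro word_net_distinct) simp
  ultimately show "set_net g n i {y \<in> set (c1 @ x # c2). x \<prec> y} + set_net g n i {y \<in> set D. y \<preceq> z} \<le> 0"
    using no_minus_word_increasing[OF v increasing_rev[OF dec(2)], of z] by simp
qed

section \<open>Replacing one letter of a column\<close>

definition moves :: "cartan \<Rightarrow> nat \<Rightarrow> nat \<Rightarrow> letter \<Rightarrow> letter \<Rightarrow> bool" where
  "moves g n i x y \<longleftrightarrow> vec_f g n i x = Some y \<or> vec_e g n i x = Some y"

lemma vec_f_cases:
  assumes "vec_f g n i x = Some y"
  obtains "x = Unb i" "y = Unb (Suc i)" "g = TypeC \<longrightarrow> i \<noteq> n"
  | "x = Unb i" "y = Bar i" "g = TypeC" "i = n"
  | "x = Bar (Suc i)" "y = Bar i" "g = TypeC" "i < n"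
  using assms by (cases x) (auto split: if_splits)

lemma vec_f_between:
  assumes "vec_f g n i x = Some y" "w \<in> alphabet g n" "x \<prec> w" "w \<preceq> y"
  shows "w = y"
  using assms(1)
  by (rule vec_f_cases; cases w; use assms(2-) in \<open>auto simp: alphabet_def\<close>)

lemma vec_f_between':
  assumes "vec_f g n i x = Some y" "w \<in> alphabet g n" "x \<preceq> w" "w \<prec> y"
  shows "w = x"
  using assms(1)
  by (rule vec_f_cases; cases w; use assms(2-) in \<open>auto simp: alphabet_def\<close>)

lemma vec_f_less: "vec_f g n i x = Some y \<Longrightarrow> x \<prec> y"
  by (erule vec_f_cases) auto

lemma vec_f_alphabet:
  "vec_f g n i x = Some y \<Longrightarrow> 1 \<le> i \<Longrightarrow> i \<le> n \<Longrightarrow> x \<in> alphabet g n \<and> y \<in> alphabet g n"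
  by (erule vec_f_cases) (cases g; auto simp: alphabet_def)+

lemma letter_net_vec:
  "vec_f g n i x = Some y \<Longrightarrow> letter_net g n i x = - 1 \<and> letter_net g n i y = 1"
  by (cases rule: vec_signs_cases[of g n i x]; cases rule: vec_signs_cases[of g n i y])
    (auto simp: vec_e_iff_vec_f[symmetric])

text \<open>The alphabet has no letter between \<open>x\<close> and \<open>y\<close>. If
  \<open>y\<close> were present, its sign would be adjacent to that of \<open>x\<close> inside the
  column and cancel it.\<close>

lemma moves_fresh:
  assumes "active g n i S x" "moves g n i x y" "S \<subseteq> alphabet g n"
  shows "y \<notin> S"
proof
  assume y: "y \<in> S"
  from assms(2) show False unfolding moves_def
  proof
    assume f: "vec_f g n i x = Some y"
    have "{w \<in> S. x \<prec> w \<and> w \<preceq> y} = {y}"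
      using vec_f_between[OF f] vec_f_less[OF f] y assms(3) by auto
    then show False
      using assms(1) letter_net_vec[OF f] unfolding active_def set_net_def
      by (metis (no_types, lifting) finite.emptyI sum.empty sum.insert_remove empty_Diff
          add.right_neutral not_one_le_zero)
  next
    assume "vec_e g n i x = Some y"
    then have f: "vec_f g n i y = Some x" by (simp add: vec_e_iff_vec_f)
    have "{w \<in> S. y \<preceq> w \<and> w \<prec> x} = {y}"
      using vec_f_between'[OF f] vec_f_less[OF f] y assms(3) by auto
    then have "0 \<le> set_net g n i {y}" using assms(1) unfolding active_def by metis
    then show False using letter_net_vec[OF f] by (simp add: set_net_def)
  qed
qed

lemma decreasing_move:
  assumes "decreasing (c1 @ x # c2)" "set (c1 @ x # c2) \<subseteq> alphabet g n"
    and "moves g n i x y" "active g n i (set (c1 @ x # c2)) x"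
  shows "decreasing (c1 @ y # c2)" "y \<notin> set (c1 @ x # c2)"
    "set (c1 @ y # c2) = insert y (set (c1 @ x # c2) - {x})"
proof -
  show y: "y \<notin> set (c1 @ x # c2)" using moves_fresh assms by blast
  have "x \<notin> set c1" "x \<notin> set c2" using decreasing_distinct[OF assms(1)] by auto
  then show "set (c1 @ y # c2) = insert y (set (c1 @ x # c2) - {x})" by auto
  have 1: "y \<prec> w" if "w \<in> set c1" for w
  proof -
    have w: "x \<prec> w" "w \<in> alphabet g n" "w \<noteq> y" using that assms(1,2) y by (auto simp: sorted_wrt_append)
    from assms(3) show ?thesis unfolding moves_def
    proof
      assume "vec_f g n i x = Some y"
      from vec_f_between[OF this w(2,1)] w(3) show ?thesis by (auto simp: letter_le_iff_not_less)
    next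
      assume "vec_e g n i x = Some y"
      then have "y \<prec> x" by (simp add: vec_e_iff_vec_f vec_f_less)
      then show ?thesis using w(1) letter_less_trans by blast
    qed
  qed
  have 2: "w \<prec> y" if "w \<in> set c2" for w
  proof -
    have w: "w \<prec> x" "w \<in> alphabet g n" "w \<noteq> y" using that assms(1,2) y by (auto simp: sorted_wrt_append)
    from assms(3) show ?thesis unfolding moves_def
    proof
      assume "vec_f g n i x = Some y"
      then show ?thesis using w(1) letter_less_trans vec_f_less by blast
    next
      assume "vec_e g n i x = Some y"
      then have "vec_f g n i y = Some x" by (simp add: vec_e_iff_vec_f)
      from vec_f_between'[OF this w(2)] w show ?thesis by (auto simp: letter_le_iff_not_less)
    qed
  qed
  show "decreasing (c1 @ y # c2)" using assms(1) 1 2 by (auto simp: sorted_wrt_append)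
qed

lemma unb_upto_insert:
  "unb_upto (insert (Unb j) S) a = unb_upto S a + of_bool (1 \<le> j \<and> j \<le> a \<and> Unb j \<notin> S)"
  "unb_upto (insert (Bar j) S) a = unb_upto S a"
  "bar_upto (insert (Bar j) S) a = bar_upto S a + of_bool (1 \<le> j \<and> j \<le> a \<and> Bar j \<notin> S)"
  "bar_upto (insert (Unb j) S) a = bar_upto S a"
  by (induction a) (auto simp: le_Suc_eq)

lemma unb_upto_remove:
  "unb_upto (S - {Unb j}) a = unb_upto S a - of_bool (1 \<le> j \<and> j \<le> a \<and> Unb j \<in> S)"
  "unb_upto (S - {Bar j}) a = unb_upto S a"
  "bar_upto (S - {Bar j}) a = bar_upto S a - of_bool (1 \<le> j \<and> j \<le> a \<and> Bar j \<in> S)"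
  "bar_upto (S - {Unb j}) a = bar_upto S a"
  by (induction a) (auto simp: le_Suc_eq)

definition unb_shift :: "nat \<Rightarrow> letter \<Rightarrow> letter \<Rightarrow> int" where
  "unb_shift i x y = of_bool (y = Unb i) - of_bool (x = Unb i)"

definition bar_shift :: "nat \<Rightarrow> letter \<Rightarrow> letter \<Rightarrow> int" where
  "bar_shift i x y = of_bool (y = Bar i) - of_bool (x = Bar i)"

text \<open>Trading \<open>i\<close> against \<open>i + 1\<close> is visible only to the count up to
  \<open>i\<close>. Trading \<open>Unb n\<close> against \<open>Bar n\<close> is visible to all
  counts from \<open>n\<close> on, whence the bound \<open>a \<le> n\<close> in type C.\<close>

lemma upto_move:
  assumes "moves g n i x y" "1 \<le> i" "x \<in> S" "y \<notin> S" "a \<le> n \<or> g = TypeA"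
  shows "unb_upto (insert y (S - {x})) a = unb_upto S a + (if a = i then unb_shift i x y else 0)"
    "bar_upto (insert y (S - {x})) a = bar_upto S a + (if a = i then bar_shift i x y else 0)"
proof -
  have "vec_f g n i x = Some y \<or> vec_f g n i y = Some x"
    using assms(1) by (simp add: moves_def vec_e_iff_vec_f)
  then have "unb_upto (insert y (S - {x})) a = unb_upto S a + (if a = i then unb_shift i x y else 0) \<and>
    bar_upto (insert y (S - {x})) a = bar_upto S a + (if a = i then bar_shift i x y else 0)"
    by (elim disjE vec_f_cases;
      use assms in \<open>auto simp: unb_upto_insert unb_upto_remove unb_shift_def bar_shift_def\<close>)
  then show "unb_upto (insert y (S - {x})) a = unb_upto S a + (if a = i then unb_shift i x y else 0)"
    "bar_upto (insert y (S - {x})) a = bar_upto S a + (if a = i then bar_shift i x y else 0)" by blast+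
qed

section \<open>Stability of the tableau conditions\<close>

text \<open>Off the diagonal only one of the two summands changes. A decrease at \<open>i\<close>
  does no harm there if the new value is still at least the one at \<open>i - 1\<close> or
  \<open>i + 1\<close>, where the inequality is known. For \<open>i = n\<close> the condition on
  \<kappa> may be dropped, since \<open>a = n\<close> forces \<open>b = n\<close>; the diagonal pair
  \<open>(i, i)\<close> is a hypothesis of its own.\<close>

lemma shift_nonneg:
  fixes k D :: "nat \<Rightarrow> int"
  assumes H: "\<And>a b. a \<le> b \<Longrightarrow> b \<le> n \<Longrightarrow> 0 \<le> k a + D b"
    and \<kappa>: "0 \<le> \<kappa> \<or> i = n \<or> k i0 \<le> k i + \<kappa> \<or> k (Suc i) \<le> k i + \<kappa>"
    and \<delta>: "0 \<le> \<delta> \<or> D i0 \<le> D i + \<delta> \<or> i < n \<and> D (Suc i) \<le> D i + \<delta>"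
    and i: "i = Suc i0" "i \<le> n" and \<kappa>\<delta>: "0 \<le> k i + D i + \<kappa> + \<delta>"
    and ab: "a \<le> b" "b \<le> n"
  shows "0 \<le> k a + (if a = i then \<kappa> else 0) + (D b + (if b = i then \<delta> else 0))"
proof -
  consider "a = i" "b = i" | "a = i" "i < b" | "a < i" "b = i" | "a \<noteq> i" "b \<noteq> i"
    using ab by linarith
  then show ?thesis
  proof cases
    case 2
    then show ?thesis using \<kappa> H[of i b] H[of i0 b] H[of "Suc i" b] i ab by fastforce
  next
    case 3
    then show ?thesis using \<delta> H[of a i] H[of a i0] H[of a "Suc i"] i ab by fastforce
  qed (use \<kappa>\<delta> H ab in auto)
qed

lemma slack_move:
  assumes "moves g n i x y" "1 \<le> i" "x \<in> S" "y \<notin> S" "b \<le> n"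
  shows "slack (insert y (S - {x})) b = slack S b + (if b = i then - unb_shift i x y - bar_shift i x y else 0)"
  using upto_move[OF assms(1-4), of b] assms(5) by (simp add: slack_def)

lemma moves_cases:
  assumes "moves g n i x y"
  obtains "x = Unb i" "y = Unb (Suc i)" "g = TypeC \<longrightarrow> i \<noteq> n"
  | "x = Unb (Suc i)" "y = Unb i" "g = TypeC \<longrightarrow> i \<noteq> n"
  | "x = Unb n" "y = Bar n" "g = TypeC" "i = n"
  | "x = Bar n" "y = Unb n" "g = TypeC" "i = n"
  | "x = Bar (Suc i)" "y = Bar i" "g = TypeC" "i < n"
  | "x = Bar i" "y = Bar (Suc i)" "g = TypeC" "i < n"
  using assms unfolding moves_def vec_e_iff_vec_f by (elim disjE vec_f_cases) auto

lemma slack_move_nonneg: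
  assumes "moves TypeC n i x y" "1 \<le> i" "i \<le> n" "x \<in> S" "y \<notin> S" "finite S"
    and act: "active TypeC n i S x" and H: "\<And>b. b \<le> n \<Longrightarrow> 0 \<le> slack S b" and "b \<le> n"
  shows "0 \<le> slack (insert y (S - {x})) b"
proof (cases "b = i")
  case False
  then show ?thesis using slack_move[OF assms(1,2,4,5,9)] H[OF assms(9)] by simp
next
  case True
  obtain i0 where i: "i = Suc i0" using assms(2) by (cases i) auto
  have s: "slack S i = slack S i0 + 1 - of_bool (Unb i \<in> S) - of_bool (Bar i \<in> S)"
    "slack S (Suc i) = slack S i + 1 - of_bool (Unb (Suc i) \<in> S) - of_bool (Bar (Suc i) \<in> S)"
    by (simp_all add: i)
  have Hs: "0 \<le> slack S i0" "0 \<le> slack S i" "i < n \<Longrightarrow> 0 \<le> slack S (Suc i)"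
    using H[of i0] H[of i] H[of "Suc i"] assms(3) unfolding i by linarith+
  have "0 \<le> slack S i - unb_shift i x y - bar_shift i x y"
    using assms(1)
  proof (cases rule: moves_cases)
    case 2
    \<comment> \<open>Only cases 2 and 5 lower the slack at \<open>i\<close>. Here, if
      \<open>Bar i\<close> lies in \<open>S\<close>, then so does \<open>Bar (Suc i)\<close>, and
      the slack at \<open>Suc i\<close> is one less than at \<open>i\<close> but still nonnegative.
      Otherwise the slack at \<open>i\<close> exceeds that at \<open>i - 1\<close>. Case 5 is the
      same with barred and unbarred letters exchanged.\<close>
    have "set_net TypeC n i {y \<in> S. Unb (Suc i) \<prec> y \<and> y \<preceq> Bar i} \<le> 0"
      using act 2 unfolding active_def by blast
    then show ?thesis using 2 assms(1-6) s Hs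
      by (auto simp: set_net_TypeC unb_shift_def bar_shift_def split: if_splits)
  next
    case 5
    have "0 \<le> set_net TypeC n i {y \<in> S. Unb i \<preceq> y \<and> y \<prec> Bar (Suc i)}"
      using act 5 unfolding active_def by blast
    then show ?thesis using 5 assms(1-6) s Hs
      by (auto simp: set_net_TypeC unb_shift_def bar_shift_def split: if_splits)
  qed (use H[of i] assms(3) in \<open>auto simp: unb_shift_def bar_shift_def\<close>)
  then show ?thesis using slack_move[OF assms(1,2,4,5,9)] True by simp
qed

lemma col_adm_move:
  assumes "col_adm g n (c1 @ x # c2)" "moves g n i x y" "1 \<le> i" "i \<le> n"
    and "active g n i (set (c1 @ x # c2)) x"
  shows "col_adm g n (c1 @ y # c2)"
proof -
  let ?S = "set (c1 @ x # c2)"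
  have dec: "decreasing (c1 @ x # c2)" and al: "?S \<subseteq> alphabet g n" using assms(1) by (auto simp: col_adm_def)
  note m = decreasing_move[OF dec al assms(2,5)]
  have "y \<in> alphabet g n"
    using assms(2-4) unfolding moves_def vec_e_iff_vec_f by (auto dest: vec_f_alphabet)
  then have "set (c1 @ y # c2) \<subseteq> alphabet g n" using al unfolding m(3) by blast
  moreover have "0 \<le> slack (set (c1 @ y # c2)) b" if "g = TypeC" "b \<le> n" for b
    unfolding m(3)
    using assms that m(2) by (intro slack_move_nonneg[of n i x y]) (auto simp: col_adm_def)
  ultimately show ?thesis using m(1) by (simp add: col_adm_def)
qed

text \<open>Only \<open>a = i\<close> is affected. If the move broke this inequality, it would be an
  equality before, and the inequalities at \<open>i - 1\<close> and \<open>i + 1\<close> would then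
  fix the membership of \<open>Unb i\<close> and \<open>Unb (Suc i)\<close> in the neighbour so that
  a sign of the neighbour remains, against \<open>active_left\<close> or
  \<open>active_right\<close>.\<close>

lemma pair_adm_TypeA_move:
  assumes "finite S" "finite S'" "1 \<le> i" and H: "\<And>a. L - unb_upto S a \<le> L' - unb_upto S' a"
  shows "moves TypeA n i x y \<Longrightarrow> x \<in> S \<Longrightarrow> y \<notin> S \<Longrightarrow> active TypeA n i S x \<Longrightarrow> active_left TypeA n i S S' x \<Longrightarrow>
      L - unb_upto (insert y (S - {x})) a \<le> L' - unb_upto S' a"
    and "moves TypeA n i x y \<Longrightarrow> x \<in> S' \<Longrightarrow> y \<notin> S' \<Longrightarrow> active TypeA n i S' x \<Longrightarrow> active_right TypeA n i S' S x \<Longrightarrow>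
      L - unb_upto S a \<le> L' - unb_upto (insert y (S' - {x})) a"
proof -
  obtain i0 where i: "i = Suc i0" using assms(3) by (cases i) auto
  have s: "unb_upto S i = unb_upto S i0 + of_bool (Unb i \<in> S)"
    "unb_upto S (Suc i) = unb_upto S i + of_bool (Unb (Suc i) \<in> S)"
    "unb_upto S' i = unb_upto S' i0 + of_bool (Unb i \<in> S')"
    "unb_upto S' (Suc i) = unb_upto S' i + of_bool (Unb (Suc i) \<in> S')"
    by (simp_all add: i)
  {
    assume m: "moves TypeA n i x y" "x \<in> S" "y \<notin> S" and act: "active_left TypeA n i S S' x"
    show "L - unb_upto (insert y (S - {x})) a \<le> L' - unb_upto S' a"
    proof (cases "a = i")
      case True
      have "0 \<le> set_net TypeA n i {w \<in> S'. Unb i \<preceq> w} + set_net TypeA n i {w \<in> S. w \<prec> x}"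
        using act unfolding active_left_def by blast
      then have "L - unb_upto S i - unb_shift i x y \<le> L' - unb_upto S' i"
        using m(1) by (rule_tac moves_cases[OF m(1)])
          (use m assms(1,2) s H[of i0] H[of i] H[of "Suc i"] in
            \<open>auto simp: set_net_TypeA unb_shift_def split: if_splits\<close>)
      then show ?thesis using upto_move(1)[OF m(1) assms(3) m(2,3), of a] True by simp
    qed (use upto_move(1)[OF m(1) assms(3) m(2,3), of a] H[of a] in simp)
  }
  {
    assume m: "moves TypeA n i x y" "x \<in> S'" "y \<notin> S'" and act: "active_right TypeA n i S' S x"
    show "L - unb_upto S a \<le> L' - unb_upto (insert y (S' - {x})) a"
    proof (cases "a = i")
      case True
      have "set_net TypeA n i {w \<in> S'. x \<prec> w} + set_net TypeA n i {w \<in> S. w \<preceq> Unb (Suc i)} \<le> 0"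
        using act unfolding active_right_def by blast
      then have "L - unb_upto S i \<le> L' - unb_upto S' i - unb_shift i x y"
        using m(1) by (rule_tac moves_cases[OF m(1)])
          (use m assms(1,2) s H[of i0] H[of i] H[of "Suc i"] in
            \<open>auto simp: set_net_TypeA unb_shift_def split: if_splits\<close>)
      then show ?thesis using upto_move(1)[OF m(1) assms(3) m(2,3), of a] True by simp
    qed (use upto_move(1)[OF m(1) assms(3) m(2,3), of a] H[of a] in simp)
  }
qed

lemma pair_adm_TypeC_move:
  fixes S S' :: "letter set" and L L' :: int
  defines "k \<equiv> \<lambda>S S' a. unb_upto S a + bar_upto S' a - int a"
  assumes fin: "finite S" "finite S'" and i: "1 \<le> i" "i \<le> n"
    and L: "unb_upto S n + bar_upto S n = L" "unb_upto S' n + bar_upto S' n = L'"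
    and H: "\<And>a b. a \<le> b \<Longrightarrow> b \<le> n \<Longrightarrow> 0 \<le> k S S' a + slack S b"
    and H': "\<And>a b. a \<le> b \<Longrightarrow> b \<le> n \<Longrightarrow> 0 \<le> k S S' a + slack S' b + L' - L"
    and m: "moves TypeC n i x y" and ab: "a \<le> b" "b \<le> n"
  shows "x \<in> S \<Longrightarrow> y \<notin> S \<Longrightarrow> active TypeC n i S x \<Longrightarrow> active_left TypeC n i S S' x \<Longrightarrow>
      0 \<le> k (insert y (S - {x})) S' a + slack (insert y (S - {x})) b \<and>
      0 \<le> k (insert y (S - {x})) S' a + slack S' b + L' - L"
    and "x \<in> S' \<Longrightarrow> y \<notin> S' \<Longrightarrow> active TypeC n i S' x \<Longrightarrow> active_right TypeC n i S' S x \<Longrightarrow>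
      0 \<le> k S (insert y (S' - {x})) a + slack S b \<and>
      0 \<le> k S (insert y (S' - {x})) a + slack (insert y (S' - {x})) b + L' - L"
proof -
  obtain i0 where i0: "i = Suc i0" using i by (cases i) auto
  define K where "K = k S S'"
  define D where "D = slack S"
  define D' where "D' b = slack S' b + L' - L" for b
  have H: "0 \<le> K a + D b" and H': "0 \<le> K a + D' b" if "a \<le> b" "b \<le> n" for a b
    using H[OF that] H'[OF that] by (simp_all add: K_def D_def D'_def algebra_simps)
  have s: "K i = K i0 + of_bool (Unb i \<in> S) + of_bool (Bar i \<in> S') - 1"
    "K (Suc i) = K i + of_bool (Unb (Suc i) \<in> S) + of_bool (Bar (Suc i) \<in> S') - 1"
    "D i = D i0 + 1 - of_bool (Unb i \<in> S) - of_bool (Bar i \<in> S)"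
    "D (Suc i) = D i + 1 - of_bool (Unb (Suc i) \<in> S) - of_bool (Bar (Suc i) \<in> S)"
    "D' i = D' i0 + 1 - of_bool (Unb i \<in> S') - of_bool (Bar i \<in> S')"
    "D' (Suc i) = D' i + 1 - of_bool (Unb (Suc i) \<in> S') - of_bool (Bar (Suc i) \<in> S')"
    by (simp_all add: i0 K_def D_def D'_def k_def)
  \<comment> \<open>Both sides are \<open>n - L\<close>: at \<open>b = n\<close> the two families of
    inequalities agree. The case \<open>i = n\<close> relies on this.\<close>
  have Dn: "D n = D' n" using L by (simp add: D_def D'_def slack_def)
  have HH: "0 \<le> K i0 + D i0" "0 \<le> K i0 + D i" "0 \<le> K i + D i"
    "0 \<le> K i0 + D' i0" "0 \<le> K i0 + D' i" "0 \<le> K i + D' i"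
    "i < n \<Longrightarrow> 0 \<le> K i0 + D (Suc i)" "i < n \<Longrightarrow> 0 \<le> K i + D (Suc i)" "i < n \<Longrightarrow> 0 \<le> K (Suc i) + D (Suc i)"
    "i < n \<Longrightarrow> 0 \<le> K i0 + D' (Suc i)" "i < n \<Longrightarrow> 0 \<le> K i + D' (Suc i)" "i < n \<Longrightarrow> 0 \<le> K (Suc i) + D' (Suc i)"
    using H[of i0 i0] H[of i0 i] H[of i i] H[of i0 "Suc i"] H[of i "Suc i"] H[of "Suc i" "Suc i"]
      H'[of i0 i0] H'[of i0 i] H'[of i i] H'[of i0 "Suc i"] H'[of i "Suc i"] H'[of "Suc i" "Suc i"] i i0
    by auto
  {
    assume x: "x \<in> S" "y \<notin> S" and act: "active TypeC n i S x" "active_left TypeC n i S S' x"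
    \<comment> \<open>The left column enters \<open>K\<close> through its unbarred letters and
      \<open>D\<close> through both kinds, while \<open>D'\<close> is unchanged. So
      \<open>shift_nonneg\<close> is applied with \<kappa>, \<delta> for \<open>D\<close> and with
      \<kappa>, 0 for \<open>D'\<close>.\<close>
    define \<kappa> where "\<kappa> = unb_shift i x y"
    define \<delta> where "\<delta> = - unb_shift i x y - bar_shift i x y"
    have l: "0 \<le> set_net TypeC n i {w \<in> S'. z \<preceq> w} + set_net TypeC n i {w \<in> S. w \<prec> x}"
      and a1: "0 \<le> set_net TypeC n i {w \<in> S. z \<preceq> w \<and> w \<prec> x}"
      and a2: "set_net TypeC n i {w \<in> S. x \<prec> w \<and> w \<preceq> z} \<le> 0" for z
      using act unfolding active_left_def active_def by blast+
    have "(0 \<le> \<kappa> \<or> i = n \<or> K i0 \<le> K i + \<kappa> \<or> K (Suc i) \<le> K i + \<kappa>) \<and>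
      (0 \<le> \<delta> \<or> D i0 \<le> D i + \<delta> \<or> i < n \<and> D (Suc i) \<le> D i + \<delta>) \<and>
      0 \<le> K i + D i + \<kappa> + \<delta> \<and> 0 \<le> K i + D' i + \<kappa> + 0"
    proof (cases "i = n")
      case True
      have "0 \<le> set_net TypeC n n {w \<in> S'. Unb n \<preceq> w} + set_net TypeC n n {w \<in> S. w \<prec> x}"
        using l True by simp
      then show ?thesis
        by (rule_tac moves_cases[OF m]) (use x s HH True Dn fin in
          \<open>auto simp: set_net_TypeC_n \<kappa>_def \<delta>_def unb_shift_def bar_shift_def of_bool_def split: if_splits\<close>)
    next
      case False
      then have "i < n" using i by simp
      \<comment> \<open>The thresholds are the four letters that carry a sign of color
        \<open>i\<close>. Each move then becomes a linear check over the membership of these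
        letters, with \<open>HH\<close> supplying the values near \<open>i\<close>.\<close>
      show ?thesis
        by (rule_tac moves_cases[OF m])
          (use x s HH \<open>i < n\<close> fin l[of "Unb i"] l[of "Bar (Suc i)"] l[of "Bar i"] l[of "Unb (Suc i)"]
            a1[of "Unb i"] a2[of "Bar i"] in
          \<open>auto simp: set_net_TypeC \<kappa>_def \<delta>_def unb_shift_def bar_shift_def of_bool_def split: if_splits\<close>)
    qed
    then have "0 \<le> K a + (if a = i then \<kappa> else 0) + (D b + (if b = i then \<delta> else 0))"
      "0 \<le> K a + (if a = i then \<kappa> else 0) + (D' b + (if b = i then 0 else 0))"
      using shift_nonneg[of n K D \<kappa> i i0 \<delta> a b] shift_nonneg[of n K D' \<kappa> i i0 0 a b] H H' ab i i0 by simp_all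
    then show "0 \<le> k (insert y (S - {x})) S' a + slack (insert y (S - {x})) b \<and>
      0 \<le> k (insert y (S - {x})) S' a + slack S' b + L' - L"
      using upto_move[OF m i(1) x, of a] slack_move[OF m i(1) x, of b] ab
      by (auto simp: k_def K_def D_def D'_def \<kappa>_def \<delta>_def algebra_simps)
  }
  {
    assume x: "x \<in> S'" "y \<notin> S'" and act: "active TypeC n i S' x" "active_right TypeC n i S' S x"
    \<comment> \<open>The right column enters \<open>K\<close> through its barred letters, and now
      \<open>D'\<close> changes while \<open>D\<close> stays.\<close>
    define \<kappa> where "\<kappa> = bar_shift i x y"
    define \<delta> where "\<delta> = - unb_shift i x y - bar_shift i x y"
    have l: "set_net TypeC n i {w \<in> S'. x \<prec> w} + set_net TypeC n i {w \<in> S. w \<preceq> z} \<le> 0"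
      and a1: "0 \<le> set_net TypeC n i {w \<in> S'. z \<preceq> w \<and> w \<prec> x}"
      and a2: "set_net TypeC n i {w \<in> S'. x \<prec> w \<and> w \<preceq> z} \<le> 0" for z
      using act unfolding active_right_def active_def by blast+
    have "(0 \<le> \<kappa> \<or> i = n \<or> K i0 \<le> K i + \<kappa> \<or> K (Suc i) \<le> K i + \<kappa>) \<and>
      (0 \<le> \<delta> \<or> D' i0 \<le> D' i + \<delta> \<or> i < n \<and> D' (Suc i) \<le> D' i + \<delta>) \<and>
      0 \<le> K i + D i + \<kappa> + 0 \<and> 0 \<le> K i + D' i + \<kappa> + \<delta>"
    proof (cases "i = n")
      case True
      have "set_net TypeC n n {w \<in> S'. x \<prec> w} + set_net TypeC n n {w \<in> S. w \<preceq> Bar n} \<le> 0"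
        using l True by simp
      then show ?thesis
        by (rule_tac moves_cases[OF m]) (use x s HH True Dn fin in
          \<open>auto simp: set_net_TypeC_n \<kappa>_def \<delta>_def unb_shift_def bar_shift_def of_bool_def split: if_splits\<close>)
    next
      case False
      then have "i < n" using i by simp
      show ?thesis
        by (rule_tac moves_cases[OF m])
          (use x s HH \<open>i < n\<close> fin l[of "Unb i"] l[of "Bar (Suc i)"] l[of "Bar i"] l[of "Unb (Suc i)"]
            a1[of "Unb i"] a2[of "Bar i"] in
          \<open>auto simp: set_net_TypeC \<kappa>_def \<delta>_def unb_shift_def bar_shift_def of_bool_def split: if_splits\<close>)
    qed
    then have "0 \<le> K a + (if a = i then \<kappa> else 0) + (D b + (if b = i then 0 else 0))"
      "0 \<le> K a + (if a = i then \<kappa> else 0) + (D' b + (if b = i then \<delta> else 0))"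
      using shift_nonneg[of n K D \<kappa> i i0 0 a b] shift_nonneg[of n K D' \<kappa> i i0 \<delta> a b] H H' ab i i0 by simp_all
    then show "0 \<le> k S (insert y (S' - {x})) a + slack S b \<and>
      0 \<le> k S (insert y (S' - {x})) a + slack (insert y (S' - {x})) b + L' - L"
      using upto_move[OF m i(1) x, of a] slack_move[OF m i(1) x, of b] ab
      by (auto simp: k_def K_def D_def D'_def \<kappa>_def \<delta>_def algebra_simps)
  }
qed

section \<open>Connectedness of the tableau crystal\<close>

lemma reading_eq: "reading T = rev (concat T)"
  by (simp add: reading_def rev_concat rev_map)

lemma concat_eq_append_ConsD:
  "concat T = a @ x # b \<Longrightarrow>
    \<exists>T1 c1 c2 T2. T = T1 @ (c1 @ x # c2) # T2 \<and> a = concat T1 @ c1 \<and> b = c2 @ concat T2"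
proof (induction T arbitrary: a)
  case (Cons C T)
  from Cons.prems have "C @ concat T = a @ x # b" by simp
  then consider us where "C = a @ x # us" "b = us @ concat T"
    | us where "a = C @ us" "concat T = us @ x # b"
    by (auto simp: append_eq_append_conv2 Cons_eq_append_conv append_eq_Cons_conv)
  then show ?case
  proof cases
    case (1 us)
    then show ?thesis by (intro exI[of _ "[]"] exI[of _ a] exI[of _ us] exI[of _ T]) simp
  next
    case (2 us)
    from Cons.IH[OF 2(2)] obtain T1 c1 c2 T2 where
      "T = T1 @ (c1 @ x # c2) # T2" "us = concat T1 @ c1" "b = c2 @ concat T2" by blast
    with 2 show ?thesis by (intro exI[of _ "C # T1"] exI[of _ c1] exI[of _ c2] exI[of _ T2]) simp
  qed
qed simp

lemma tableaux_colD:
  "sorted is \<Longrightarrow> T \<in> tableaux g n is \<Longrightarrow> C \<in> set T \<Longrightarrow> col_adm g n C"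
  by (simp add: tableaux_iff)

lemma col_adm_length:
  assumes "col_adm TypeC n C"
  shows "unb_upto (set C) n + bar_upto (set C) n = int (length C)"
  using assms unb_plus_bar by (simp add: col_adm_def)

lemma pair_adm_move_left:
  assumes "pair_adm g n (c1 @ x # c2) D" "col_adm g n (c1 @ x # c2)" "col_adm g n D"
    and m: "moves g n i x y" and i: "1 \<le> i" "i \<le> n"
    and act: "active g n i (set (c1 @ x # c2)) x" "active_left g n i (set (c1 @ x # c2)) (set D) x"
  shows "pair_adm g n (c1 @ y # c2) D"
proof -
  let ?S = "set (c1 @ x # c2)"
  have dec: "decreasing (c1 @ x # c2)" and al: "?S \<subseteq> alphabet g n" using assms(2) by (auto simp: col_adm_def)
  note s = decreasing_move[OF dec al m act(1)]
  have len: "length (c1 @ y # c2) = length (c1 @ x # c2)" by simp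
  have x: "x \<in> ?S" by simp
  show ?thesis
  proof (cases g)
    case TypeA
    then show ?thesis
      using assms(1) m act s(2) x i
        pair_adm_TypeA_move(1)[of ?S "set D" i "int (length (c1 @ x # c2))" "int (length D)" n x y]
      unfolding pair_adm_def s(3) len by simp
  next
    case TypeC
    note lens = col_adm_length[OF assms(2)[unfolded TypeC]] col_adm_length[OF assms(3)[unfolded TypeC]]
    show ?thesis
      unfolding pair_adm_def s(3) len TypeC cartan.case
      by (intro allI impI, elim conjE, rule pair_adm_TypeC_move(1)[OF finite_set finite_set i lens _ _
          m[unfolded TypeC] _ _ x s(2) act[unfolded TypeC]])
        (use assms(1) TypeC in \<open>simp_all add: pair_adm_def\<close>)
  qed
qed

lemma pair_adm_move_right:
  assumes "pair_adm g n D (c1 @ x # c2)" "col_adm g n (c1 @ x # c2)" "col_adm g n D"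
    and m: "moves g n i x y" and i: "1 \<le> i" "i \<le> n"
    and act: "active g n i (set (c1 @ x # c2)) x" "active_right g n i (set (c1 @ x # c2)) (set D) x"
  shows "pair_adm g n D (c1 @ y # c2)"
proof -
  let ?S = "set (c1 @ x # c2)"
  have dec: "decreasing (c1 @ x # c2)" and al: "?S \<subseteq> alphabet g n" using assms(2) by (auto simp: col_adm_def)
  note s = decreasing_move[OF dec al m act(1)]
  have len: "length (c1 @ y # c2) = length (c1 @ x # c2)" by simp
  have x: "x \<in> ?S" by simp
  show ?thesis
  proof (cases g)
    case TypeA
    then show ?thesis
      using assms(1) m act s(2) x i
        pair_adm_TypeA_move(2)[of "set D" ?S i "int (length D)" "int (length (c1 @ x # c2))" n x y]
      unfolding pair_adm_def s(3) len by simp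
  next
    case TypeC
    note lens = col_adm_length[OF assms(3)[unfolded TypeC]] col_adm_length[OF assms(2)[unfolded TypeC]]
    show ?thesis
      unfolding pair_adm_def s(3) len TypeC cartan.case
      by (intro allI impI, elim conjE, rule pair_adm_TypeC_move(2)[OF finite_set finite_set i lens _ _
          m[unfolded TypeC] _ _ x s(2) act[unfolded TypeC]])
        (use assms(1) TypeC in \<open>simp_all add: pair_adm_def\<close>)
  qed
qed

text \<open>Only pairs containing the changed column are affected. Its right neighbour is read just
  before it and its left neighbour just after it, so \<open>u\<close> and \<open>v\<close> control
  exactly these two.\<close>

lemma tableaux_move:
  assumes "sorted is" "T \<in> tableaux g n is" "1 \<le> i" "i \<le> n" and m: "moves g n i x y"
    and r: "reading T = u @ x # v" and uv: "no_plus_word g n i u" "no_minus_word g n i v"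
  shows "\<exists>T'\<in>tableaux g n is. reading T' = u @ y # v"
proof -
  have "concat T = rev v @ x # rev u" using r unfolding reading_eq
    by (metis append.assoc append_Cons append_Nil rev.simps(2) rev_append rev_rev_ident rev_swap)
  from concat_eq_append_ConsD[OF this] obtain T1 c1 c2 T2 where
    T: "T = T1 @ (c1 @ x # c2) # T2" "rev v = concat T1 @ c1" "rev u = c2 @ concat T2" by blast
  have u: "u = reading T2 @ rev c2" using arg_cong[OF T(3), of rev] by (simp add: reading_eq)
  have v: "v = rev c1 @ reading T1" using arg_cong[OF T(2), of rev] by (simp add: reading_eq)
  define C where "C = c1 @ x # c2"
  define C' where "C' = c1 @ y # c2"
  define T' where "T' = T1 @ C' # T2"
  have T: "T = T1 @ C # T2" using T by (simp add: C_def)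
  have adm: "\<forall>D\<in>set T. col_adm g n D" and len: "map length T = is"
    and pairs: "\<And>k. Suc k < length T \<Longrightarrow> pair_adm g n (T ! k) (T ! Suc k)"
    using assms(2) unfolding tableaux_iff[OF assms(1)] by auto
  have C: "col_adm g n C" using adm T by simp
  then have dec: "decreasing (c1 @ x # c2)" by (simp add: col_adm_def C_def)
  have act: "active g n i (set (c1 @ x # c2)) x"
    using active_reading[OF dec] uv unfolding u v by blast
  have C': "col_adm g n C'" using col_adm_move[of g n c1 x c2 i y] C m assms(3,4) act by (simp add: C_def C'_def)
  have len': "length T' = length T" by (simp add: T'_def T)
  have "pair_adm g n (T' ! k) (T' ! Suc k)" if k: "Suc k < length T'" for k
  proof -
    consider "k = length T1" | "Suc k = length T1" | "k \<noteq> length T1" "Suc k \<noteq> length T1" by blast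
    then show ?thesis
    proof cases
      case 1
      with k obtain D T2' where D: "T2 = D # T2'" by (cases T2) (auto simp: T'_def)
      have "active_left g n i (set (c1 @ x # c2)) (set D) x"
        using active_left_reading[OF dec, of D g n i "reading T2'"] uv(1) adm T D
        by (simp add: u reading_def col_adm_def)
      then have "pair_adm g n C' D"
        using pair_adm_move_left[of g n c1 x c2 D i y] pairs[of k] 1 k C adm m assms(3,4) act
        by (simp add: C_def C'_def T D T'_def nth_append)
      then show ?thesis using 1 by (simp add: T'_def D nth_append)
    next
      case 2
      then obtain T1' D where D: "T1 = T1' @ [D]" by (cases T1 rule: rev_cases) auto
      have "active_right g n i (set (c1 @ x # c2)) (set D) x"
        using active_right_reading[OF dec, of D g n i "reading T1'"] uv(2) adm T D
        by (simp add: v reading_def col_adm_def)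
      then have "pair_adm g n D C'"
        using pair_adm_move_right[of g n D c1 x c2 i y] pairs[of k] 2 k C adm m assms(3,4) act
        by (simp add: C_def C'_def T D T'_def nth_append)
      then show ?thesis using 2 by (simp add: T'_def D nth_append)
    next
      case 3
      then have "T' ! k = T ! k" "T' ! Suc k = T ! Suc k"
        by (auto simp: T'_def T nth_append nth_Cons')
      then show ?thesis using pairs[of k] k len' by simp
    qed
  qed
  moreover have "map length T' = is" using len by (simp add: T T'_def C_def C'_def)
  moreover have "\<forall>D\<in>set T'. col_adm g n D" using adm C' by (auto simp: T T'_def)
  ultimately have "T' \<in> tableaux g n is" unfolding tableaux_iff[OF assms(1)] by blast
  moreover have "reading T' = u @ y # v" by (simp add: T'_def C'_def reading_def u v)
  ultimately show ?thesis by blast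
qed

lemma tableaux_word_f:
  assumes "sorted is" "T \<in> tableaux g n is" "i \<in> {1..n}" "word_f g n i (reading T) = Some w"
  shows "\<exists>T'\<in>tableaux g n is. reading T' = w"
  using assms(4) tableaux_move[OF assms(1,2), of i] assms(3)
  unfolding word_f_iff moves_def by (metis atLeastAtMost_iff)

lemma tableaux_word_e:
  assumes "sorted is" "T \<in> tableaux g n is" "i \<in> {1..n}" "word_e g n i (reading T) = Some w"
  shows "\<exists>T'\<in>tableaux g n is. reading T' = w"
  using assms(4) tableaux_move[OF assms(1,2), of i] assms(3)
  unfolding word_e_iff moves_def by (metis atLeastAtMost_iff)

section \<open>Highest weight columns and tableaux\<close>

definition hw_column :: "nat \<Rightarrow> letter list" where
  "hw_column k = rev (map Unb [1..<Suc k])"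

lemma length_hw_column [simp]: "length (hw_column k) = k"
  by (simp add: hw_column_def)

lemma set_hw_column: "set (hw_column k) = Unb ` {1..k}"
  by (auto simp: hw_column_def)

lemma nth_hw_column: "p < k \<Longrightarrow> hw_column k ! p = Unb (k - p)"
  by (simp add: hw_column_def rev_nth del: upt_Suc)

lemma unb_upto_hw_column: "unb_upto (Unb ` {1..k}) a = int (min a k)"
  by (induction a) (auto simp: of_bool_def min_def)

lemma bar_upto_hw_column: "bar_upto (Unb ` A) a = 0"
  by (induction a) auto

lemma col_adm_hw_column: "k \<le> n \<Longrightarrow> col_adm g n (hw_column k)"
  unfolding col_adm_def set_hw_column slack_def unb_upto_hw_column bar_upto_hw_column
  by (cases g) (auto simp: hw_column_def sorted_wrt_rev sorted_wrt_map alphabet_def simp del: upt_Suc)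

lemma hw_tableau_mem:
  assumes "sorted is" "set is \<subseteq> {1..n}"
  shows "map hw_column is \<in> tableaux g n is"
proof -
  have "pair_adm g n (hw_column j) (hw_column k)" if "j \<le> k" "k \<le> n" for j k
    unfolding pair_adm_def set_hw_column slack_def unb_upto_hw_column bar_upto_hw_column
    using that by (cases g) (auto simp: min_def)
  moreover have "is ! k \<le> is ! Suc k" "is ! Suc k \<le> n" if "Suc k < length is" for k
    using sorted_nth_mono[OF assms(1), of k "Suc k"] subsetD[OF assms(2) nth_mem[OF that]] that by auto
  ultimately show ?thesis using assms(2)
    unfolding tableaux_iff[OF assms(1)] by (auto simp: comp_def intro!: col_adm_hw_column)
qed

lemma word_net_hw: "k \<le> n \<Longrightarrow> 1 \<le> i \<Longrightarrow> i \<le> n \<Longrightarrow> word_net g n i (map Unb [1..<Suc k]) = - of_bool (i = k)"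
proof (induction k)
  case (Suc k)
  have "[1..<Suc (Suc k)] = [1..<Suc k] @ [Suc k]" by simp
  then show ?case using Suc by (cases g) (auto simp: letter_net_def simp del: upt_Suc)
qed simp

text \<open>The column is determined from the top. After the letters 1, ..., j only color
  \<open>j\<close> has a plus left over, so a minus of the next letter must have color
  \<open>j\<close>, and the letter is \<open>Unb (Suc j)\<close> or \<open>Bar j\<close>. The
  latter, together with 1, ..., j, makes the slack at \<open>j\<close> negative. The letter 1, which
  has no minus, can only come first because the column is strict.\<close>

lemma hw_column_unique:
  assumes C: "col_adm g n C" "length C \<le> n"
    and hw: "\<And>j i. j < length C \<Longrightarrow> i \<in> {1..n} \<Longrightarrow> vec_e g n i (rev C ! j) \<noteq> None \<Longrightarrow>
      word_net g n i (take j (rev C)) < 0"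
  shows "C = hw_column (length C)"
proof -
  let ?R = "rev C"
  have dec: "decreasing C" and al: "set C \<subseteq> alphabet g n" using C by (auto simp: col_adm_def)
  have inc: "sorted_wrt (\<prec>) ?R" using dec by (rule increasing_rev)
  have "take j ?R = map Unb [1..<Suc j]" if "j \<le> length C" for j
    using that
  proof (induction j)
    case (Suc j)
    then have IH: "take j ?R = map Unb [1..<Suc j]" and j: "j < length C" "j < n" using C(2) by auto
    have x: "?R ! j \<in> set C" using j by (metis length_rev nth_mem set_rev)
    have net: "i = j" if "i \<in> {1..n}" "vec_e g n i (?R ! j) \<noteq> None" for i
      using hw[OF j(1) that] that(1) word_net_hw[of j n i g] j(2) unfolding IH by (auto split: if_splits)
    have "?R ! j = Unb (Suc j)"
    proof (cases "?R ! j")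
      case (Unb m)
      have m: "1 \<le> m" "g = TypeC \<longrightarrow> m \<le> n" "m \<le> Suc n" using x al Unb by (cases g; auto simp: alphabet_def)+
      show ?thesis
      proof (cases "m = 1")
        case True
        have "j = 0"
        proof (rule ccontr)
          assume "j \<noteq> 0"
          then have "?R ! 0 = take j ?R ! 0" by simp
          also have "\<dots> = Unb 1" unfolding IH using \<open>j \<noteq> 0\<close> by (simp del: upt_Suc)
          finally have "Unb 1 \<prec> ?R ! j" using sorted_wrt_nth_less[OF inc, of 0 j] j \<open>j \<noteq> 0\<close> by simp
          then show False using Unb True by simp
        qed
        then show ?thesis using Unb True by simp
      next
        case False
        with m obtain i where i: "m = Suc i" "1 \<le> i" by (cases m) auto
        then have "vec_e g n i (?R ! j) \<noteq> None" using Unb m by auto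
        then show ?thesis using net[of i] i m Unb by auto
      qed
    next
      case (Bar b)
      then have g: "g = TypeC" and b: "1 \<le> b" "b \<le> n" using x al by (cases g; auto simp: alphabet_def)+
      then have "vec_e g n b (?R ! j) \<noteq> None" using Bar by auto
      then have bj: "b = j" using net[of b] b by auto
      have sub: "Unb ` {1..j} \<subseteq> set C"
      proof -
        have "set (take j ?R) = Unb ` {1..j}" unfolding IH by auto
        then show ?thesis using set_take_subset[of j ?R] by simp
      qed
      have "unb_upto (set C) a = int a" if "a \<le> j" for a
        using that sub by (induction a) auto
      moreover have "0 < bar_upto (set C) j"
      proof -
        obtain j0 where "j = Suc j0" using b bj by (cases j) auto
        moreover have "0 \<le> bar_upto (set C) a" for a by (induction a) auto
        ultimately show ?thesis using x Bar bj by (simp add: add_nonneg_pos)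
      qed
      ultimately have "slack (set C) j < 0" by (simp add: slack_def)
      moreover have "0 \<le> slack (set C) j" using C(1) g j by (simp add: col_adm_def)
      ultimately show ?thesis by simp
    qed
    then show ?case using IH j by (simp add: take_Suc_conv_app_nth)
  qed (simp del: upt_Suc)
  from this[of "length C"] have "rev C = map Unb [1..<Suc (length C)]" by (simp del: upt_Suc)
  then show ?thesis unfolding hw_column_def by (metis rev_rev_ident)
qed

lemma no_minus_wordD: "no_minus_word g n i (u @ v) \<Longrightarrow> word_net g n i u \<le> 0"
  by (auto simp: no_minus_word_def)

lemma no_minus_word_prefix: "no_minus_word g n i (u @ v) \<Longrightarrow> no_minus_word g n i u"
  unfolding no_minus_word_def by (metis append.assoc)

text \<open>The leftmost column is read last, so the induction removes it and knows the columns to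
  its right. These must contribute net 0 to every color for which a letter of the leftmost column
  has a minus; then the condition on the whole word becomes the hypothesis of
  \<open>hw_column_unique\<close>.\<close>

lemma hw_tableau_unique:
  assumes "sorted (map length T)" "\<forall>C\<in>set T. col_adm g n C \<and> length C \<le> n"
    and "\<And>k. Suc k < length T \<Longrightarrow> rows_weak (T ! k) (T ! Suc k)"
    and "\<And>i. i \<in> {1..n} \<Longrightarrow> no_minus_word g n i (reading T)"
  shows "T = map hw_column (map length T)"
  using assms
proof (induction T)
  case (Cons C T)
  have r: "reading (C # T) = reading T @ rev C" by (simp add: reading_def)
  have IH: "T = map hw_column (map length T)"
  proof (rule Cons.IH)
    show "rows_weak (T ! k) (T ! Suc k)" if "Suc k < length T" for k
      using Cons.prems(3)[of "Suc k"] that by simp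
    show "no_minus_word g n i (reading T)" if "i \<in> {1..n}" for i
      using Cons.prems(4)[OF that] no_minus_word_prefix unfolding r by blast
  qed (use Cons.prems(1,2) in auto)
  have C: "col_adm g n C" "length C \<le> n" using Cons.prems(2) by auto
  have "C = hw_column (length C)"
  proof (rule hw_column_unique[OF C])
    fix j i assume j: "j < length C" and i: "i \<in> {1..n}" "vec_e g n i (rev C ! j) \<noteq> None"
    have "word_net g n i (reading T) = 0"
    proof (cases T)
      case Nil
      then show ?thesis by (simp add: reading_def)
    next
      case (Cons D T')
      \<comment> \<open>Every letter of \<open>C\<close> is at most its bottom entry, hence at most
        the bottom entry \<open>Unb (length D)\<close> of the right neighbour. A minus therefore has
        a color below \<open>length D\<close>, and columns of at least that length have net 0 for
        it.\<close>
      have D: "D = hw_column (length D)" using IH Cons by simp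
      have CD: "length C \<le> length D" using Cons.prems(1) Cons by simp
      have "rows_weak C D" using Cons.prems(3)[of 0] Cons by simp
      then have "C ! 0 \<preceq> D ! 0" using rows_weak_iff[OF CD] j by (metis gr_zeroI not_less_zero)
      also have "D ! 0 = Unb (length D)"
        using nth_hw_column[of 0 "length D"] D CD j by (metis diff_zero gr_zeroI leD not_less_zero)
      finally have C0: "C ! 0 \<preceq> Unb (length D)" .
      have "rev C ! j \<preceq> C ! 0"
      proof -
        have "rev C ! j = C ! (length C - Suc j)" using j by (simp add: rev_nth)
        then show ?thesis
          using sorted_wrt_nth_less[of "\<lambda>x y. y \<prec> x" C 0 "length C - Suc j"] C(1) j
          by (cases "length C - Suc j") (auto simp: col_adm_def letter_le_def)
      qed
      with C0 have "rev C ! j \<preceq> Unb (length D)" using letter_le_trans by blast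
      then obtain m where "rev C ! j = Unb m" "m \<le> length D" by (cases "rev C ! j") auto
      with i(2) have "i < length D" by (auto split: if_splits)
      moreover have "\<forall>E\<in>set T. length D \<le> length E" using Cons.prems(1) Cons by auto
      ultimately have "\<forall>E\<in>set T. i < length E" by auto
      moreover have "\<forall>E\<in>set T. length E \<le> n" using Cons.prems(2) by auto
      moreover have net: "word_net g n i (reading (map hw_column is)) = 0"
        if "\<forall>k\<in>set is. i < k \<and> k \<le> n" for "is"
        using that
      proof (induction "is")
        case (Cons k "is")
        then show ?case using word_net_hw[of k n i g] i(1) by (simp add: reading_def hw_column_def del: upt_Suc)
      qed (simp add: reading_def)
      ultimately have "word_net g n i (reading (map hw_column (map length T))) = 0"
        by (intro net) auto
      then show ?thesis using IH by simp
    qed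
    moreover have "word_net g n i (reading T @ take j (rev C) @ [rev C ! j]) \<le> 0"
    proof (rule no_minus_wordD)
      have "rev C = take j (rev C) @ [rev C ! j] @ drop (Suc j) (rev C)"
        using id_take_nth_drop[of j "rev C"] j by simp
      then show "no_minus_word g n i ((reading T @ take j (rev C) @ [rev C ! j]) @ drop (Suc j) (rev C))"
        using Cons.prems(4)[OF i(1)] unfolding r by (metis append.assoc)
    qed
    moreover have "letter_net g n i (rev C ! j) = 1"
      using i(2) by (cases rule: vec_signs_cases[of g n i "rev C ! j"]) auto
    ultimately show "word_net g n i (take j (rev C)) < 0" by simp
  qed
  then show ?case using IH by simp
qed simp

text \<open>Each arrow raises the rank by one; \<open>Bar n\<close> comes right after
  \<open>Unb n\<close>. The total over a word thus measures the distance from the highest weight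
  element.\<close>

fun letter_rank :: "nat \<Rightarrow> letter \<Rightarrow> nat" where
  "letter_rank n (Unb j) = j"
| "letter_rank n (Bar j) = 2 * n + 1 - j"

lemma letter_rank_vec_f:
  "vec_f g n i x = Some y \<Longrightarrow> 1 \<le> i \<Longrightarrow> i \<le> n \<Longrightarrow> letter_rank n y = Suc (letter_rank n x)"
  by (erule vec_f_cases) auto

text \<open>Connectedness as an induction rule. An application of some \<open>word_e\<close> stays
  among the tableaux and lowers the total rank, so the descent stops, and it can stop only where
  \<open>hw_tableau_unique\<close> applies.\<close>

lemma tableaux_induct [consumes 3, case_names highest step]:
  assumes "sorted is" "set is \<subseteq> {1..n}" "T \<in> tableaux g n is"
    and "P (map hw_column is)"
    and "\<And>T T' i. T \<in> tableaux g n is \<Longrightarrow> T' \<in> tableaux g n is \<Longrightarrow> i \<in> {1..n} \<Longrightarrow>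
      word_f g n i (reading T) = Some (reading T') \<Longrightarrow> P T \<Longrightarrow> P T'"
  shows "P T"
  using assms(3)
proof (induction "\<Sum>x\<leftarrow>reading T. letter_rank n x" arbitrary: T rule: less_induct)
  case less
  show ?case
  proof (cases "\<exists>i\<in>{1..n}. word_e g n i (reading T) \<noteq> None")
    case True
    then obtain i w where i: "i \<in> {1..n}" "word_e g n i (reading T) = Some w" by auto
    from tableaux_word_e[OF assms(1) less.prems i] obtain T' where
      T': "T' \<in> tableaux g n is" "reading T' = w" by blast
    have f: "word_f g n i (reading T') = Some (reading T)"
      using i(2) by (simp add: word_e_iff_word_f T'(2))
    then obtain u x y v where "reading T' = u @ x # v" "reading T = u @ y # v" "vec_f g n i x = Some y"
      unfolding word_f_iff by blast
    then have "(\<Sum>x\<leftarrow>reading T'. letter_rank n x) < (\<Sum>x\<leftarrow>reading T. letter_rank n x)"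
      using letter_rank_vec_f[of g n i x y] i(1) by simp
    from less.hyps[OF this T'(1)] show ?thesis using assms(5)[OF T'(1) less.prems i(1) f] by blast
  next
    case False
    have len: "map length T = is" and T: "\<forall>C\<in>set T. col_adm g n C"
      using less.prems unfolding tableaux_iff[OF assms(1)] by auto
    have "T = map hw_column (map length T)"
    proof (rule hw_tableau_unique)
      have "length C \<le> n" if "C \<in> set T" for C
      proof -
        have "length C \<in> set is" using that len by auto
        then show ?thesis using assms(2) by auto
      qed
      then show "\<forall>C\<in>set T. col_adm g n C \<and> length C \<le> n" using T by blast
      show "rows_weak (T ! k) (T ! Suc k)" if "Suc k < length T" for k
        using less.prems that unfolding tableaux_def rows_weak_def by blast
      show "no_minus_word g n i (reading T)" if "i \<in> {1..n}" for i
        using False that by (simp add: word_e_None_iff[symmetric])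
    qed (use len assms(1) in simp)
    then show ?thesis using assms(4) len by simp
  qed
qed

lemma unread_eq:
  assumes "map length T = is" "reading T = w"
  shows "unread is w = T"
proof -
  have "length w = sum_list is" using assms by (auto simp: reading_eq length_concat)
  from the1_equality[OF ex1_unread[OF this]] assms show ?thesis unfolding unread_def by blast
qed

section \<open>Columns of type C\<close>

lemma puts_block_from:
  "puts_block g n N i m (F, F) z \<longleftrightarrow> (if split_layer g n (Suc F)
     then front_color g n N m (Suc F) = i \<and> z = (Suc F, F) \<or> back_color g n N m (Suc F) = i \<and> z = (F, Suc F)
     else front_color g n N m (Suc F) = i \<and> z = (Suc F, Suc F))"
  "puts_block g n N i m (Suc F, F) z \<longleftrightarrow>
     split_layer g n (Suc F) \<and> back_color g n N m (Suc F) = i \<and> z = (Suc F, Suc F)"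
  "puts_block g n N i m (F, Suc F) z \<longleftrightarrow>
     split_layer g n (Suc F) \<and> front_color g n N m (Suc F) = i \<and> z = (Suc F, Suc F)"
  by (auto simp: puts_block.simps)

lemma puts_block_into:
  "puts_block g n N i m z (Suc F, Suc F) \<longleftrightarrow> (if split_layer g n (Suc F)
     then front_color g n N m (Suc F) = i \<and> z = (F, Suc F) \<or> back_color g n N m (Suc F) = i \<and> z = (Suc F, F)
     else front_color g n N m (Suc F) = i \<and> z = (F, F))"
  "puts_block g n N i m z (Suc F, F) \<longleftrightarrow>
     split_layer g n (Suc F) \<and> front_color g n N m (Suc F) = i \<and> z = (F, F)"
  "puts_block g n N i m z (F, Suc F) \<longleftrightarrow>
     split_layer g n (Suc F) \<and> back_color g n N m (Suc F) = i \<and> z = (F, F)"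
  "\<not> puts_block g n N i m z (0, 0)"
  by (auto simp: puts_block.simps)

text \<open>
  The column of type \<open>C\<^sub>n\<close> with letter \<open>x\<close>, raised by \<open>p\<close> periods.  The letter \<open>Bar 1\<close> has its top in
  the following period.  The flag \<open>e\<close> says that the front color is \<open>0\<close>.
\<close>

definition colC :: "nat \<Rightarrow> bool \<Rightarrow> nat \<Rightarrow> letter \<Rightarrow> column" where
  "colC n e p x = (let q = p * (2 * n - 2) in case x of
     Unb j \<Rightarrow> if j = 1 then (if e then (Suc q, q) else (q, Suc q)) else (q + j - 1, q + j - 1)
   | Bar j \<Rightarrow> if j = 1 then (if e then (q + (2 * n - 2), Suc (q + (2 * n - 2)))
         else (Suc (q + (2 * n - 2)), q + (2 * n - 2)))
       else (q + 2 * n - j, q + 2 * n - j))"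

lemma layerC:
  assumes "r < 2 * n - 2"
  shows "split_layer TypeC n (Suc (p * (2 * n - 2) + r)) \<longleftrightarrow> r = 0"
    "front_color TypeC n N m (Suc (p * (2 * n - 2) + r)) =
      (if r = 0 then (m + N) mod 2 else if r < n then r + 1 else 2 * n - 1 - r)"
  using assms by (simp_all add: split_layer_def front_color_def period_def)

lemma layerC_top:
  "split_layer TypeC n (Suc (p * (2 * n - 2) + (2 * n - 2)))"
  "front_color TypeC n N m (Suc (p * (2 * n - 2) + (2 * n - 2))) = (m + N) mod 2"
  by (simp_all add: split_layer_def front_color_def period_def)

lemma layerC0:
  "split_layer TypeC n (Suc (p * (2 * n - 2)))"
  "front_color TypeC n N m (Suc (p * (2 * n - 2))) = (m + N) mod 2"
  by (simp_all add: split_layer_def front_color_def period_def)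

lemma colC_Unb: "2 \<le> j \<Longrightarrow> colC n e p (Unb j) = (Suc (p * (2 * n - 2) + (j - 2)), Suc (p * (2 * n - 2) + (j - 2)))"
  by (auto simp: colC_def Let_def)

lemma colC_Bar: "2 \<le> j \<Longrightarrow> j \<le> n \<Longrightarrow> colC n e p (Bar j) = (Suc (p * (2 * n - 2) + (2 * n - 1 - j)), Suc (p * (2 * n - 2) + (2 * n - 1 - j)))"
  by (auto simp: colC_def Let_def)

lemma colC_1:
  "colC n e p (Unb (Suc 0)) = (if e then (Suc (p * (2 * n - 2)), p * (2 * n - 2))
     else (p * (2 * n - 2), Suc (p * (2 * n - 2))))"
  "colC n e p (Bar (Suc 0)) = (if e then (p * (2 * n - 2) + (2 * n - 2), Suc (p * (2 * n - 2) + (2 * n - 2)))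
     else (Suc (p * (2 * n - 2) + (2 * n - 2)), p * (2 * n - 2) + (2 * n - 2)))"
  by (simp_all add: colC_def Let_def)

lemma alphabetC_cases:
  assumes "x \<in> alphabet TypeC n"
  obtains "x = Unb (Suc 0)" | j where "x = Unb j" "2 \<le> j" "j \<le> n"
  | j where "x = Bar j" "2 \<le> j" "j \<le> n" | "x = Bar (Suc 0)"
proof (cases x)
  case (Unb j)
  then have "1 \<le> j" "j \<le> n" using assms by (auto simp: alphabet_def)
  then show ?thesis using that(1,2) Unb by (cases "j = 1") auto
next
  case (Bar j)
  then have "1 \<le> j" "j \<le> n" using assms by (auto simp: alphabet_def)
  then show ?thesis using that(3,4) Bar by (cases "j = 1") auto
qed

lemma parity_colors:
  "even (m + N) \<Longrightarrow> (m + N) mod 2 = (0::nat)" "odd (m + N) \<Longrightarrow> (m + N) mod 2 = (1::nat)"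
  by presburger+

lemma column_letter_layerC:
  assumes "3 \<le> n" "r < 2 * n - 2"
  shows "column_letter TypeC n N m (Suc (p * (2 * n - 2) + r), Suc (p * (2 * n - 2) + r)) =
    (if r < n - 1 then Unb (r + 2) else Bar (2 * n - 1 - r))"
  using assms layerC[OF assms(2)] by (auto simp: column_letter_def Let_def period_def)

lemma column_letter_colC:
  assumes "3 \<le> n" "x \<in> alphabet TypeC n"
  shows "column_letter TypeC n N m (colC n (even (m + N)) p x) = x"
  using assms(2)
proof (cases rule: alphabetC_cases)
  case 1
  then show ?thesis
    using layerC0[where p = p and n = n] by (cases "even (m + N)") (auto simp: colC_1 column_letter_def back_color_def parity_colors)
next
  case (2 j)
  then have r: "j - 2 < 2 * n - 2" using assms by auto
  show ?thesis
    unfolding 2(1) colC_Unb[OF 2(2)] column_letter_layerC[OF assms(1) r] using 2 assms by auto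
next
  case (3 j)
  then have r: "2 * n - 1 - j < 2 * n - 2" using assms by auto
  show ?thesis
    unfolding 3(1) colC_Bar[OF 3(2,3)] column_letter_layerC[OF assms(1) r] using 3 assms by auto
next
  case 4
  then show ?thesis
    using layerC_top[where p = p and n = n] by (cases "even (m + N)") (auto simp: colC_1 Let_def column_letter_def back_color_def parity_colors)
qed

text \<open>With front color 1, the letter 1 in the lowest period would be a single back block
  \<open>(0, 1)\<close> without the ground-state block; the last hypothesis excludes this.\<close>

lemma column_ok_colC:
  assumes "3 \<le> n" "x \<in> alphabet TypeC n" "p = 0 \<and> x = Unb 1 \<longrightarrow> e"
  shows "column_ok TypeC n (colC n e p x)"
  using assms(2)
proof (cases rule: alphabetC_cases)
  case 1
  then show ?thesis using layerC0[where p = p and n = n] assms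
    by (cases p) (auto simp: colC_1 column_ok_def ground_column_def Let_def)
next
  case 4
  then show ?thesis using layerC_top[where p = p and n = n] assms
    by (auto simp: colC_1 column_ok_def ground_column_def Let_def)
qed (auto simp: colC_Unb colC_Bar column_ok_def ground_column_def)

text \<open>For colors other than 0 the period index \<open>p\<close> never changes. This is why
  \<open>Bar 1\<close>, although it lies in the next split layer, is counted with the period of
  \<open>Bar 2\<close>: it arises from \<open>Bar 2\<close> by a 1-block.\<close>

lemma puts_block_colC:
  assumes "3 \<le> n" "x \<in> alphabet TypeC n" "1 \<le> i" "i \<le> n"
  shows "puts_block TypeC n N i m (colC n (even (m + N)) p x) z \<longleftrightarrow>
    (\<exists>y. vec_f TypeC n i x = Some y \<and> z = colC n (even (m + N)) p y)"
  using assms(2)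
proof (cases rule: alphabetC_cases)
  case 1
  then show ?thesis using layerC0[where p = p and n = n] assms
    by (cases "even (m + N)")
      (auto simp: colC_1 colC_Unb Let_def puts_block_from back_color_def parity_colors)
next
  case (2 j)
  define q where "q = p * (2 * n - 2)"
  have r: "j - 1 < 2 * n - 2" using 2 assms by auto
  have s: "Suc (q + (j - 2)) = q + (j - 1)" using 2 by auto
  have L: "\<not> split_layer TypeC n (Suc (q + (j - 1)))" "front_color TypeC n N m (Suc (q + (j - 1))) = j"
    using layerC[OF r, where p = p] 2 by (auto simp: q_def)
  have "colC n (even (m + N)) p (if j = n then Bar n else Unb (Suc j)) = (Suc (q + (j - 1)), Suc (q + (j - 1)))"
    using 2 assms(1) s by (auto simp: colC_Unb colC_Bar q_def[symmetric])
  then show ?thesis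
    unfolding 2(1) colC_Unb[OF 2(2)] q_def[symmetric] s puts_block_from using L by auto
next
  case (3 j)
  define q where "q = p * (2 * n - 2)"
  show ?thesis
  proof (cases "j = 2")
    case True
    have s: "Suc (q + (2 * n - 1 - j)) = q + (2 * n - 2)" using assms True by auto
    show ?thesis
      unfolding 3(1) colC_Bar[OF 3(2,3)] q_def[symmetric] s puts_block_from
      using layerC_top[where p = p and n = n] True 3 assms
      by (cases "even (m + N)") (auto simp: q_def[symmetric] colC_1 Let_def back_color_def parity_colors)
  next
    case False
    have r: "2 * n - j < 2 * n - 2" using 3 assms False by auto
    have s: "Suc (q + (2 * n - 1 - j)) = q + (2 * n - j)" using assms 3 by auto
    have L: "\<not> split_layer TypeC n (Suc (q + (2 * n - j)))" "front_color TypeC n N m (Suc (q + (2 * n - j))) = j - 1"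
      using layerC[OF r, where p = p] 3 assms by (auto simp: q_def)
    have "colC n (even (m + N)) p (Bar (j - 1)) = (Suc (q + (2 * n - j)), Suc (q + (2 * n - j)))"
      using 3 False by (auto simp: colC_Bar q_def[symmetric])
    then show ?thesis
      unfolding 3(1) colC_Bar[OF 3(2,3)] q_def[symmetric] s puts_block_from using L 3 assms False by auto
  qed
next
  case 4
  then show ?thesis using layerC_top[where p = p and n = n] assms
    by (cases "even (m + N)")
      (auto simp: colC_1 colC_Unb Let_def puts_block_from back_color_def parity_colors)
qed

lemma puts_block_into_colC:
  assumes "3 \<le> n" "x \<in> alphabet TypeC n" "1 \<le> i" "i \<le> n"
    and "puts_block TypeC n N i m z (colC n (even (m + N)) p x)"
  shows "\<exists>y. vec_e TypeC n i x = Some y \<and> z = colC n (even (m + N)) p y"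
  using assms(2)
proof (cases rule: alphabetC_cases)
  case 1
  then show ?thesis using layerC0[where p = p and n = n] assms
    by (cases "even (m + N)")
      (auto simp: colC_1 Let_def puts_block_into back_color_def parity_colors)
next
  case (2 j)
  define q where "q = p * (2 * n - 2)"
  have r: "j - 2 < 2 * n - 2" using 2 assms by auto
  have L: "split_layer TypeC n (Suc (q + (j - 2))) \<longleftrightarrow> j = 2"
    "front_color TypeC n N m (Suc (q + (j - 2))) = (if j = 2 then (m + N) mod 2 else j - 1)"
    using layerC[OF r, where p = p] 2 by (auto simp: q_def)
  note P = assms(5)[unfolded 2(1) colC_Unb[OF 2(2)] q_def[symmetric] puts_block_into L]
  show ?thesis
  proof (cases "j = 2")
    case True
    have c: "front_color TypeC n N m (Suc q) = (if even (m + N) then 0 else 1)"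
      using L(2) True parity_colors[of m N] by simp
    have "i = 1 \<and> z = (if even (m + N) then (Suc q, q) else (q, Suc q))"
      using P True assms(3) by (auto simp: back_color_def c[simplified] split: if_splits)
    then show ?thesis using True 2 assms(1) by (auto simp: colC_1 q_def)
  next
    case False
    then have "colC n (even (m + N)) p (Unb (j - 1)) = (q + (j - 2), q + (j - 2))"
      using 2 by (auto simp: colC_Unb q_def[symmetric])
    then show ?thesis using P False 2 by auto
  qed
next
  case (3 j)
  define q where "q = p * (2 * n - 2)"
  have r: "2 * n - 1 - j < 2 * n - 2" using 3 assms by auto
  have L: "\<not> split_layer TypeC n (Suc (q + (2 * n - 1 - j)))"
    "front_color TypeC n N m (Suc (q + (2 * n - 1 - j))) = j"
    using layerC[OF r, where p = p] 3 assms by (auto simp: q_def)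
  note P = assms(5)[unfolded 3(1) colC_Bar[OF 3(2,3)] q_def[symmetric] puts_block_into]
  have "colC n (even (m + N)) p (if j = n then Unb n else Bar (Suc j)) = (q + (2 * n - 1 - j), q + (2 * n - 1 - j))"
    using 3 assms(1) by (auto simp: colC_Unb colC_Bar q_def[symmetric])
  then show ?thesis using P L 3 by (auto split: if_splits)
next
  case 4
  define q where "q = p * (2 * n - 2) + (2 * n - 2)"
  have B2: "colC n (even (m + N)) p (Bar 2) = (q, q)"
    using assms(1) by (auto simp: colC_Bar q_def)
  have L: "split_layer TypeC n (Suc q)"
    "front_color TypeC n N m (Suc q) = (if even (m + N) then 0 else 1)"
    using layerC_top[where p = p and n = n] parity_colors[of m N] by (simp_all add: q_def)
  have "colC n (even (m + N)) p x = (if even (m + N) then (q, Suc q) else (Suc q, q))"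
    unfolding 4 colC_1 q_def ..
  then have "i = 1 \<and> z = (q, q)"
    using assms(5) by (auto simp: puts_block_into back_color_def L split: if_splits)
  then show ?thesis using 4 assms(1) B2 by (auto simp: numeral_2_eq_2)
qed

section \<open>Conditions on neighbouring columns\<close>

definition pair_ok :: "cartan \<Rightarrow> column \<Rightarrow> column \<Rightarrow> bool" where
  "pair_ok g c d \<longleftrightarrow> fst d \<le> fst c \<and> snd d \<le> snd c \<and> (g = TypeC \<longrightarrow> \<not> (full_column c \<and> c = d))"

lemma pair_ok_colC_less:
  assumes "3 \<le> n" "x \<in> alphabet TypeC n" "y \<in> alphabet TypeC n" "y \<prec> x"
  shows "pair_ok TypeC (colC n e p x) (colC n (\<not> e) p y)"
  by (rule alphabetC_cases[OF assms(2)]; rule alphabetC_cases[OF assms(3)];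
      use assms in \<open>auto simp: colC_1 colC_Unb colC_Bar Let_def pair_ok_def full_column_def\<close>)

text \<open>The critical case is \<open>x = y\<close>. Full columns of equal height are forbidden,
  and for the letters \<open>1\<close> and \<open>Bar 1\<close> the alternating front colors put the
  two half blocks into opposite halves.\<close>

lemma pair_ok_colC_iff:
  assumes "3 \<le> n" "x \<in> alphabet TypeC n" "y \<in> alphabet TypeC n" "x \<preceq> y"
  shows "\<not> pair_ok TypeC (colC n e p x) (colC n (\<not> e) p y)"
  by (rule alphabetC_cases[OF assms(2)]; rule alphabetC_cases[OF assms(3)];
      use assms in \<open>auto simp: colC_1 colC_Unb colC_Bar Let_def pair_ok_def full_column_def\<close>)

lemma pair_ok_colC_Suc:
  assumes "3 \<le> n" "x \<in> alphabet TypeC n" "y \<in> alphabet TypeC n"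
  shows "pair_ok TypeC (colC n e (Suc p) x) (colC n (\<not> e) p y)"
  by (rule alphabetC_cases[OF assms(2)]; rule alphabetC_cases[OF assms(3)];
      use assms in \<open>auto simp: colC_1 colC_Unb colC_Bar Let_def pair_ok_def full_column_def\<close>)

text \<open>\<open>Bar 1\<close> in period \<open>p\<close> and \<open>1\<close> in period
  \<open>Suc p\<close> are half blocks of the same split layer. By the alternating front colors they
  lie in the same half, so the two columns are equal but not full.\<close>

lemma pair_ok_colC_lowered:
  assumes "3 \<le> n" "x \<in> alphabet TypeC n" "y \<in> alphabet TypeC n"
    and "pair_ok TypeC (colC n e p x) (colC n (\<not> e) (Suc p) y)"
  shows "x = Bar 1 \<and> y = Unb 1"
  by (rule alphabetC_cases[OF assms(2)]; rule alphabetC_cases[OF assms(3)];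
      use assms in \<open>auto simp: colC_1 colC_Unb colC_Bar Let_def pair_ok_def full_column_def split: if_splits\<close>)

lemma pair_ok_colC_ground:
  assumes "3 \<le> n" "x \<in> alphabet TypeC n"
  shows "pair_ok TypeC (colC n True 0 x) (ground_column TypeC)"
  by (rule alphabetC_cases[OF assms(2)];
      use assms in \<open>auto simp: colC_1 colC_Unb colC_Bar Let_def pair_ok_def full_column_def ground_column_def\<close>)

text \<open>In the lowest period only \<open>Bar 2\<close> and \<open>Bar 1\<close> are high enough
  to lose a whole period, which gives the two exceptional outcomes.\<close>

lemma colC_lowered:
  assumes "3 \<le> n" "x \<in> alphabet TypeC n" "colC n e p x = (f + period TypeC n, b + period TypeC n)"
  shows "(\<exists>p'. p = Suc p' \<and> (f, b) = colC n e p' x) \<or> p = 0 \<and> (f, b) = (0, 0) \<or>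
    p = 0 \<and> x = Bar 1 \<and> (f, b) = (if e then (0, 1) else (1, 0))"
proof (cases p)
  case 0
  then show ?thesis
    by (rule_tac alphabetC_cases[OF assms(2)])
      (use assms in \<open>auto simp: colC_1 colC_Unb colC_Bar Let_def period_def split: if_splits\<close>)
next
  case (Suc p')
  then have "(f, b) = colC n e p' x"
    by (rule_tac alphabetC_cases[OF assms(2)])
      (use assms in \<open>auto simp: colC_1 colC_Unb colC_Bar Let_def period_def split: if_splits\<close>)
  then show ?thesis using Suc by blast
qed

section \<open>Columns of a wall\<close>

lemma block_start_Suc: "k < length is \<Longrightarrow> block_start is (Suc k) = block_start is k + is ! k"
  by (simp add: block_start_def take_Suc_conv_app_nth)

lemma block_start_mono: "j \<le> k \<Longrightarrow> block_start is j \<le> block_start is k"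
proof (induction k)
  case (Suc k)
  have "block_start is k \<le> block_start is (Suc k)"
    by (cases "k < length is") (simp_all add: block_start_def take_Suc_conv_app_nth)
  with Suc show ?case by (auto simp: le_Suc_eq)
qed simp

lemma block_start_le: "k \<le> length is \<Longrightarrow> block_start is k \<le> sum_list is"
  using block_start_mono[of k "length is" "is"] by (simp add: block_start_def)

lemma block_of_eq:
  assumes "k < length is" "1 \<le> a" "a \<le> is ! k"
  shows "block_of is (block_start is k + a) = k"
  unfolding block_of_def
proof (rule Least_equality)
  show "block_start is k + a \<le> block_start is (Suc k)" using assms by (simp add: block_start_Suc)
  fix j assume "block_start is k + a \<le> block_start is (Suc j)"
  then have "\<not> Suc j \<le> k" using block_start_mono[of "Suc j" k "is"] assms(2) by linarith
  then show "k \<le> j" by simp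
qed

lemma block_cases:
  assumes "1 \<le> m" "m \<le> sum_list is"
  obtains k a where "k < length is" "1 \<le> a" "a \<le> is ! k" "m = block_start is k + a"
proof -
  have "\<exists>k a. k < length is \<and> 1 \<le> a \<and> a \<le> is ! k \<and> m = block_start is k + a"
    if "m \<le> block_start is j" "j \<le> length is" for j
    using that
  proof (induction j)
    case 0
    then show ?case using assms by (simp add: block_start_def)
  next
    case (Suc j)
    show ?case
    proof (cases "m \<le> block_start is j")
      case False
      then show ?thesis using Suc.prems
        by (intro exI[of _ j] exI[of _ "m - block_start is j"]) (auto simp: block_start_Suc)
    qed (use Suc in auto)
  qed
  from this[of "length is"] assms(2) that show ?thesis by (auto simp: block_start_def)
qed

text \<open>
  In type \<open>A\<^sub>n\<close> only \<open>letter_rank 0 (Unb j) = j\<close> is used.  Truncation of a negative height to \<open>0\<close> occurs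
  only for letters that are too small for their row (see \<open>good\<close> below).
\<close>

definition colA :: "int \<Rightarrow> letter \<Rightarrow> column" where
  "colA B x = (nat (B + int (letter_rank 0 x)), nat (B + int (letter_rank 0 x)))"

lemma front_color_phase:
  assumes "(int (N mod (n + 1)) - int m + B + 1) mod int (n + 1) = 0" "0 \<le> B + int j"
  shows "front_color TypeA n N m (nat (B + int j)) = nat ((int j - 1) mod int (n + 1))"
proof -
  have "(int (N mod (n + 1)) - int m + int (nat (B + int j))) mod int (n + 1) =
      ((int (N mod (n + 1)) - int m + B + 1) + (int j - 1)) mod int (n + 1)"
    using assms(2) by (simp add: algebra_simps)
  also have "\<dots> = (int j - 1) mod int (n + 1)"
    using assms(1) by (metis add_0 mod_add_left_eq)
  finally show ?thesis by (simp only: front_color_def cartan.case)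
qed

lemma split_layer_TypeA [simp]: "\<not> split_layer TypeA n h"
  by (simp add: split_layer_def)

text \<open>The congruence makes \<open>B + j\<close> a height with top color \<open>j - 1\<close>,
  that is, with letter \<open>j\<close>. As \<open>B\<close> can be negative, the lemmas ask for
  \<open>0 \<le> B + int j\<close>.\<close>

locale phaseA =
  fixes n N m :: nat and B :: int
  assumes phase: "(int (N mod (n + 1)) - int m + B + 1) mod int (n + 1) = 0"
begin

lemma color: "1 \<le> j \<Longrightarrow> j \<le> Suc n \<Longrightarrow> 0 \<le> B + int j \<Longrightarrow> front_color TypeA n N m (nat (B + int j)) = j - 1"
  using front_color_phase[OF phase] by (simp add: nat_diff_distrib of_nat_diff[symmetric] del: of_nat_diff)

lemma color_Suc:
  assumes "1 \<le> j" "j \<le> Suc n" "0 \<le> B + int j"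
  shows "front_color TypeA n N m (Suc (nat (B + int j))) = (if j = Suc n then 0 else j)"
proof -
  have "Suc (nat (B + int j)) = nat (B + int (Suc j))" using assms by simp
  then show ?thesis using front_color_phase[OF phase, of "Suc j"] assms
    by (auto simp: nat_mod_as_int[symmetric])
qed

lemma column_letter_colA:
  assumes "1 \<le> j" "j \<le> Suc n" "0 \<le> B + int j"
  shows "column_letter TypeA n N m (colA B (Unb j)) = Unb j"
  using color[OF assms] assms by (simp add: column_letter_def colA_def)

lemma puts_block_colA:
  assumes "1 \<le> j" "j \<le> Suc n" "0 \<le> B + int j" "1 \<le> i" "i \<le> n"
  shows "puts_block TypeA n N i m (colA B (Unb j)) z \<longleftrightarrow>
    (\<exists>y. vec_f TypeA n i (Unb j) = Some y \<and> z = colA B y)"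
proof -
  have "Suc (nat (B + int j)) = nat (B + int (Suc j))" using assms by simp
  then show ?thesis using color_Suc[OF assms(1-3)] assms(4,5)
    by (auto simp: colA_def puts_block_from)
qed

lemma puts_block_into_colA:
  assumes "1 \<le> j" "j \<le> Suc n" "0 \<le> B + int j" "1 \<le> i" "i \<le> n"
    and "puts_block TypeA n N i m z (colA B (Unb j))"
  shows "vec_e TypeA n i (Unb j) = Some (Unb i) \<and> z = colA B (Unb i) \<and> 0 \<le> B + int i"
proof -
  obtain h where h: "nat (B + int j) = Suc h"
    using assms(6) puts_block_into(4) by (cases "nat (B + int j)") (auto simp: colA_def)
  then have "front_color TypeA n N m (Suc h) = j - 1" using color[OF assms(1-3)] by simp
  then have "j - 1 = i" "z = (h, h)" using assms(6) h by (auto simp: colA_def puts_block_into)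
  then show ?thesis using assms(1,4) h by (auto simp: colA_def)
qed

end

lemma pair_ok_ground: "pair_ok g (ground_column g) (ground_column g)"
  by (cases g) (auto simp: pair_ok_def ground_column_def full_column_def)

text \<open>Heights weakly decrease to the left, so two equal full columns force all columns between
  them to be equal. Comparing neighbours is therefore enough.\<close>

lemma proper_iff:
  "proper g n Y \<longleftrightarrow> Y 0 = ground_column g \<and> finite {m. Y m \<noteq> ground_column g} \<and>
    (\<forall>m\<ge>1. column_ok g n (Y m) \<and> pair_ok g (Y m) (Y (Suc m)))" (is "_ \<longleftrightarrow> ?R")
proof
  assume "proper g n Y"
  then show ?R
    unfolding proper_def young_wall_def pair_ok_def by (metis Suc_le_mono le_SucI n_not_Suc_n)
next
  assume R: ?R
  then have yw: "young_wall g n Y" by (auto simp: young_wall_def pair_ok_def)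
  have mono: "fst (Y m) \<le> fst (Y l) \<and> snd (Y m) \<le> snd (Y l)" if "1 \<le> l" "l \<le> m" for l m
    using that(2)
  proof (induction m rule: dec_induct)
    case (step m)
    then have "pair_ok g (Y m) (Y (Suc m))" using R that(1) by simp
    then show ?case using step by (auto simp: pair_ok_def)
  qed simp
  have "Y l \<noteq> Y m" if g: "g = TypeC" and lm: "1 \<le> l" "l < m" "full_column (Y l)" for l m
  proof
    assume e: "Y l = Y m"
    have "fst (Y (Suc l)) = fst (Y l)" "snd (Y (Suc l)) = snd (Y l)"
      using mono[of l "Suc l"] mono[of "Suc l" m] lm e by auto
    then have "Y l = Y (Suc l)" by (simp add: prod_eq_iff)
    then show False using R lm(1,3) g by (auto simp: pair_ok_def)
  qed
  then show "proper g n Y" using yw unfolding proper_def by (metis linorder_neqE_nat)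
qed

section \<open>Placing letters in the columns of a wall\<close>

locale wall_setting =
  fixes g :: cartan and n :: nat and "is" :: "nat list"
  assumes type: "g = TypeA \<and> n \<ge> 1 \<or> g = TypeC \<and> n \<ge> 3"
    and sorted_is: "sorted is" and is_subset: "set is \<subseteq> {1..n}"
begin

abbreviation N :: nat where "N \<equiv> sum_list is"

abbreviation block :: "nat \<Rightarrow> nat" where "block m \<equiv> block_of is m"

definition row :: "nat \<Rightarrow> nat" where "row m = m - block_start is (block m)"

text \<open>Normalised so that the letter \<open>is ! block m + 1 - row m\<close> of the highest
  weight tableau gets the height prescribed by \<open>hw_wall\<close>.\<close>

definition baseA :: "nat \<Rightarrow> int" where
  "baseA m = int (\<Sum>j\<in>{Suc (block m)..<length is}. n + 1 - is ! j) + int (row m) - int (is ! block m) - 1"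

text \<open>\<open>top_period\<close> starts at 1, whereas \<open>colC\<close> takes the number of
  periods to raise by; hence \<open>Suc\<close> in the difference.\<close>

definition col :: "nat \<Rightarrow> letter \<Rightarrow> column" where
  "col m x = (case g of TypeA \<Rightarrow> colA (baseA m) x
     | TypeC \<Rightarrow> colC n (even (m + N)) (length is - Suc (block m)) x)"

text \<open>
  In a strictly increasing column of length \<open>l\<close> the unbarred entry of row \<open>r\<close> is at least \<open>l + 1 - r\<close>.  This
  bound keeps heights nonnegative in type \<open>A\<^sub>n\<close>, and in type \<open>C\<^sub>n\<close> it restricts the letter \<open>1\<close> in the
  lowest period to column \<open>N\<close>, where the \<open>0\<close>-block is the ground-state block.
\<close>

definition good :: "nat \<Rightarrow> letter \<Rightarrow> bool" where
  "good m x \<longleftrightarrow> x \<in> alphabet g n \<and> (\<forall>j. x = Unb j \<longrightarrow> is ! block m + 1 \<le> j + row m)"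

lemma blockI: "k < length is \<Longrightarrow> 1 \<le> a \<Longrightarrow> a \<le> is ! k \<Longrightarrow>
    block (block_start is k + a) = k \<and> row (block_start is k + a) = a"
  using block_of_eq by (simp add: row_def)

lemma block_bounds:
  assumes "1 \<le> m" "m \<le> N"
  shows "block m < length is" "1 \<le> row m" "row m \<le> is ! block m" "m = block_start is (block m) + row m"
  using block_cases[OF assms] blockI by metis+

lemma is_bounds: "k < length is \<Longrightarrow> 1 \<le> is ! k \<and> is ! k \<le> n"
  using is_subset nth_mem by fastforce

lemma Suc_cases:
  assumes "1 \<le> m" "m \<le> N"
  obtains (same) "m < N" "block (Suc m) = block m" "row (Suc m) = Suc (row m)" "row m < is ! block m"
  | (next_block) "m < N" "block (Suc m) = Suc (block m)" "row (Suc m) = 1" "row m = is ! block m"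
      "Suc (block m) < length is"
  | (last) "m = N" "block m = length is - 1" "row m = is ! block m"
proof -
  note b = block_bounds[OF assms]
  show ?thesis
  proof (cases "row m < is ! block m")
    case True
    have s: "Suc m = block_start is (block m) + Suc (row m)" using b by simp
    have "Suc m \<le> block_start is (Suc (block m))" using s True b by (simp add: block_start_Suc)
    also have "\<dots> \<le> N" using b(1) by (intro block_start_le) simp
    finally have "m < N" by simp
    then show ?thesis using same blockI[OF b(1), of "Suc (row m)"] True s by simp
  next
    case False
    then have r: "row m = is ! block m" using b by simp
    then have m: "m = block_start is (Suc (block m))" using b by (simp add: block_start_Suc)
    show ?thesis
    proof (cases "Suc (block m) < length is")
      case True
      have i: "1 \<le> is ! Suc (block m)" using is_bounds[OF True] by simp
      have s: "Suc m = block_start is (Suc (block m)) + 1" using m by simp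
      have "Suc m \<le> block_start is (Suc (Suc (block m)))"
        using s True i by (simp add: block_start_Suc)
      also have "\<dots> \<le> N" using True by (intro block_start_le) simp
      finally have "m < N" by simp
      then show ?thesis using next_block blockI[OF True _ i] s r True by simp
    next
      case False
      then have "Suc (block m) = length is" using b(1) by simp
      then have "m = N" using m by (simp add: block_start_def)
      then show ?thesis using last r \<open>Suc (block m) = length is\<close> by simp
    qed
  qed
qed

lemma alphabetA: "g = TypeA \<Longrightarrow> x \<in> alphabet g n \<Longrightarrow> \<exists>j. x = Unb j \<and> 1 \<le> j \<and> j \<le> Suc n"
  by (auto simp: alphabet_def)

text \<open>At a block boundary the letter 1 on the right is as high as the letter
  \<open>n + 1\<close> on the left. This is why \<open>pair_ok_next\<close> imposes no relation
  between letters of different blocks.\<close>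

lemma baseA_next:
  assumes "row m = is ! block m" "block (Suc m) = Suc (block m)" "row (Suc m) = 1"
    "Suc (block m) < length is"
  shows "baseA m = baseA (Suc m) + int n"
proof -
  have "(\<Sum>j\<in>{Suc (block m)..<length is}. n + 1 - is ! j) =
      (n + 1 - is ! Suc (block m)) + (\<Sum>j\<in>{Suc (Suc (block m))..<length is}. n + 1 - is ! j)"
    using assms(4) by (simp add: sum.atLeast_Suc_lessThan)
  then show ?thesis using assms is_bounds[OF assms(4)] by (simp add: baseA_def)
qed

lemma baseA_same:
  "block (Suc m) = block m \<Longrightarrow> row (Suc m) = Suc (row m) \<Longrightarrow> baseA (Suc m) = baseA m + 1"
  by (simp add: baseA_def)

lemma baseA_last: "block m = length is - 1 \<Longrightarrow> row m = is ! block m \<Longrightarrow> baseA m = - 1"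
  by (simp add: baseA_def)

text \<open>The summands \<open>n + 1 - is ! j\<close> of the later blocks add up to a multiple of
  \<open>n + 1\<close> minus the number of columns in these blocks, and the row accounts for the
  rest of the present block.\<close>

lemma phase_baseA:
  assumes "1 \<le> m" "m \<le> N"
  shows "phaseA n N m (baseA m)"
proof
  note b = block_bounds[OF assms]
  let ?k = "block m"
  have "N = block_start is (Suc ?k) + (\<Sum>j\<in>{Suc ?k..<length is}. is ! j)"
  proof -
    have "N = sum_list (take (Suc ?k) is) + sum_list (drop (Suc ?k) is)"
      by (metis append_take_drop_id sum_list_append)
    moreover have "sum_list (drop (Suc ?k) is) = (\<Sum>j\<in>{Suc ?k..<length is}. is ! j)"
      by (simp add: sum_list_sum_nth sum.atLeastLessThan_shift_0[of _ "Suc ?k"] add.commute)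
    ultimately show ?thesis by (simp add: block_start_def)
  qed
  moreover have "int (\<Sum>j\<in>{Suc ?k..<length is}. n + 1 - is ! j) =
      int (length is - Suc ?k) * int (n + 1) - int (\<Sum>j\<in>{Suc ?k..<length is}. is ! j)"
  proof -
    have "int (\<Sum>j\<in>{Suc ?k..<length is}. n + 1 - is ! j) = (\<Sum>j\<in>{Suc ?k..<length is}. int (n + 1) - int (is ! j))"
      using is_bounds by (simp add: of_nat_diff le_SucI)
    then show ?thesis by (simp add: sum_subtractf)
  qed
  ultimately have "int N - int m + baseA m + 1 = int (length is - Suc ?k) * int (n + 1)"
    using b block_start_Suc[OF b(1)] by (simp add: baseA_def algebra_simps)
  then have "(int N - int m + baseA m + 1) mod int (n + 1) = 0" by simp
  moreover have "(int (N mod (n + 1)) - int m + baseA m + 1) mod int (n + 1) = (int N - int m + baseA m + 1) mod int (n + 1)"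
    by (simp only: of_nat_mod add_diff_eq[symmetric] add.assoc diff_conv_add_uminus mod_add_left_eq)
  ultimately show "(int (N mod (n + 1)) - int m + baseA m + 1) mod int (n + 1) = 0" by simp
qed

lemma good_baseA: "good m (Unb j) \<Longrightarrow> 0 \<le> baseA m + int j"
  by (simp add: good_def baseA_def del: of_nat_sum)

lemma good_TypeC:
  assumes "g = TypeC" "1 \<le> m" "m \<le> N" "good m x"
  shows "length is - Suc (block m) = 0 \<and> x = Unb 1 \<longrightarrow> even (m + N)"
proof (intro impI)
  assume *: "length is - Suc (block m) = 0 \<and> x = Unb 1"
  then have "row m = is ! block m" using assms(4) block_bounds[OF assms(2,3)] by (auto simp: good_def)
  from assms(2,3) show "even (m + N)"
    by (cases rule: Suc_cases) (use * \<open>row m = is ! block m\<close> in auto)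
qed

lemma col_TypeA: "g = TypeA \<Longrightarrow> col m = colA (baseA m)"
  by (rule ext) (unfold col_def, simp)

lemma col_TypeC: "g = TypeC \<Longrightarrow> col m = colC n (even (m + N)) (length is - Suc (block m))"
  by (rule ext) (unfold col_def, simp)

text \<open>The additional clause in type A records that the height of \<open>col m y\<close> is not
  truncated, even though \<open>y\<close> need not be \<open>good\<close>.\<close>

lemma col_props:
  assumes m: "1 \<le> m" "m \<le> N" and x: "good m x"
  shows column_letter_col: "column_letter g n N m (col m x) = x"
    and column_ok_col: "column_ok g n (col m x)"
    and puts_block_col: "1 \<le> i \<Longrightarrow> i \<le> n \<Longrightarrow> puts_block g n N i m (col m x) z \<longleftrightarrow>
      (\<exists>y. vec_f g n i x = Some y \<and> z = col m y)"
    and puts_block_into_col: "1 \<le> i \<Longrightarrow> i \<le> n \<Longrightarrow> puts_block g n N i m z (col m x) \<Longrightarrow>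
      \<exists>y. vec_e g n i x = Some y \<and> z = col m y \<and> (g = TypeA \<longrightarrow> 0 \<le> baseA m + int (letter_rank 0 y))"
proof -
  have al: "x \<in> alphabet g n" using x by (simp add: good_def)
  have "column_letter g n N m (col m x) = x \<and> column_ok g n (col m x) \<and>
    (1 \<le> i \<longrightarrow> i \<le> n \<longrightarrow> (puts_block g n N i m (col m x) z \<longleftrightarrow> (\<exists>y. vec_f g n i x = Some y \<and> z = col m y)) \<and>
    (puts_block g n N i m z (col m x) \<longrightarrow>
      (\<exists>y. vec_e g n i x = Some y \<and> z = col m y \<and> (g = TypeA \<longrightarrow> 0 \<le> baseA m + int (letter_rank 0 y)))))" for i z
  proof (cases g)
    case TypeA
    then obtain j where j: "x = Unb j" "1 \<le> j" "j \<le> Suc n" using alphabetA al by blast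
    interpret phaseA n N m "baseA m" by (rule phase_baseA[OF m])
    have B: "0 \<le> baseA m + int j" using good_baseA x j by blast
    show ?thesis
      unfolding col_TypeA[OF TypeA] j(1) unfolding TypeA
    proof (intro conjI impI)
      show "column_letter TypeA n N m (colA (baseA m) (Unb j)) = Unb j"
        by (rule column_letter_colA[OF j(2,3) B])
      show "column_ok TypeA n (colA (baseA m) (Unb j))"
        by (simp add: column_ok_def colA_def ground_column_def)
    next
      assume i: "1 \<le> i" "i \<le> n"
      show "puts_block TypeA n N i m (colA (baseA m) (Unb j)) z \<longleftrightarrow>
          (\<exists>y. vec_f TypeA n i (Unb j) = Some y \<and> z = colA (baseA m) y)"
        by (rule puts_block_colA[OF j(2,3) B i])
      assume "puts_block TypeA n N i m z (colA (baseA m) (Unb j))"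
      from puts_block_into_colA[OF j(2,3) B i this]
      show "\<exists>y. vec_e TypeA n i (Unb j) = Some y \<and> z = colA (baseA m) y \<and>
          (TypeA = TypeA \<longrightarrow> 0 \<le> baseA m + int (letter_rank 0 y))"
        by (intro exI[of _ "Unb i"]) simp
    qed
  next
    case TypeC
    then have n: "3 \<le> n" using type by simp
    show ?thesis
      using column_letter_colC[OF n al[unfolded TypeC]] column_ok_colC[OF n al[unfolded TypeC] good_TypeC[OF TypeC m x]]
        puts_block_colC[OF n al[unfolded TypeC]] puts_block_into_colC[OF n al[unfolded TypeC]]
      unfolding col_TypeC[OF TypeC] unfolding TypeC by blast
  qed
  then show "column_letter g n N m (col m x) = x" "column_ok g n (col m x)"
    "1 \<le> i \<Longrightarrow> i \<le> n \<Longrightarrow> puts_block g n N i m (col m x) z \<longleftrightarrow>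
      (\<exists>y. vec_f g n i x = Some y \<and> z = col m y)"
    "1 \<le> i \<Longrightarrow> i \<le> n \<Longrightarrow> puts_block g n N i m z (col m x) \<Longrightarrow>
      \<exists>y. vec_e g n i x = Some y \<and> z = col m y \<and> (g = TypeA \<longrightarrow> 0 \<le> baseA m + int (letter_rank 0 y))"
    by blast+
qed

lemma pair_ok_same:
  assumes m: "1 \<le> m" "m < N" "block (Suc m) = block m" and x: "good m x" "good (Suc m) y" "y \<prec> x"
  shows "pair_ok g (col m x) (col (Suc m) y)"
proof -
  have al: "x \<in> alphabet g n" "y \<in> alphabet g n" using x by (simp_all add: good_def)
  have r: "row (Suc m) = Suc (row m)" by (rule Suc_cases[of m]) (use m in auto)
  show ?thesis
  proof (cases g)
    case TypeA
    then obtain j j' where j: "x = Unb j" "y = Unb j'" using alphabetA al by metis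
    then show ?thesis
      using x(3) baseA_same[OF m(3) r] unfolding col_TypeA[OF TypeA] by (auto simp: TypeA pair_ok_def colA_def)
  next
    case TypeC
    then show ?thesis
      using pair_ok_colC_less[of n x y "even (m + N)"] al x(3) type m(3) unfolding col_TypeC[OF TypeC] by (simp add: TypeC)
  qed
qed

text \<open>In type A the base grows by one to the left inside a block, so equal letters would make
  the left column higher. The bound on the height prevents both columns from being truncated to
  0.\<close>

lemma pair_not_ok_same:
  assumes m: "1 \<le> m" "m < N" "block (Suc m) = block m" and x: "x \<in> alphabet g n"
    and v: "g = TypeA \<Longrightarrow> 0 \<le> baseA m + int (letter_rank 0 x)"
  shows "\<not> pair_ok g (col m x) (col (Suc m) x)"
proof -
  have r: "row (Suc m) = Suc (row m)" by (rule Suc_cases[of m]) (use m in auto)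
  show ?thesis
  proof (cases g)
    case TypeA
    then show ?thesis
      using v baseA_same[OF m(3) r] unfolding col_TypeA[OF TypeA] by (auto simp: TypeA pair_ok_def colA_def)
  next
    case TypeC
    then show ?thesis
      using pair_ok_colC_iff[of n x x "even (m + N)"] x type m(3) unfolding col_TypeC[OF TypeC] by (simp add: TypeC)
  qed
qed

lemma pair_ok_next:
  assumes m: "1 \<le> m" "m < N" "block (Suc m) \<noteq> block m" and x: "x \<in> alphabet g n" "y \<in> alphabet g n"
  shows "pair_ok g (col m x) (col (Suc m) y)"
proof -
  have b: "block (Suc m) = Suc (block m)" "row (Suc m) = 1" "row m = is ! block m" "Suc (block m) < length is"
    by (rule Suc_cases[of m]; use m in simp)+
  show ?thesis
  proof (cases g)
    case TypeA
    then obtain j j' where "x = Unb j" "y = Unb j'" "1 \<le> j" "j' \<le> Suc n" using alphabetA x by metis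
    then show ?thesis
      using baseA_next[OF b(3,1,2,4)] unfolding col_TypeA[OF TypeA] by (auto simp: TypeA pair_ok_def colA_def)
  next
    case TypeC
    have "length is - Suc (block m) = Suc (length is - Suc (Suc (block m)))" using b(4) by simp
    then show ?thesis
      using pair_ok_colC_Suc[of n x y "even (m + N)"] x type TypeC b(1) unfolding col_TypeC[OF TypeC] by (simp add: TypeC)
  qed
qed

lemma pair_ok_last:
  assumes "1 \<le> N" "x \<in> alphabet g n"
  shows "pair_ok g (col N x) (ground_column g)"
proof (cases g)
  case TypeA
  then show ?thesis unfolding col_TypeA[OF TypeA] by (simp add: TypeA colA_def pair_ok_def ground_column_def)
next
  case TypeC
  have "block N = length is - 1" by (rule Suc_cases[of N]) (use assms(1) in auto)
  then show ?thesis using pair_ok_colC_ground[of n x] assms(2) type TypeC unfolding col_TypeC[OF TypeC] by (simp add: TypeC)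
qed

end

section \<open>Kashiwara operators on walls\<close>

lemma cancel_append: "cancel (s @ t) = foldr push_sign s (cancel t)"
  by (simp add: cancel_def)

definition descending :: "(nat \<Rightarrow> sign list) \<Rightarrow> nat \<Rightarrow> (nat \<times> sign) list" where
  "descending \<sigma> N = concat (map (\<lambda>m. map (Pair m) (\<sigma> m)) (rev [1..<Suc N]))"

lemma descending_simps:
  "descending \<sigma> 0 = []" "descending \<sigma> (Suc N) = map (Pair (Suc N)) (\<sigma> (Suc N)) @ descending \<sigma> N"
  by (simp_all add: descending_def)

text \<open>Columns are listed with decreasing numbers, so the plus of column \<open>Suc m\<close>
  directly precedes the minus of column \<open>m\<close>. Two such pairs never overlap because the
  required signs differ, and \<open>\<not> S N\<close> keeps every pair inside the list.\<close>

lemma cancel_descending: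
  assumes S: "\<And>m. S m \<Longrightarrow> \<sigma> m = [Minus] \<and> \<sigma> (Suc m) = [Plus]" and 0: "\<not> S 0"
  shows "\<not> S N \<Longrightarrow> cancel (descending \<sigma> N) =
    cancel (descending (\<lambda>m. if S m \<or> S (m - 1) then [] else \<sigma> m) N)"
proof (induction N rule: less_induct)
  case (less N)
  define \<tau> where "\<tau> = (\<lambda>m. if S m \<or> S (m - 1) then [] else \<sigma> m)"
  show ?case
  proof (cases N)
    case (Suc M)
    show ?thesis
    proof (cases "S M")
      case True
      then obtain K where K: "M = Suc K" using 0 by (cases M) auto
      have "\<not> S K" using S[of K] S[OF True] K by auto
      then have IH: "cancel (descending \<sigma> K) = cancel (descending \<tau> K)"
        using less.IH[of K] Suc K by (simp add: \<tau>_def)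
      have "descending \<sigma> N = (N, Plus) # (M, Minus) # descending \<sigma> K"
        using S[OF True] Suc K by (simp add: descending_simps)
      moreover have "descending \<tau> N = descending \<tau> K"
        using True Suc K by (simp add: descending_simps \<tau>_def)
      ultimately show ?thesis using IH by (simp add: cancel_Cons \<tau>_def)
    next
      case False
      then have IH: "cancel (descending \<sigma> M) = cancel (descending \<tau> M)"
        using less.IH[of M] Suc by (simp add: \<tau>_def)
      have "\<tau> N = \<sigma> N" using False less.prems Suc by (simp add: \<tau>_def)
      then show ?thesis using IH Suc by (simp add: descending_simps cancel_append \<tau>_def)
    qed
  qed (simp add: descending_simps)
qed

lemma cancel_map: "cancel (map (apfst h) s) = map (apfst h) (cancel s)"
proof (induction s)
  case (Cons x s)
  have "push_sign (apfst h x) (map (apfst h) t) = map (apfst h) (push_sign x t)" for t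
    by (cases x; cases "snd x"; cases t; cases "snd (hd t)") (auto simp: apfst_def)
  then show ?case using Cons by (simp add: cancel_Cons)
qed (simp add: cancel_def)

lemma places_map: "places c (map (apfst h) s) = map h (places c s)"
  by (simp add: places_def cancel_map filter_map comp_def)

lemma leftmost_plus_map: "leftmost_plus (map (apfst h) s) = map_option h (leftmost_plus s)"
  by (simp add: leftmost_plus_def places_map hd_map)

lemma rightmost_minus_map: "rightmost_minus (map (apfst h) s) = map_option h (rightmost_minus s)"
  by (simp add: rightmost_minus_def places_map last_map)

text \<open>The word read from left to right begins with the highest column number: column
  \<open>m\<close> is found at position \<open>length v - m\<close>.\<close>

lemma word_signature_rev:
  "word_signature g n i (rev v) =
    map (apfst (\<lambda>m. length v - m)) (descending (\<lambda>m. vec_signs g n i (v ! (m - 1))) (length v))"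
proof -
  have "[0..<length v] = map (\<lambda>m. length v - m) (rev [1..<Suc (length v)])"
    by (rule nth_equalityI) (simp_all add: rev_nth del: upt_Suc)
  then have "word_signature g n i (rev v) = concat (map (\<lambda>m. map (Pair (length v - m)) (vec_signs g n i (rev v ! (length v - m)))) (rev [1..<Suc (length v)]))"
    by (simp only: word_signature_def length_rev map_map comp_def)
  also have "\<dots> = concat (map (\<lambda>m. map (Pair (length v - m)) (vec_signs g n i (v ! (m - 1)))) (rev [1..<Suc (length v)]))"
    by (intro arg_cong[of _ _ concat] map_cong refl) (auto simp: rev_nth simp del: upt_Suc)
  also have "\<dots> = map (apfst (\<lambda>m. length v - m)) (descending (\<lambda>m. vec_signs g n i (v ! (m - 1))) (length v))"
    by (simp add: descending_def map_concat comp_def del: upt_Suc)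
  finally show ?thesis .
qed

lemma vec_e_Some_vec_f: "vec_e g n i x = Some y \<Longrightarrow> vec_e g n i y = None \<and> vec_f g n i x = None"
  by (cases x) (auto split: if_splits)

lemma vec_f_Some_vec_e: "vec_f g n i x = Some y \<Longrightarrow> vec_f g n i y = None \<and> vec_e g n i x = None"
  by (cases x) (auto split: if_splits)

lemma column_ok_ground: "column_ok g n (ground_column g)"
  by (cases g) (auto simp: column_ok_def ground_column_def split_layer_def)

text \<open>The ground-state pattern is aligned with \<open>N\<close>: the first free place of
  column \<open>N + 1\<close> has color 0, which is why the classical operators never leave the
  first \<open>N\<close> columns.\<close>

lemma puts_block_ground:
  assumes "puts_block g n N i m (ground_column g) x"
  shows "x = (1, 1) \<and> (m = Suc N \<longrightarrow> i = 0)"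
proof (cases g)
  case TypeA
  have "(int (N mod (n + 1)) - int (Suc N) + int 1) mod int (n + 1) = 0"
  proof -
    have "int (N mod (n + 1)) - int (Suc N) + int 1 = int N mod int (n + 1) - int N"
      by (simp add: of_nat_mod)
    then show ?thesis by (simp add: mod_diff_left_eq)
  qed
  then have "front_color TypeA n N (Suc N) 1 = 0" by (simp add: front_color_def)
  then show ?thesis using assms unfolding TypeA
    by (auto simp: ground_column_def puts_block_from)
next
  case TypeC
  have "back_color TypeC n N (Suc N) 1 = 0"
    unfolding front_color_def back_color_def by simp presburger
  then show ?thesis using assms unfolding TypeC
    by (auto simp: ground_column_def puts_block_from)
qed

context wall_setting
begin

lemma good_rank: "good m x \<Longrightarrow> g = TypeA \<Longrightarrow> 0 \<le> baseA m + int (letter_rank 0 x)"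
  using alphabetA[of x] good_baseA[of m] by (metis good_def letter_rank.simps(1))

section \<open>Fillings and their walls\<close>

definition same :: "nat \<Rightarrow> bool" where
  "same m \<longleftrightarrow> 1 \<le> m \<and> m < N \<and> block (Suc m) = block m"

text \<open>Entry \<open>m - 1\<close> of the list is the letter of wall column \<open>m\<close>;
  passing from \<open>m\<close> to \<open>m + 1\<close> inside a block means one row up in the
  tableau.\<close>

definition fill :: "letter list \<Rightarrow> bool" where
  "fill v \<longleftrightarrow> length v = N \<and> set v \<subseteq> alphabet g n \<and> (\<forall>m. same m \<longrightarrow> v ! m \<prec> v ! (m - 1))"

definition wall_of :: "letter list \<Rightarrow> wall" where
  "wall_of v m = (if 1 \<le> m \<and> m \<le> N then col m (v ! (m - 1)) else ground_column g)"

lemma fill_alphabet: "fill v \<Longrightarrow> 1 \<le> m \<Longrightarrow> m \<le> N \<Longrightarrow> v ! (m - 1) \<in> alphabet g n"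
  by (auto simp: fill_def)

text \<open>Induction from the top row of each tableau column downwards, that is, from larger to
  smaller column numbers.\<close>

lemma fill_good:
  assumes v: "fill v" and m: "1 \<le> m" "m \<le> N"
  shows "good m (v ! (m - 1))"
  using m
proof (induction "N - m" arbitrary: m rule: less_induct)
  case (less m)
  have al: "v ! (m - 1) \<in> alphabet g n" using fill_alphabet[OF v less.prems] .
  have "is ! block m + 1 \<le> j + row m" if j: "v ! (m - 1) = Unb j" for j
    using less.prems
  proof (cases rule: Suc_cases)
    case same
    then have "v ! m \<prec> Unb j" using v less.prems j by (auto simp: fill_def same_def)
    then obtain j' where j': "v ! m = Unb j'" "j' < j" by (cases "v ! m") auto
    have "good (Suc m) (v ! (Suc m - 1))" using less.hyps[of "Suc m"] same by simp
    then show ?thesis using j' same by (auto simp: good_def)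
  qed (use al j in \<open>cases g; auto simp: alphabet_def\<close>)+
  then show ?case using al by (simp add: good_def)
qed

lemma same_cases:
  assumes "1 \<le> m" "m \<le> N"
  obtains "same m" | "m < N" "block (Suc m) \<noteq> block m" | "m = N"
  using assms that unfolding same_def by (metis le_neq_implies_less)

lemma proper_wall_of:
  assumes v: "fill v"
  shows "proper g n (wall_of v)"
  unfolding proper_iff
proof (intro conjI allI impI)
  show "wall_of v 0 = ground_column g" by (simp add: wall_of_def)
  have "{m. wall_of v m \<noteq> ground_column g} \<subseteq> {..N}" by (auto simp: wall_of_def)
  then show "finite {m. wall_of v m \<noteq> ground_column g}" using finite_subset by blast
  fix m :: nat assume m: "1 \<le> m"
  show "column_ok g n (wall_of v m)"
  proof (cases "m \<le> N")
    case True
    then show ?thesis using column_ok_col[OF m True fill_good[OF v m True]] m by (simp add: wall_of_def)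
  next
    case False
    then show ?thesis by (simp add: wall_of_def column_ok_ground)
  qed
  show "pair_ok g (wall_of v m) (wall_of v (Suc m))"
  proof (cases "m \<le> N")
    case True
    from m True show ?thesis
    proof (cases rule: same_cases)
      case 1
      then show ?thesis
        using pair_ok_same[of m "v ! (m - 1)" "v ! m"] fill_good[OF v m True] fill_good[OF v, of "Suc m"] v
        by (simp add: wall_of_def same_def fill_def)
    next
      case 2
      then show ?thesis
        using pair_ok_next[of m "v ! (m - 1)" "v ! m"] m fill_alphabet[OF v m True] fill_alphabet[OF v, of "Suc m"]
        by (simp add: wall_of_def)
    next
      case 3
      then show ?thesis using pair_ok_last[of "v ! (N - 1)"] fill_alphabet[OF v m True] m by (simp add: wall_of_def)
    qed
  next
    case False
    then show ?thesis by (simp add: wall_of_def pair_ok_ground)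
  qed
qed

lemma wall_of_update:
  assumes "length v = N" "1 \<le> m" "m \<le> N"
  shows "(wall_of v)(m := col m y) = wall_of (v[m - 1 := y])"
proof
  fix l
  show "((wall_of v)(m := col m y)) l = wall_of (v[m - 1 := y]) l"
  proof (cases "l = m")
    case False
    then have "1 \<le> l \<Longrightarrow> l - 1 \<noteq> m - 1" using assms(2) by linarith
    then show ?thesis using False by (auto simp: wall_of_def)
  qed (use assms in \<open>simp add: wall_of_def\<close>)
qed

lemma fill_update:
  assumes v: "fill v" and m: "1 \<le> m" "m \<le> N" and y: "y \<in> alphabet g n"
    and 1: "same m \<Longrightarrow> v ! m \<prec> y" and 2: "2 \<le> m \<Longrightarrow> same (m - 1) \<Longrightarrow> y \<prec> v ! (m - 2)"
  shows "fill (v[m - 1 := y])"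
  unfolding fill_def
proof (intro conjI allI impI)
  show "length (v[m - 1 := y]) = N" using v by (simp add: fill_def)
  show "set (v[m - 1 := y]) \<subseteq> alphabet g n"
    using v y set_update_subset_insert[of v "m - 1" y] by (auto simp: fill_def)
  fix l assume l: "same l"
  have vl: "v ! l \<prec> v ! (l - 1)" using v l by (simp add: fill_def)
  have len: "length v = N" using v by (simp add: fill_def)
  consider "l = m" | "l = m - 1" "l \<noteq> m" | "l \<noteq> m" "l \<noteq> m - 1" by blast
  then show "v[m - 1 := y] ! l \<prec> v[m - 1 := y] ! (l - 1)"
  proof cases
    case 1
    then show ?thesis using 1 assms(5) l m len by (simp add: nth_list_update)
  next
    case 2
    then have "2 \<le> m" "l - 1 = m - 2" using l by (auto simp: same_def)
    then show ?thesis using 2 assms(6) l m len by (simp add: nth_list_update)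
  next
    case 3
    then have "l - 1 \<noteq> m - 1" using l m by (auto simp: same_def)
    then show ?thesis using 3 vl by simp
  qed
qed

lemma fill_sameD: "fill v \<Longrightarrow> same m \<Longrightarrow> v ! m \<prec> v ! (m - 1)"
  by (simp add: fill_def)

lemma proper_wallD:
  "proper g n Y \<Longrightarrow> 1 \<le> m \<Longrightarrow> pair_ok g (Y m) (Y (Suc m))"
  by (simp add: proper_iff)

context
  fixes v i m
  assumes v: "fill v" and m: "1 \<le> m" "m \<le> N" and i: "1 \<le> i" "i \<le> n"
begin

text \<open>The alphabet has no letter between \<open>y\<close> and the old letter, so strictness
  can only fail by an equal letter in the row above.\<close>

lemma fill_e:
  assumes e: "vec_e g n i (v ! (m - 1)) = Some y" and ne: "\<not> (same m \<and> v ! m = y)"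
  shows "fill (v[m - 1 := y])"
proof (rule fill_update[OF v m])
  have f: "vec_f g n i y = Some (v ! (m - 1))" using e by (simp add: vec_e_iff_vec_f)
  show "y \<in> alphabet g n" using vec_f_alphabet[OF f i] by simp
  show "v ! m \<prec> y" if s: "same m"
  proof (rule ccontr)
    assume "\<not> v ! m \<prec> y"
    moreover have "v ! m \<in> alphabet g n" using fill_alphabet[OF v, of "Suc m"] s by (simp add: same_def)
    ultimately show False
      using vec_f_between'[OF f, of "v ! m"] fill_sameD[OF v s] ne s by (simp add: letter_le_iff_not_less)
  qed
  show "y \<prec> v ! (m - 2)" if "2 \<le> m" "same (m - 1)"
    using fill_sameD[OF v that(2)] vec_f_less[OF f] letter_less_trans that(1)
    by (metis diff_diff_left one_add_one)
qed

lemma wall_of_m: "wall_of v m = col m (v ! (m - 1))"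
  using m by (simp add: wall_of_def)

lemma puts_into_unique:
  assumes "vec_e g n i (v ! (m - 1)) = Some y" "puts_block g n N i m z (wall_of v m)"
  shows "z = col m y"
  using puts_block_into_col[OF m fill_good[OF v m] i assms(2)[unfolded wall_of_m]] assms(1) by auto

lemma remove_block_wall_of:
  assumes e: "vec_e g n i (v ! (m - 1)) = Some y" and ne: "\<not> (same m \<and> v ! m = y)"
  shows "removable g n N i m (wall_of v)" "remove_block g n N i m (wall_of v) = wall_of (v[m - 1 := y])"
proof -
  have f: "vec_f g n i y = Some (v ! (m - 1))" using e by (simp add: vec_e_iff_vec_f)
  have w: "fill (v[m - 1 := y])" using fill_e[OF e ne] .
  have "good m y" using fill_good[OF w m] m w by (simp add: fill_def)
  then have p: "puts_block g n N i m (col m y) (wall_of v m)"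
    using puts_block_col[OF m _ i] f m by (simp add: wall_of_def)
  have "(THE x. puts_block g n N i m x (wall_of v m)) = col m y"
    using p puts_into_unique[OF e] by (rule the_equality)
  then show r: "remove_block g n N i m (wall_of v) = wall_of (v[m - 1 := y])"
    using wall_of_update m v by (simp add: remove_block_def fill_def)
  show "removable g n N i m (wall_of v)"
    unfolding removable_def r using p proper_wall_of[OF w] by blast
qed

text \<open>If the row above already contains \<open>y\<close>, removing the block contradicts
  properness by \<open>pair_not_ok_same\<close>. In that case \<open>y\<close> is not known to be
  \<open>good\<close>, so the height bound has to come from
  \<open>puts_block_into_col\<close>.\<close>

lemma removable_wall_of_iff:
  "removable g n N i m (wall_of v) \<longleftrightarrow> (\<exists>y. vec_e g n i (v ! (m - 1)) = Some y \<and> \<not> (same m \<and> v ! m = y))"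
proof
  assume r: "removable g n N i m (wall_of v)"
  then obtain z where z: "puts_block g n N i m z (col m (v ! (m - 1)))"
    using m by (auto simp: removable_def wall_of_def)
  obtain y where y: "vec_e g n i (v ! (m - 1)) = Some y" "z = col m y"
      "g = TypeA \<longrightarrow> 0 \<le> baseA m + int (letter_rank 0 y)"
    using puts_block_into_col[OF m fill_good[OF v m] i z] by blast
  have "puts_block g n N i m (col m y) (wall_of v m)" using z y wall_of_m by simp
  then have "(THE x. puts_block g n N i m x (wall_of v m)) = col m y"
    using puts_into_unique[OF y(1)] by (rule the_equality)
  then have "proper g n ((wall_of v)(m := col m y))"
    using r by (simp add: removable_def remove_block_def)
  from proper_wallD[OF this m(1)] have "pair_ok g (col m y) (wall_of v (Suc m))" by simp
  moreover have "\<not> pair_ok g (col m y) (wall_of v (Suc m))" if s: "same m" "v ! m = y"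
  proof -
    have "y \<in> alphabet g n" using vec_f_alphabet[of g n i y] i y(1) by (simp add: vec_e_iff_vec_f)
    then show ?thesis using pair_not_ok_same[of m y] s y(3) by (simp add: same_def wall_of_def)
  qed
  ultimately show "\<exists>y. vec_e g n i (v ! (m - 1)) = Some y \<and> \<not> (same m \<and> v ! m = y)" using y by blast
qed (use remove_block_wall_of in blast)

lemma fill_f:
  assumes f: "vec_f g n i (v ! (m - 1)) = Some y" and ne: "\<not> (same (m - 1) \<and> v ! (m - 2) = y)"
  shows "fill (v[m - 1 := y])"
proof (rule fill_update[OF v m])
  show "y \<in> alphabet g n" using vec_f_alphabet[OF f i] by simp
  show "v ! m \<prec> y" if s: "same m"
    using fill_sameD[OF v s] vec_f_less[OF f] letter_less_trans by blast
  show "y \<prec> v ! (m - 2)" if s: "2 \<le> m" "same (m - 1)"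
  proof (rule ccontr)
    assume "\<not> y \<prec> v ! (m - 2)"
    moreover have "v ! (m - 2) \<in> alphabet g n"
      using fill_alphabet[OF v, of "m - 1"] s m by (simp add: same_def numeral_2_eq_2)
    moreover have "v ! (m - 1) \<prec> v ! (m - 2)"
      using fill_sameD[OF v s(2)] s(1) by (simp add: numeral_2_eq_2)
    ultimately show False
      using vec_f_between[OF f, of "v ! (m - 2)"] ne s by (simp add: letter_le_iff_not_less)
  qed
qed

lemma add_block_wall_of:
  assumes f: "vec_f g n i (v ! (m - 1)) = Some y" and ne: "\<not> (same (m - 1) \<and> v ! (m - 2) = y)"
  shows "admissible g n N i m (wall_of v)" "add_block g n N i m (wall_of v) = wall_of (v[m - 1 := y])"
proof -
  have w: "fill (v[m - 1 := y])" using fill_f[OF f ne] .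
  have p: "puts_block g n N i m (wall_of v m) z \<longleftrightarrow> z = col m y" for z
    using puts_block_col[OF m fill_good[OF v m] i] f m by (simp add: wall_of_def)
  show r: "add_block g n N i m (wall_of v) = wall_of (v[m - 1 := y])"
    using wall_of_update m v by (simp add: add_block_def fill_def p)
  show "admissible g n N i m (wall_of v)"
    unfolding admissible_def r using p proper_wall_of[OF w] by blast
qed

lemma admissible_wall_of_iff:
  "admissible g n N i m (wall_of v) \<longleftrightarrow>
    (\<exists>y. vec_f g n i (v ! (m - 1)) = Some y \<and> \<not> (same (m - 1) \<and> v ! (m - 2) = y))"
proof
  assume a: "admissible g n N i m (wall_of v)"
  then obtain y where y: "vec_f g n i (v ! (m - 1)) = Some y"
    using m puts_block_col[OF m fill_good[OF v m] i] by (auto simp: admissible_def wall_of_def)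
  have "(THE x. puts_block g n N i m (wall_of v m) x) = col m y"
    using puts_block_col[OF m fill_good[OF v m] i] y m by (simp add: wall_of_def)
  then have pr: "proper g n ((wall_of v)(m := col m y))"
    using a by (simp add: admissible_def add_block_def)
  have "\<not> (same (m - 1) \<and> v ! (m - 2) = y)"
  proof
    assume s: "same (m - 1) \<and> v ! (m - 2) = y"
    then have m2: "2 \<le> m" "Suc (m - 1) = m" by (auto simp: same_def)
    have m1: "1 \<le> m - 1" "m - 1 \<noteq> m" "m - 1 \<le> N" "m - 1 - 1 = m - 2" using m m2 by linarith+
    then have "wall_of v (m - 1) = col (m - 1) y"
      using s unfolding wall_of_def by simp
    moreover note m1
    ultimately have "pair_ok g (col (m - 1) y) (col (Suc (m - 1)) y)"
      using proper_wallD[OF pr, of "m - 1"] m2(2) by simp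
    moreover have gd: "good (m - 1) y" using fill_good[OF v m1(1,3)] s m1(4) by simp
    moreover have "y \<in> alphabet g n" using gd by (simp add: good_def)
    ultimately show False
      using pair_not_ok_same[of "m - 1" y] s good_rank[OF gd] unfolding same_def by blast
  qed
  then show "\<exists>y. vec_f g n i (v ! (m - 1)) = Some y \<and> \<not> (same (m - 1) \<and> v ! (m - 2) = y)" using y by blast
qed (use add_block_wall_of in blast)

end

section \<open>The signature of a wall\<close>

lemma not_removable_ground:
  assumes "N < m" "fill v"
  shows "\<not> removable g n N i m (wall_of v)"
proof
  assume r: "removable g n N i m (wall_of v)"
  have Y: "wall_of v m = ground_column g" using assms by (simp add: wall_of_def)
  show False
  proof (cases g)
    case TypeA
    then show ?thesis using r unfolding removable_def Y ground_column_def by (simp add: puts_block_into)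
  next
    case TypeC
    then have "(THE x. puts_block g n N i m x (wall_of v m)) = (0, 0)" if "puts_block g n N i m x (wall_of v m)" for x
      using that unfolding Y ground_column_def by (auto simp: puts_block_into)
    then have "proper g n ((wall_of v)(m := (0, 0)))"
      using r by (auto simp: removable_def remove_block_def)
    moreover have "1 \<le> m" using assms(1) by simp
    ultimately have "column_ok g n (((wall_of v)(m := (0, 0))) m)" unfolding proper_iff by blast
    then have "column_ok g n (0, 0)" by simp
    then show ?thesis by (simp add: column_ok_def TypeC ground_column_def)
  qed
qed

text \<open>In column \<open>N + 1\<close> the only place has color 0. Further to the left, a block
  would rise above the ground column on its right.\<close>

lemma not_admissible_ground:
  assumes "N < m" "fill v" "1 \<le> i" "i \<le> n"
  shows "\<not> admissible g n N i m (wall_of v)"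
proof
  assume a: "admissible g n N i m (wall_of v)"
  have Y: "wall_of v m = ground_column g" using assms by (simp add: wall_of_def)
  obtain x where x: "puts_block g n N i m (wall_of v m) x" using a by (auto simp: admissible_def)
  have x1: "x = (1, 1)" "m = Suc N \<Longrightarrow> i = 0"
    if "puts_block g n N i m (wall_of v m) x" for x
    using puts_block_ground[OF that[unfolded Y]] by simp_all
  have "m \<noteq> Suc N" using x1(2)[OF x] assms by auto
  then have m: "N < m - 1" "1 \<le> m - 1" "Suc (m - 1) = m" "m - 1 \<noteq> m" using assms(1) by auto
  have "(THE x. puts_block g n N i m (wall_of v m) x) = (1, 1)"
    using x x1(1) by (metis the_equality)
  then have "proper g n ((wall_of v)(m := (1, 1)))" using a by (simp add: admissible_def add_block_def)
  from proper_wallD[OF this m(2)] m have "pair_ok g (ground_column g) (1, 1)" by (simp add: wall_of_def)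
  then show False by (cases g) (auto simp: pair_ok_def ground_column_def)
qed

text \<open>
  Column \<open>m\<close> would lose a block and column \<open>m + 1\<close> would gain one, but either change gives two equal
  letters in one block of columns, which no proper wall has.
\<close>

definition cancelled :: "letter list \<Rightarrow> nat \<Rightarrow> nat \<Rightarrow> bool" where
  "cancelled v i m \<longleftrightarrow> same m \<and> vec_e g n i (v ! (m - 1)) = Some (v ! m)"

text \<open>All strings of the vector crystal have length at most one, so after one block no second
  block of the same color can follow, and the signs \<open>--\<close>, \<open>-+\<close> and
  \<open>++\<close> never occur.\<close>

lemma column_signs_wall_of:
  assumes v: "fill v" and m: "1 \<le> m" "m \<le> N" and i: "1 \<le> i" "i \<le> n"
  shows "column_signs g n N i (wall_of v) m =
    (if cancelled v i m \<or> cancelled v i (m - 1) then [] else vec_signs g n i (v ! (m - 1)))"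
proof -
  let ?x = "v ! (m - 1)"
  have len: "length v = N" using v by (simp add: fill_def)
  have nth: "v[m - 1 := y] ! (m - 1) = y" for y using len m by simp
  note r = removable_wall_of_iff[OF v m i] and a = admissible_wall_of_iff[OF v m i]
  have c1: "cancelled v i (m - 1) \<longleftrightarrow> same (m - 1) \<and> vec_f g n i ?x = Some (v ! (m - 2))"
    by (simp add: cancelled_def vec_e_iff_vec_f numeral_2_eq_2)
  show ?thesis
  proof (cases rule: vec_signs_cases[of g n i ?x])
    case 1
    then show ?thesis using r a by (simp add: column_signs_def)
  next
    case 2
    then obtain y where y: "vec_e g n i ?x = Some y" by blast
    have na: "\<not> admissible g n N i m (wall_of v)" using a 2 by simp
    have nc: "\<not> cancelled v i (m - 1)" using 2 c1 by simp
    show ?thesis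
    proof (cases "same m \<and> v ! m = y")
      case True
      then show ?thesis using r y na by (auto simp: column_signs_def cancelled_def)
    next
      case False
      have "\<not> removable g n N i m (remove_block g n N i m (wall_of v))"
        using remove_block_wall_of(2)[OF v m i y False] removable_wall_of_iff[OF fill_e[OF v m i y False] m i]
          vec_e_Some_vec_f[OF y] nth by simp
      then show ?thesis using r y na nc 2 False by (auto simp: column_signs_def cancelled_def)
    qed
  next
    case 3
    then obtain y where y: "vec_f g n i ?x = Some y" by blast
    have nr: "\<not> removable g n N i m (wall_of v)" using r 3 by simp
    have nc: "\<not> cancelled v i m" using 3 by (simp add: cancelled_def)
    show ?thesis
    proof (cases "same (m - 1) \<and> v ! (m - 2) = y")
      case True
      then show ?thesis using a y nr c1 by (auto simp: column_signs_def)
    next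
      case False
      have "\<not> admissible g n N i m (add_block g n N i m (wall_of v))"
        using add_block_wall_of(2)[OF v m i y False] admissible_wall_of_iff[OF fill_f[OF v m i y False] m i]
          vec_f_Some_vec_e[OF y] nth by simp
      then show ?thesis using a y nr nc c1 3 False by (auto simp: column_signs_def)
    qed
  qed
qed

lemma column_signs_ground:
  assumes "fill v" "N < m" "1 \<le> i" "i \<le> n"
  shows "column_signs g n N i (wall_of v) m = []"
  using not_removable_ground[OF assms(2,1)] not_admissible_ground[OF assms(2,1,3,4)]
  by (simp add: column_signs_def)

lemma wall_signature_wall_of:
  assumes v: "fill v" and i: "1 \<le> i" "i \<le> n"
  shows "wall_signature g n N i (wall_of v) = descending (column_signs g n N i (wall_of v)) N"
proof -
  let ?s = "column_signs g n N i (wall_of v)"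
  have "m \<le> N" if "?s m \<noteq> []" for m
    using column_signs_ground[OF v _ i, of m] that by (meson not_le_imp_less)
  then have "{m. 1 \<le> m \<and> ?s m \<noteq> []} = set (filter (\<lambda>m. ?s m \<noteq> []) [1..<Suc N])"
    by (auto simp: less_Suc_eq_le simp del: upt_Suc)
  then have "sorted_list_of_set {m. 1 \<le> m \<and> ?s m \<noteq> []} = filter (\<lambda>m. ?s m \<noteq> []) [1..<Suc N]"
    by (simp only: sorted_list_of_set_sort_remdups)
      (simp add: sorted_sort_id distinct_remdups_id sorted_wrt_filter del: upt_Suc)
  moreover have "concat (map f (filter (\<lambda>m. ?s m \<noteq> []) xs)) = concat (map f xs)"
    if "\<And>m. ?s m = [] \<Longrightarrow> f m = []" for f :: "nat \<Rightarrow> (nat \<times> sign) list" and xs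
    using that by (induction xs) auto
  ultimately show ?thesis
    unfolding wall_signature_def descending_def by (simp add: rev_filter del: upt_Suc)
qed

lemma cancel_wall_signature:
  assumes v: "fill v" and i: "1 \<le> i" "i \<le> n"
  shows "cancel (wall_signature g n N i (wall_of v)) = cancel (descending (\<lambda>m. vec_signs g n i (v ! (m - 1))) N)"
proof -
  let ?\<sigma> = "\<lambda>m. vec_signs g n i (v ! (m - 1))"
  have "cancel (descending ?\<sigma> N) =
      cancel (descending (\<lambda>m. if cancelled v i m \<or> cancelled v i (m - 1) then [] else ?\<sigma> m) N)"
  proof (rule cancel_descending)
    show "?\<sigma> m = [Minus] \<and> ?\<sigma> (Suc m) = [Plus]" if "cancelled v i m" for m
    proof -
      have e: "vec_e g n i (v ! (m - 1)) = Some (v ! m)" using that by (simp add: cancelled_def)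
      then have "vec_f g n i (v ! m) = Some (v ! (m - 1))" by (simp add: vec_e_iff_vec_f)
      with e show ?thesis by (simp add: vec_signs_iff)
    qed
  qed (simp_all add: cancelled_def same_def)
  moreover have "descending (column_signs g n N i (wall_of v)) N =
      descending (\<lambda>m. if cancelled v i m \<or> cancelled v i (m - 1) then [] else ?\<sigma> m) N"
    unfolding descending_def
    by (intro arg_cong[of _ _ concat] map_cong refl) (auto simp: column_signs_wall_of[OF v _ _ i])
  ultimately show ?thesis using wall_signature_wall_of[OF v i] by simp
qed

lemma places_wall_signature:
  assumes v: "fill v" and i: "1 \<le> i" "i \<le> n"
  shows "places c (wall_signature g n N i (wall_of v)) = places c (descending (\<lambda>m. vec_signs g n i (v ! (m - 1))) N)"
  by (simp add: places_def cancel_wall_signature[OF assms])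

lemma length_places_wall_of:
  assumes "fill v" "1 \<le> i" "i \<le> n"
  shows "length (places c (wall_signature g n N i (wall_of v))) = length (places c (word_signature g n i (rev v)))"
  using assms by (simp add: places_wall_signature word_signature_rev places_map fill_def)

lemma wall_signature_mem:
  assumes "fill v" "1 \<le> i" "i \<le> n" "(m, c) \<in> set (wall_signature g n N i (wall_of v))"
  shows "1 \<le> m \<and> m \<le> N \<and> c \<in> set (column_signs g n N i (wall_of v) m)"
  using assms(4) by (auto simp: wall_signature_wall_of[OF assms(1-3)] descending_def simp del: upt_Suc)

lemma wall_f_wall_of:
  assumes v: "fill v" and i: "1 \<le> i" "i \<le> n"
  shows "wall_f g n N i (wall_of v) = map_option (\<lambda>w. wall_of (rev w)) (word_f g n i (rev v))"
proof -
  have len: "length v = N" using v by (simp add: fill_def)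
  let ?s = "wall_signature g n N i (wall_of v)"
  have lp: "leftmost_plus (word_signature g n i (rev v)) = map_option (\<lambda>m. N - m) (leftmost_plus ?s)"
    by (simp add: word_signature_rev leftmost_plus_map len) (simp add: leftmost_plus_def places_wall_signature[OF v i])
  show ?thesis
  proof (cases "leftmost_plus ?s")
    case None
    then show ?thesis using lp by (simp add: wall_f_def word_f_def)
  next
    case (Some m)
    then have "(m, Plus) \<in> set ?s" by (auto simp: leftmost_plus_iff)
    then have m: "1 \<le> m" "m \<le> N" and "Plus \<in> set (column_signs g n N i (wall_of v) m)"
      using wall_signature_mem[OF v i] by blast+
    then have "\<not> cancelled v i (m - 1)" and p: "Plus \<in> set (vec_signs g n i (v ! (m - 1)))"
      unfolding column_signs_wall_of[OF v m i] by (auto split: if_splits)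
    then obtain y where y: "vec_f g n i (v ! (m - 1)) = Some y"
      by (cases rule: vec_signs_cases[of g n i "v ! (m - 1)"]) auto
    \<comment> \<open>A plus present in the signature lies outside the pairs of
      \<open>cancelled\<close>, which is the side condition for adding the block.\<close>
    have ne: "\<not> (same (m - 1) \<and> v ! (m - 2) = y)"
      using \<open>\<not> cancelled v i (m - 1)\<close> y by (auto simp: cancelled_def vec_e_iff_vec_f numeral_2_eq_2)
    have "word_f g n i (rev v) = Some ((rev v)[N - m := y])"
      using lp Some y m len by (simp add: word_f_def rev_nth)
    moreover have "rev ((rev v)[N - m := y]) = v[m - 1 := y]"
      using m len by (simp add: rev_update)
    moreover have "wall_f g n N i (wall_of v) = Some (wall_of (v[m - 1 := y]))"
      using Some add_block_wall_of(2)[OF v m i y ne] by (simp add: wall_f_def)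
    ultimately show ?thesis by simp
  qed
qed

lemma wall_e_wall_of:
  assumes v: "fill v" and i: "1 \<le> i" "i \<le> n"
  shows "wall_e g n N i (wall_of v) = map_option (\<lambda>w. wall_of (rev w)) (word_e g n i (rev v))"
proof -
  have len: "length v = N" using v by (simp add: fill_def)
  let ?s = "wall_signature g n N i (wall_of v)"
  have rm: "rightmost_minus (word_signature g n i (rev v)) = map_option (\<lambda>m. N - m) (rightmost_minus ?s)"
    by (simp add: word_signature_rev rightmost_minus_map len) (simp add: rightmost_minus_def places_wall_signature[OF v i])
  show ?thesis
  proof (cases "rightmost_minus ?s")
    case None
    then show ?thesis using rm by (simp add: wall_e_def word_e_def)
  next
    case (Some m)
    then have "(m, Minus) \<in> set ?s" by (auto simp: rightmost_minus_iff)
    then have m: "1 \<le> m" "m \<le> N" and "Minus \<in> set (column_signs g n N i (wall_of v) m)"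
      using wall_signature_mem[OF v i] by blast+
    then have "\<not> cancelled v i m" and p: "Minus \<in> set (vec_signs g n i (v ! (m - 1)))"
      unfolding column_signs_wall_of[OF v m i] by (auto split: if_splits)
    then obtain y where y: "vec_e g n i (v ! (m - 1)) = Some y"
      by (cases rule: vec_signs_cases[of g n i "v ! (m - 1)"]) auto
    have ne: "\<not> (same m \<and> v ! m = y)" using \<open>\<not> cancelled v i m\<close> y by (auto simp: cancelled_def)
    have "word_e g n i (rev v) = Some ((rev v)[N - m := y])"
      using rm Some y m len by (simp add: word_e_def rev_nth)
    moreover have "rev ((rev v)[N - m := y]) = v[m - 1 := y]"
      using m len by (simp add: rev_update)
    moreover have "wall_e g n N i (wall_of v) = Some (wall_of (v[m - 1 := y]))"
      using Some remove_block_wall_of(2)[OF v m i y ne] by (simp add: wall_e_def)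
    ultimately show ?thesis by simp
  qed
qed

end

section \<open>Reducedness and the highest weight wall\<close>

lemma concat_nth:
  "map length T = is \<Longrightarrow> k < length T \<Longrightarrow> p < is ! k \<Longrightarrow> concat T ! (block_start is k + p) = T ! k ! p"
proof (induction T arbitrary: "is" k)
  case (Cons C T)
  show ?case
  proof (cases k)
    case 0
    then show ?thesis using Cons.prems by (auto simp: block_start_def nth_append)
  next
    case (Suc l)
    then show ?thesis using Cons.prems Cons.IH[of "map length T" l]
      by (auto simp: block_start_def nth_append)
  qed
qed simp

context wall_setting
begin

lemma concat_nth_block:
  assumes "map length T = is" "1 \<le> m" "m \<le> N"
  shows "concat T ! (m - 1) = T ! block m ! (row m - 1)"
proof -
  note b = block_bounds[OF assms(2,3)]
  have "m - 1 = block_start is (block m) + (row m - 1)" using b by simp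
  moreover have "block m < length T" "row m - 1 < is ! block m" using b assms(1) by auto
  ultimately show ?thesis using concat_nth[OF assms(1)] by simp
qed

lemma same_row:
  assumes "same m"
  shows "row (Suc m) = Suc (row m) \<and> row m < is ! block m"
  by (rule Suc_cases[of m]) (use assms in \<open>auto simp: same_def\<close>)

lemma fill_concat:
  assumes T: "T \<in> tableaux g n is"
  shows "fill (concat T)"
  unfolding fill_def
proof (intro conjI allI impI)
  have len: "map length T = is" and adm: "\<forall>C\<in>set T. col_adm g n C"
    using T unfolding tableaux_iff[OF sorted_is] by auto
  show "length (concat T) = N" using len by (simp add: length_concat)
  show "set (concat T) \<subseteq> alphabet g n" using adm by (auto simp: col_adm_def)
  fix m assume s: "same m"
  then have m: "1 \<le> m" "m \<le> N" "1 \<le> Suc m" "Suc m \<le> N" "block (Suc m) = block m" by (auto simp: same_def)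
  note b = block_bounds[OF m(1,2)] and r = same_row[OF s]
  have "block m < length T" using b(1) len by auto
  then have "decreasing (T ! block m)" "length (T ! block m) = is ! block m"
    using adm len by (auto simp: col_adm_def)
  then have "T ! block m ! row m \<prec> T ! block m ! (row m - 1)"
    using sorted_wrt_nth_less[of "\<lambda>x y. y \<prec> x" "T ! block m" "row m - 1" "row m"] b r by simp
  then show "concat T ! m \<prec> concat T ! (m - 1)"
    using concat_nth_block[OF len m(1,2)] concat_nth_block[OF len m(3,4)] m(5) r by simp
qed

text \<open>These two entries sit in neighbouring wall columns at a block boundary. Go right along
  the top row of the shorter column, then down in the longer one.\<close>

lemma tableau_top_le_next_bottom:
  assumes T: "T \<in> tableaux g n is" and k: "Suc k < length is"
  shows "T ! k ! (is ! k - 1) \<preceq> T ! Suc k ! 0"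
proof -
  have len: "map length T = is" and adm: "\<forall>C\<in>set T. col_adm g n C"
    using T unfolding tableaux_iff[OF sorted_is] by auto
  have lenk: "length (T ! k) = is ! k" "length (T ! Suc k) = is ! Suc k" "Suc k < length T"
    using len k by auto
  have i: "1 \<le> is ! k" "is ! k \<le> is ! Suc k"
    using is_bounds[of k] sorted_nth_mono[OF sorted_is, of k "Suc k"] k by auto
  have "rows_weak (T ! k) (T ! Suc k)"
    using T lenk(3) unfolding tableaux_def rows_weak_def by blast
  then have 1: "T ! k ! (is ! k - 1) \<preceq> T ! Suc k ! (is ! k - 1)"
    using rows_weak_iff[of "T ! k" "T ! Suc k"] lenk i by simp
  have "decreasing (T ! Suc k)" using adm lenk(3) by (auto simp: col_adm_def)
  then have "T ! Suc k ! (is ! k - 1) \<preceq> T ! Suc k ! 0"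
    using sorted_wrt_nth_less[of "\<lambda>x y. y \<prec> x" "T ! Suc k" 0 "is ! k - 1"] lenk i
    by (cases "is ! k - 1") (auto simp: letter_le_def)
  with 1 show ?thesis using letter_le_trans by blast
qed

lemma not_both_one:
  assumes "T \<in> tableaux g n is" "g = TypeC" "C \<in> set T"
  shows "\<not> (Unb 1 \<in> set C \<and> Bar 1 \<in> set C)"
proof
  assume *: "Unb 1 \<in> set C \<and> Bar 1 \<in> set C"
  have "1 \<le> n" using type by auto
  then have "0 \<le> slack (set C) 1" using tableaux_colD[OF sorted_is assms(1,3)] assms(2)
    unfolding col_adm_def by blast
  then show False using * by simp
qed

text \<open>A lowered column either sinks below the ground column or conflicts with its left
  neighbour. Inside a block the neighbour is then almost a whole period too high; at a block
  boundary the two columns reach the same level and weak increase along rows decides.\<close>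

lemma reduced_wall_of:
  assumes T: "T \<in> tableaux g n is"
  shows "reduced g n (wall_of (concat T))"
  unfolding reduced_def
proof (intro allI impI notI)
  fix m f b
  let ?v = "concat T"
  assume m1: "1 \<le> m" and Y: "wall_of ?v m = (f + period g n, b + period g n)"
    and pr: "proper g n ((wall_of ?v)(m := (f, b)))"
  have len: "map length T = is" using T unfolding tableaux_iff[OF sorted_is] by auto
  note v = fill_concat[OF T]
  have per: "1 \<le> period g n" using type by (auto simp: period_def)
  have mN: "m \<le> N"
  proof (rule ccontr)
    assume "\<not> m \<le> N"
    then have "ground_column g = (f + period g n, b + period g n)" using Y by (simp add: wall_of_def)
    then show False using per by (cases g) (auto simp: ground_column_def)
  qed
  let ?x = "?v ! (m - 1)"
  have Y: "col m ?x = (f + period g n, b + period g n)" using Y m1 mN by (simp add: wall_of_def)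
  have ok: "column_ok g n (f, b)" and pair: "pair_ok g (f, b) (wall_of ?v (Suc m))"
    using pr m1 unfolding proper_iff by (metis fun_upd_same) (use pr proper_wallD[OF pr m1] in simp)
  note gx = fill_good[OF v m1 mN]
  have alx: "?x \<in> alphabet g n" using gx by (simp add: good_def)
  have xb: "?x = T ! block m ! (row m - 1)" using concat_nth_block[OF len m1 mN] .
  have Sm: "wall_of ?v (Suc m) = col (Suc m) (?v ! m)" if "m < N" using that by (simp add: wall_of_def)
  have aly: "?v ! m \<in> alphabet g n" if "m < N" using fill_alphabet[OF v, of "Suc m"] that by simp
  have yb: "?v ! m = T ! block (Suc m) ! (row (Suc m) - 1)" if "m < N"
    using concat_nth_block[OF len, of "Suc m"] that by simp
  have next_le: "?x \<preceq> ?v ! m" if "m < N" "block (Suc m) = Suc (block m)" "row (Suc m) = 1"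
    "row m = is ! block m" "Suc (block m) < length is"
    using tableau_top_le_next_bottom[OF T that(5)] xb yb[OF that(1)] that by simp
  show False
  proof (cases g)
    case TypeA
    obtain j where j: "?x = Unb j" "1 \<le> j" "j \<le> Suc n" using alphabetA[OF TypeA alx] by blast
    have "0 \<le> baseA m + int j" using good_baseA gx j(1) by simp
    then have f: "int f = baseA m + int j - int n - 1"
      using Y unfolding col_TypeA[OF TypeA] j(1) by (auto simp: colA_def period_def TypeA)
    have y: "\<exists>j'. ?v ! m = Unb j' \<and> 1 \<le> j' \<and> j' \<le> Suc n \<and> baseA (Suc m) + int j' \<le> int f" if mlt: "m < N"
    proof -
      obtain j' where j': "?v ! m = Unb j'" "1 \<le> j'" "j' \<le> Suc n" using alphabetA[OF TypeA aly[OF mlt]] by blast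
      have "nat (baseA (Suc m) + int j') \<le> f"
        using pair unfolding Sm[OF mlt] col_TypeA[OF TypeA] by (simp add: pair_ok_def j' colA_def)
      then show ?thesis using j' by auto
    qed
    from m1 mN show False
    proof (cases rule: Suc_cases)
      case same
      then show ?thesis using y f j baseA_same[OF same(2,3)] by auto
    next
      case next_block
      then show ?thesis using y f j baseA_next[OF next_block(4,2,3,5)] next_le by auto
    next
      case last
      then show ?thesis using f j baseA_last by auto
    qed
  next
    case TypeC
    have n: "3 \<le> n" using type TypeC by simp
    define e where "e = even (m + N)"
    define p where "p = length is - Suc (block m)"
    have Yc: "colC n e p ?x = (f + period TypeC n, b + period TypeC n)"
      using Y unfolding col_TypeC[OF TypeC] e_def p_def unfolding TypeC .
    have okC: "column_ok TypeC n (f, b)" using ok unfolding TypeC .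
    then have f: "1 \<le> f" by (simp add: column_ok_def ground_column_def)
    have pairC: "pair_ok TypeC (f, b) (colC n (\<not> e) (length is - Suc (block (Suc m))) (?v ! m))" if "m < N"
      using pair unfolding Sm[OF that] col_TypeC[OF TypeC] e_def unfolding TypeC by simp
    have bl: "block m < length is" using block_bounds[OF m1 mN] by simp
    note low = colC_lowered[OF n alx[unfolded TypeC] Yc]
    from m1 mN show False
    proof (cases rule: Suc_cases)
      case same
      have pc: "pair_ok TypeC (f, b) (colC n (\<not> e) p (?v ! m))"
        using pairC[OF same(1)] unfolding same(2) p_def .
      \<comment> \<open>After lowering, the neighbour is one period ahead, which
        \<open>pair_ok_colC_lowered\<close> permits only for this pair of letters. The lowest period
        is treated separately, since the lowered column is no \<open>colC\<close> there.\<close>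
      have "?x = Bar 1 \<and> ?v ! m = Unb 1"
        using low
      proof (elim disjE exE conjE)
        fix p' assume "p = Suc p'" "(f, b) = colC n e p' ?x"
        then show ?thesis
          using pair_ok_colC_lowered[OF n alx[unfolded TypeC] aly[OF same(1), unfolded TypeC]] pc by simp
      next
        assume "(f, b) = (0, 0)" then show ?thesis using f by simp
      next
        assume *: "p = 0" "?x = Bar 1" "(f, b) = (if e then (0, 1) else (1, 0))"
        then have "\<not> e" "f = 1" "b = 0" using f by (auto split: if_splits)
        then have "?v ! m = Unb 1"
          using pc * by (rule_tac alphabetC_cases[OF aly[OF same(1), unfolded TypeC]])
            (use n in \<open>auto simp: colC_1 colC_Unb colC_Bar pair_ok_def\<close>)
        then show ?thesis using * by simp
      qed
      moreover have "?x \<in> set (T ! block m)" "?v ! m \<in> set (T ! block m)" "T ! block m \<in> set T"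
        using xb yb[OF same(1)] same len bl block_bounds[OF m1 mN] by auto
      ultimately show False using not_both_one[OF T TypeC] by metis
    next
      case next_block
      then have p: "p = Suc (length is - Suc (block (Suc m)))" using bl unfolding p_def by simp
      then have "(f, b) = colC n e (length is - Suc (block (Suc m))) ?x" using low by auto
      then show False
        using pair_ok_colC_iff[OF n alx[unfolded TypeC] aly[OF next_block(1), unfolded TypeC] next_le[OF next_block]]
          pairC[OF next_block(1)] by simp
    next
      case last
      then have "p = 0" "e" using bl unfolding p_def e_def by auto
      then show False using low f by auto
    qed
  qed
qed

lemma top_period_colC:
  assumes "1 \<le> j" "j \<le> n" "3 \<le> n"
  shows "top_period TypeC n (colC n e p (Unb j)) = Suc p"
proof (cases "j = 1")
  case True
  then show ?thesis using assms by (auto simp: colC_1 top_period_def period_def max_def)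
next
  case False
  then have j: "2 \<le> j" "j - 2 < 2 * n - 2" using assms by auto
  then have "(p * (2 * n - 2) + (j - 2)) div (2 * n - 2) = p"
    by (subst div_mult_self3) auto
  then show ?thesis unfolding colC_Unb[OF j(1)] top_period_def period_def by simp
qed

text \<open>In type A the heights agree by the choice of \<open>baseA\<close>. In type C the column
  satisfies the three properties in the definite description, and \<open>ex1_hw_column\<close> makes
  it the only one.\<close>

lemma hw_wall_eq: "hw_wall g n is = wall_of (concat (map hw_column is))"
proof
  fix m
  let ?T = "map hw_column is"
  have T: "?T \<in> tableaux g n is" by (rule hw_tableau_mem[OF sorted_is is_subset])
  show "hw_wall g n is m = wall_of (concat ?T) m"
  proof (cases "1 \<le> m \<and> m \<le> N")
    case False
    then show ?thesis by (auto simp: hw_wall_def wall_of_def)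
  next
    case True
    then have m: "1 \<le> m" "m \<le> N" by auto
    note b = block_bounds[OF m]
    define j where "j = is ! block m + 1 - row m"
    have j: "1 \<le> j" "j \<le> n" "row m + j = is ! block m + 1"
      using b is_bounds[OF b(1)] by (auto simp: j_def)
    have x: "concat ?T ! (m - 1) = Unb j"
      using concat_nth_block[of ?T, OF _ m] b nth_hw_column[of "row m - 1" "is ! block m"]
      by (simp add: j_def comp_def)
    have w: "wall_of (concat ?T) m = col m (Unb j)" using x m by (simp add: wall_of_def)
    have good: "good m (Unb j)" using fill_good[OF fill_concat[OF T] m] x by simp
    have r: "m - block_start is (block m) = row m" by (simp add: row_def)
    show ?thesis
    proof (cases g)
      case TypeA
      have "nat (baseA m + int j) = (\<Sum>j\<in>{Suc (block m)..<length is}. n + 1 - is ! j)"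
        using j unfolding baseA_def by linarith
      then show ?thesis unfolding w col_TypeA[OF TypeA] using m
        by (simp add: hw_wall_def TypeA colA_def Let_def)
    next
      case TypeC
      have n: "3 \<le> n" using type TypeC by simp
      let ?p = "length is - block m"
      let ?P = "\<lambda>x. column_ok TypeC n x \<and> column_letter TypeC n N m x = Unb j \<and> top_period TypeC n x = ?p"
      have par: "?p = 1 \<and> j = 1 \<longrightarrow> even (m + N)" using good_TypeC[OF TypeC m good] by auto
      have "\<exists>!x. ?P x"
        using ex1_hw_column[of n j ?p m N] n j(1,2) b(1) par by simp
      moreover have "?P (col m (Unb j))"
        using column_ok_col[OF m good] column_letter_col[OF m good] top_period_colC[OF j(1,2) n] b(1)
        unfolding col_TypeC[OF TypeC] unfolding TypeC by simp
      ultimately have "(THE x. ?P x) = col m (Unb j)" by (rule the1_equality)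
      then show ?thesis unfolding w using m
        by (simp add: hw_wall_def Let_def r j_def TypeC)
    qed
  qed
qed

end

section \<open>Weights and the isomorphism\<close>

text \<open>The height hypothesis ensures that an added front block lies above the ground-state
  column and is therefore counted.\<close>

lemma column_blocks_puts:
  assumes "puts_block g n N i m c d" "fst (ground_column g) \<le> fst c"
  shows "column_blocks g n N i' m d = column_blocks g n N i' m c + of_bool (i' = i)"
proof -
  have ext: "card {h. P h \<and> h \<le> Suc f \<and> Q h} = card {h. P h \<and> h \<le> f \<and> Q h} + of_bool (P (Suc f) \<and> Q (Suc f))"
    for P Q :: "nat \<Rightarrow> bool" and f
  proof -
    have "{h. P h \<and> h \<le> Suc f \<and> Q h} = {h. P h \<and> h \<le> f \<and> Q h} \<union> (if P (Suc f) \<and> Q (Suc f) then {Suc f} else {})"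
      by (auto simp: le_Suc_eq)
    moreover have "finite {h. P h \<and> h \<le> f \<and> Q h}" by simp
    ultimately show ?thesis by (simp add: card_insert_if)
  qed
  show ?thesis
    using assms by (cases rule: puts_block.cases) (auto simp: column_blocks_def ext)
qed

lemma column_blocks_ground: "column_blocks g n N i m (ground_column g) = 0"
proof -
  have "{h. split_layer g n h \<and> h \<le> 0 \<and> Q h} = {}" for Q by (auto simp: split_layer_def)
  then show ?thesis by (cases g) (auto simp: column_blocks_def ground_column_def)
qed

section \<open>Weights of letters and of columns\<close>

lemma vec_wt_eq:
  "j \<in> {1..n} \<Longrightarrow> vec_wt n (Unb k) j = of_bool (k = j) - of_bool (k = Suc j)"
  "j \<in> {1..n} \<Longrightarrow> vec_wt n (Bar k) j = of_bool (k = Suc j) - of_bool (k = j)"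
  by (simp_all add: eps_weight_def)

lemma vec_wt_vec_f_TypeC:
  assumes "3 \<le> n" "vec_f TypeC n i x = Some y" "1 \<le> i" "i \<le> n" "j \<in> {1..n}"
  shows "vec_wt n y j = vec_wt n x j - affine_cartan TypeC n j i"
  using assms(2)
  by (rule vec_f_cases)
    (use assms in \<open>auto simp: vec_wt_eq affine_cartan_def doubleton_eq_iff simp del: vec_wt.simps\<close>)

text \<open>The ground column is listed separately because with front color 1 it would be the letter
  \<open>Bar 1\<close> of a period below the lowest one.\<close>

lemma column_ok_TypeC_cases:
  assumes n: "3 \<le> n" and ok: "column_ok TypeC n c"
  obtains "c = ground_column TypeC" | p x where "x \<in> alphabet TypeC n" "c = colC n e p x"
proof -
  obtain f b where c: "c = (f, b)" by force
  let ?P = "2 * n - 2"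
  obtain h where h: "max f b = Suc h" using ok c by (cases "max f b") (auto simp: column_ok_def ground_column_def)
  define p r where "p = h div ?P" "r = h mod ?P"
  then have hr: "h = p * ?P + r" "r < ?P"
    using n div_mult_mod_eq[of h ?P] mod_less_divisor[of ?P h] by simp_all
  from ok c consider "f = b" | "f = Suc b" "split_layer TypeC n f" | "b = Suc f" "split_layer TypeC n b" "1 \<le> f"
    by (auto simp: column_ok_def ground_column_def)
  then show ?thesis
  proof cases
    case 1
    then have "c = (Suc h, Suc h)" using c h by simp
    moreover have "(Suc h, Suc h) = colC n e p (if r < n - 1 then Unb (r + 2) else Bar (2 * n - 1 - r))"
      using hr by (auto simp: colC_Unb colC_Bar)
    moreover have "(if r < n - 1 then Unb (r + 2) else Bar (2 * n - 1 - r)) \<in> alphabet TypeC n"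
      using hr n by (auto simp: alphabet_def image_iff)
    ultimately show ?thesis using that(2) by metis
  next
    case 2
    then have fb: "f = Suc h" "b = h" using h by auto
    then have r: "r = 0" using 2 layerC(1)[OF hr(2), of p] hr by simp
    show ?thesis
    proof (cases e)
      case True
      then have "c = colC n e p (Unb 1)" using c fb hr r by (simp add: colC_1)
      then show ?thesis using that(2)[of "Unb 1" p] n by (auto simp: alphabet_def)
    next
      case False
      show ?thesis
      proof (cases p)
        case 0
        then show ?thesis using that(1) c fb hr r by (simp add: ground_column_def)
      next
        case (Suc p')
        then have "c = colC n e p' (Bar 1)" using c fb hr r False by (simp add: colC_1 add.commute)
        then show ?thesis using that(2)[of "Bar 1" p'] n by (auto simp: alphabet_def)
      qed
    qed
  next
    case 3
    then have fb: "b = Suc h" "f = h" using h by auto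
    then have r: "r = 0" using 3 layerC(1)[OF hr(2), of p] hr by simp
    show ?thesis
    proof (cases e)
      case False
      then have "c = colC n e p (Unb 1)" using c fb hr r by (simp add: colC_1)
      then show ?thesis using that(2)[of "Unb 1" p] n by (auto simp: alphabet_def)
    next
      case True
      obtain p' where "p = Suc p'" using 3(3) fb hr r by (cases p) auto
      then have "c = colC n e p' (Bar 1)" using c fb hr r True by (simp add: colC_1 add.commute)
      then show ?thesis using that(2)[of "Bar 1" p'] n by (auto simp: alphabet_def)
    qed
  qed
qed

lemma column_predecessor_TypeC:
  assumes n: "3 \<le> n" and ok: "column_ok TypeC n c" and ne: "c \<noteq> ground_column TypeC" and j: "j \<in> {1..n}"
  shows "\<exists>d i. i \<le> n \<and> column_ok TypeC n d \<and> puts_block TypeC n N i m d c \<and>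
    vec_wt n (column_letter TypeC n N m c) j =
    vec_wt n (column_letter TypeC n N m d) j - affine_cartan TypeC n j i"
proof -
  let ?e = "even (m + N)"
  obtain p x where x: "x \<in> alphabet TypeC n" "c = colC n ?e p x"
    using column_ok_TypeC_cases[OF n ok, where e = ?e] ne by metis
  have al: "Unb 1 \<in> alphabet TypeC n" "Bar 1 \<in> alphabet TypeC n" "Bar 2 \<in> alphabet TypeC n" "Unb 2 \<in> alphabet TypeC n"
    using n by (auto simp: alphabet_def)
  show ?thesis
  proof (cases "x = Unb 1")
    case True
    \<comment> \<open>In the lowest period the letter 1 is either the ground column or a column
      lacking its ground-state block. Above it, the letter 1 arises from \<open>Bar 2\<close> of the
      previous period by a 0-block.\<close>
    have "p \<noteq> 0"
    proof
      assume "p = 0"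
      then show False using True x ne ok by (cases ?e) (auto simp: colC_1 ground_column_def column_ok_def)
    qed
    then obtain p' where p: "p = Suc p'" by (cases p) auto
    define q where "q = p' * (2 * n - 2) + (2 * n - 2)"
    have d: "colC n ?e p' (Bar 2) = (q, q)" using n by (auto simp: colC_Bar q_def)
    have c: "c = (if ?e then (Suc q, q) else (q, Suc q))" using True x p by (simp add: colC_1 q_def add.commute)
    have L: "split_layer TypeC n (Suc q)" "front_color TypeC n N m (Suc q) = (if ?e then 0 else 1)"
      using layerC_top[where p = p' and n = n] parity_colors[of m N] by (simp_all add: q_def)
    have "puts_block TypeC n N 0 m (q, q) c" using L c by (auto simp: puts_block_from back_color_def)
    moreover have "column_ok TypeC n (q, q)" using column_ok_colC[OF n al(3), of p' ?e] d by simp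
    moreover have "vec_wt n (Unb 1) j = vec_wt n (Bar 2) j - affine_cartan TypeC n j 0"
      using j n by (auto simp: vec_wt_eq affine_cartan_def doubleton_eq_iff simp del: vec_wt.simps)
    ultimately show ?thesis
      using column_letter_colC[OF n al(3), of N m p'] column_letter_colC[OF n x(1), of N m p] d x True
      by (intro exI[of _ "(q, q)"] exI[of _ 0]) simp
  next
    case False
    obtain i y where iy: "vec_f TypeC n i y = Some x" "1 \<le> i" "i \<le> n"
    proof (rule alphabetC_cases[OF x(1)])
      fix k assume "x = Unb k" "2 \<le> k" "k \<le> n"
      then show ?thesis using that[of "k - 1" "Unb (k - 1)"] by auto
    next
      fix k assume "x = Bar k" "2 \<le> k" "k \<le> n"
      then show ?thesis using that[of k "if k = n then Unb n else Bar (Suc k)"] by auto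
    next
      assume "x = Bar (Suc 0)"
      then show ?thesis using that[of 1 "Bar 2"] n by auto
    qed (use False in simp)
    have y: "y \<in> alphabet TypeC n" using vec_f_alphabet[OF iy] by simp
    show ?thesis
    proof (cases "p = 0 \<and> y = Unb 1 \<longrightarrow> ?e")
      case True
      have "puts_block TypeC n N i m (colC n ?e p y) c"
        using puts_block_colC[OF n y iy(2,3)] iy x(2) by blast
      moreover have "column_ok TypeC n (colC n ?e p y)" by (rule column_ok_colC[OF n y True])
      ultimately show ?thesis
        using column_letter_colC[OF n y, of N m p] column_letter_colC[OF n x(1), of N m p] x(2)
          vec_wt_vec_f_TypeC[OF n iy j] iy(3) by (intro exI[of _ "colC n ?e p y"] exI[of _ i]) simp
    next
      case F: False
      \<comment> \<open>Over a ground-state block of color 1 the column \<open>(1, 1)\<close> can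
        only lose its 0-block; the 1-block is the ground-state block. What remains has letter
        \<open>Bar 1\<close>.\<close>
      then have "x = Unb 2" using iy(1) n by (auto split: if_splits)
      then have c: "c = (1, 1)" using x(2) F by (simp add: colC_Unb)
      have L: "split_layer TypeC n (Suc 0)" "front_color TypeC n N m (Suc 0) = 1"
        using layerC0[where p = 0 and n = n] parity_colors[of m N] F by simp_all
      have "puts_block TypeC n N 0 m (1, 0) c" using L c puts_block_from(2)[of TypeC n N 0 m 0] by (simp add: back_color_def)
      moreover have "column_letter TypeC n N m (1, 0) = Bar 1" using L by (simp add: column_letter_def)
      moreover have "column_ok TypeC n (1, 0)" using L by (simp add: column_ok_def ground_column_def)
      moreover have "vec_wt n (Unb 2) j = vec_wt n (Bar 1) j - affine_cartan TypeC n j 0"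
        using j n by (auto simp: vec_wt_eq affine_cartan_def doubleton_eq_iff simp del: vec_wt.simps)
      ultimately show ?thesis
        using column_letter_colC[OF n x(1), of N m p] x(2) \<open>x = Unb 2\<close>
        by (intro exI[of _ "(1, 0)"] exI[of _ 0]) simp
    qed
  qed
qed

lemma front_color_Suc_TypeA:
  "front_color TypeA n N m (Suc h) = Suc (front_color TypeA n N m h) mod Suc n"
  "front_color TypeA n N m h \<le> n"
proof -
  define z where "z = int (N mod (n + 1)) - int m + int h"
  have f: "front_color TypeA n N m h = nat (z mod int (Suc n))"
    "front_color TypeA n N m (Suc h) = nat ((z + 1) mod int (Suc n))"
    by (simp_all add: front_color_def z_def algebra_simps)
  have "(z + 1) mod int (Suc n) = (z mod int (Suc n) + 1) mod int (Suc n)" by (simp add: mod_add_left_eq)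
  also have "\<dots> = int (Suc (nat (z mod int (Suc n))) mod Suc n)"
    by (simp add: of_nat_mod add.commute)
  finally show "front_color TypeA n N m (Suc h) = Suc (front_color TypeA n N m h) mod Suc n"
    unfolding f by simp
  have "z mod int (Suc n) < int (Suc n)" by (rule pos_mod_bound) simp
  then show "front_color TypeA n N m h \<le> n" unfolding f by linarith
qed

lemma column_predecessor_TypeA:
  assumes n: "1 \<le> n" and ok: "column_ok TypeA n c" and ne: "c \<noteq> ground_column TypeA" and j: "j \<in> {1..n}"
  shows "\<exists>d i. i \<le> n \<and> column_ok TypeA n d \<and> puts_block TypeA n N i m d c \<and>
    vec_wt n (column_letter TypeA n N m c) j =
    vec_wt n (column_letter TypeA n N m d) j - affine_cartan TypeA n j i"
proof -
  obtain h where c: "c = (Suc h, Suc h)"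
    using ok ne by (cases c; cases "fst c") (auto simp: column_ok_def ground_column_def)
  define a where "a = front_color TypeA n N m h"
  have a: "a \<le> n" "front_color TypeA n N m (Suc h) = Suc a mod Suc n"
    using front_color_Suc_TypeA[of n N m h] by (simp_all add: a_def)
  have w: "vec_wt n (Unb (Suc (Suc a mod Suc n))) j = vec_wt n (Unb (Suc a)) j - affine_cartan TypeA n j (Suc a mod Suc n)"
  proof (cases "a = n")
    case True
    then show ?thesis using j n
      by (cases "j = n") (auto simp: vec_wt_eq affine_cartan_def simp del: vec_wt.simps)
  next
    case False
    then have "Suc a < Suc n" using a by simp
    then show ?thesis using j n False
      by (cases "j = n"; cases "Suc a = n") (auto simp: vec_wt_eq affine_cartan_def simp del: vec_wt.simps)
  qed
  have "puts_block TypeA n N (Suc a mod Suc n) m (h, h) c" using a c by (simp add: puts_block_from)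
  moreover have "column_ok TypeA n (h, h)" by (simp add: column_ok_def ground_column_def)
  moreover have "Suc a mod Suc n \<le> n" using mod_less_divisor[of "Suc n" "Suc a"] by simp
  ultimately show ?thesis using w a c
    by (intro exI[of _ "(h, h)"] exI[of _ "Suc a mod Suc n"]) (simp add: column_letter_def a_def[symmetric])
qed

text \<open>
  The blocks of colors \<open>0, \<dots>, n\<close> permute the letters of the vector crystal cyclically (level zero),
  so the weight of a column can be read off its letter.
\<close>

lemma column_weight:
  assumes "g = TypeA \<and> n \<ge> 1 \<or> g = TypeC \<and> n \<ge> 3" "column_ok g n c" "j \<in> {1..n}"
  shows "(\<Sum>i\<in>{0..n}. int (column_blocks g n N i m c) * affine_cartan g n j i) =
    vec_wt n (column_letter g n N m (ground_column g)) j - vec_wt n (column_letter g n N m c) j"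
  using assms(2)
proof (induction "fst c + snd c" arbitrary: c rule: less_induct)
  case less
  show ?case
  proof (cases "c = ground_column g")
    case True
    then show ?thesis by (simp add: column_blocks_ground)
  next
    case False
    obtain d i where d: "i \<le> n" "column_ok g n d" "puts_block g n N i m d c"
      "vec_wt n (column_letter g n N m c) j = vec_wt n (column_letter g n N m d) j - affine_cartan g n j i"
      using assms(1) column_predecessor_TypeA[of n c j N m] column_predecessor_TypeC[of n c j N m]
        less.prems False assms(3) by (cases g) auto
    have "fst d + snd d < fst c + snd c" using d(3) by (cases rule: puts_block.cases) auto
    from less.hyps[OF this d(2)] have IH:
      "(\<Sum>i\<in>{0..n}. int (column_blocks g n N i m d) * affine_cartan g n j i) =
       vec_wt n (column_letter g n N m (ground_column g)) j - vec_wt n (column_letter g n N m d) j" .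
    have "fst (ground_column g) \<le> fst d" using d(2) by (auto simp: column_ok_def)
    then have "(\<Sum>k\<in>{0..n}. int (column_blocks g n N k m c) * affine_cartan g n j k) =
        (\<Sum>k\<in>{0..n}. int (column_blocks g n N k m d) * affine_cartan g n j k + (if k = i then affine_cartan g n j k else 0))"
      using column_blocks_puts[OF d(3)] by (intro sum.cong refl) (auto simp: algebra_simps)
    also have "\<dots> = (\<Sum>k\<in>{0..n}. int (column_blocks g n N k m d) * affine_cartan g n j k) + affine_cartan g n j i"
      using d(1) by (simp add: sum.distrib)
    finally show ?thesis using IH d(4) by simp
  qed
qed

text \<open>The letters of the ground columns run cyclically through the alphabet in type A and
  alternate between \<open>1\<close> and \<open>Bar 1\<close> in type C, so the sum telescopes to
  the weight of the ground-state wall. In \<open>wall_wt_wall_of\<close> this cancels the ground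
  contributions and leaves the letters of the filling.\<close>

lemma ground_weight:
  assumes "g = TypeA \<and> n \<ge> 1 \<or> g = TypeC \<and> n \<ge> 3" "j \<in> {1..n}"
  shows "(\<Sum>m\<in>{1..N}. vec_wt n (column_letter g n N m (ground_column g)) j) = of_bool (j = ground_index g n N)"
proof (cases g)
  case TypeA
  have "vec_wt n (column_letter g n N m (ground_column g)) j =
      of_bool (Suc ((N - m) mod Suc n) = j) - of_bool ((N - m) mod Suc n = j)" if "m \<le> N" for m
  proof -
    have "(int (N mod (n + 1)) - int m) mod int (n + 1) = int ((N - m) mod Suc n)"
      using that by (simp add: of_nat_mod of_nat_diff mod_diff_left_eq)
    then show ?thesis using assms(2) TypeA
      by (simp add: column_letter_def ground_column_def front_color_def vec_wt_eq del: vec_wt.simps)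
  qed
  then have "(\<Sum>m\<in>{1..N}. vec_wt n (column_letter g n N m (ground_column g)) j) =
      (\<Sum>m\<in>{1..N}. of_bool (Suc ((N - m) mod Suc n) = j) - of_bool ((N - m) mod Suc n = j))"
    by (intro sum.cong) auto
  also have "\<dots> = (\<Sum>q<N. of_bool (Suc (q mod Suc n) = j) - of_bool (q mod Suc n = j))"
    by (rule sum.reindex_bij_witness[of _ "\<lambda>q. N - q" "\<lambda>m. N - m"]) auto
  also have "\<dots> = of_bool (j = N mod Suc n)"
  proof (induction N)
    case 0
    then show ?case using assms(2) by simp
  next
    case (Suc N)
    have "Suc (N mod Suc n) = j \<longleftrightarrow> j = Suc N mod Suc n"
      using assms(2) by (auto simp: mod_Suc)
    then show ?case using Suc by simp
  qed
  finally show ?thesis by (simp add: TypeA ground_index_def)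
next
  case TypeC
  have "vec_wt n (column_letter g n N m (ground_column g)) j =
      (if even (N - m) then of_bool (j = 1) else - of_bool (j = 1))" if "m \<le> N" for m
  proof -
    have "even (m + N) \<longleftrightarrow> even (N - m)" using that by auto
    then show ?thesis using assms(2) TypeC
      by (auto simp: column_letter_def ground_column_def front_color_def vec_wt_eq mod2_eq_if simp del: vec_wt.simps)
  qed
  then have "(\<Sum>m\<in>{1..N}. vec_wt n (column_letter g n N m (ground_column g)) j) =
      (\<Sum>m\<in>{1..N}. (if even (N - m) then of_bool (j = 1) else - of_bool (j = 1)))"
    by (intro sum.cong) auto
  also have "\<dots> = (\<Sum>q<N. (if even q then of_bool (j = 1) else - of_bool (j = 1)))"
    by (rule sum.reindex_bij_witness[of _ "\<lambda>q. N - q" "\<lambda>m. N - m"]) auto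
  also have "\<dots> = of_bool (j = N mod 2)"
    using assms(2) by (induction N) (auto simp: mod2_eq_if)
  finally show ?thesis by (simp add: TypeC ground_index_def)
qed

context wall_setting
begin

lemma wall_wt_wall_of:
  assumes v: "fill v"
  shows "wall_wt g n N (wall_of v) j = (\<Sum>x\<leftarrow>v. vec_wt n x j)"
proof (cases "j \<in> {1..n}")
  case False
  have "vec_wt n x j = 0" for x using False by (cases x) (auto simp: eps_weight_def)
  then show ?thesis using False unfolding wall_wt_def by (simp only: if_False sum_list_0)
next
  case True
  have blocks: "added_blocks g n N (wall_of v) i = (\<Sum>m\<in>{1..N}. column_blocks g n N i m (wall_of v m))" for i
    unfolding added_blocks_def
    by (rule sum.mono_neutral_left) (auto simp: wall_of_def column_blocks_ground split: if_splits)
  have "(\<Sum>i\<in>{0..n}. int (added_blocks g n N (wall_of v) i) * affine_cartan g n j i) =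
      (\<Sum>m\<in>{1..N}. \<Sum>i\<in>{0..n}. int (column_blocks g n N i m (wall_of v m)) * affine_cartan g n j i)"
    unfolding blocks of_nat_sum sum_distrib_right by (rule sum.swap)
  also have "\<dots> = (\<Sum>m\<in>{1..N}. vec_wt n (column_letter g n N m (ground_column g)) j - vec_wt n (v ! (m - 1)) j)"
  proof (intro sum.cong refl)
    fix m assume "m \<in> {1..N}"
    then have m: "1 \<le> m" "m \<le> N" by auto
    have gd: "good m (v ! (m - 1))" using fill_good[OF v m] .
    have w: "wall_of v m = col m (v ! (m - 1))" using m by (simp add: wall_of_def)
    show "(\<Sum>i\<in>{0..n}. int (column_blocks g n N i m (wall_of v m)) * affine_cartan g n j i) =
        vec_wt n (column_letter g n N m (ground_column g)) j - vec_wt n (v ! (m - 1)) j"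
      using column_weight[OF type column_ok_col[OF m gd] True, of N m] column_letter_col[OF m gd] w by simp
  qed
  also have "\<dots> = of_bool (j = ground_index g n N) - (\<Sum>m\<in>{1..N}. vec_wt n (v ! (m - 1)) j)"
    unfolding sum_subtractf ground_weight[OF type True] ..
  also have "(\<Sum>m\<in>{1..N}. vec_wt n (v ! (m - 1)) j) = (\<Sum>p<N. vec_wt n (v ! p) j)"
    by (rule sum.reindex_bij_witness[of _ Suc "\<lambda>m. m - 1"]) auto
  also have "\<dots> = (\<Sum>x\<leftarrow>v. vec_wt n x j)"
    using v by (simp add: sum_list_sum_nth fill_def atLeast0LessThan)
  finally show ?thesis using True unfolding wall_wt_def by simp
qed

text \<open>One inclusion is closure of the tableaux under the operators. The other follows the path
  of \<open>tableaux_induct\<close>, where each \<open>f_step\<close> asks for a proper and reduced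
  target, both known for the walls of tableaux.\<close>

lemma wall_component_eq:
  "wall_component g n N (hw_wall g n is) = (\<lambda>T. wall_of (concat T)) ` tableaux g n is"
proof (intro subset_antisym subsetI)
  fix Y assume "Y \<in> wall_component g n N (hw_wall g n is)"
  then show "Y \<in> (\<lambda>T. wall_of (concat T)) ` tableaux g n is"
  proof induction
    case start
    then show ?case using hw_wall_eq hw_tableau_mem[OF sorted_is is_subset] by blast
  next
    case (e_step Y i Y')
    then obtain T where T: "T \<in> tableaux g n is" "Y = wall_of (concat T)" by blast
    have r: "rev (concat T) = reading T" by (simp add: reading_eq)
    obtain w where w: "word_e g n i (reading T) = Some w" "Y' = wall_of (rev w)"
      using e_step wall_e_wall_of[OF fill_concat[OF T(1)], of i] T(2) r by auto
    obtain T' where "T' \<in> tableaux g n is" "reading T' = w"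
      using tableaux_word_e[OF sorted_is T(1) e_step(2) w(1)] by blast
    then show ?case using w(2) by (auto simp: reading_eq)
  next
    case (f_step Y i Y')
    then obtain T where T: "T \<in> tableaux g n is" "Y = wall_of (concat T)" by blast
    have r: "rev (concat T) = reading T" by (simp add: reading_eq)
    obtain w where w: "word_f g n i (reading T) = Some w" "Y' = wall_of (rev w)"
      using f_step wall_f_wall_of[OF fill_concat[OF T(1)], of i] T(2) r by auto
    obtain T' where "T' \<in> tableaux g n is" "reading T' = w"
      using tableaux_word_f[OF sorted_is T(1) f_step(2) w(1)] by blast
    then show ?case using w(2) by (auto simp: reading_eq)
  qed
next
  fix Y assume "Y \<in> (\<lambda>T. wall_of (concat T)) ` tableaux g n is"
  then obtain T where T: "T \<in> tableaux g n is" "Y = wall_of (concat T)" by blast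
  from sorted_is is_subset T(1) have "wall_of (concat T) \<in> wall_component g n N (hw_wall g n is)"
  proof (induction rule: tableaux_induct)
    case highest
    then show ?case unfolding hw_wall_eq by (rule wall_component.start)
  next
    case (step T T' i)
    have r: "rev (concat T) = reading T" "rev (reading T') = concat T'" by (simp_all add: reading_eq)
    have "wall_f g n N i (wall_of (concat T)) = Some (wall_of (concat T'))"
      using wall_f_wall_of[OF fill_concat[OF step(1)], of i] step(3,4) r by simp
    then show ?case
      using step(5,3) proper_wall_of[OF fill_concat[OF step(2)]] reduced_wall_of[OF step(2)]
      by (blast intro: wall_component.f_step)
  qed
  then show "Y \<in> wall_component g n N (hw_wall g n is)" using T(2) by simp
qed

lemma map_block_wall_of:
  assumes T: "T \<in> tableaux g n is"
  shows "map (\<lambda>k. map (\<lambda>a. let m = block_start is k + a in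
      column_letter g n N m (wall_of (concat T) m)) [1..<Suc (is ! k)]) [0..<length is] = T" (is "map ?C _ = T")
proof (rule nth_equalityI)
  have len: "map length T = is" using T unfolding tableaux_iff[OF sorted_is] by simp
  then show "length (map ?C [0..<length is]) = length T" by auto
  fix k assume "k < length (map ?C [0..<length is])"
  then have k: "k < length is" by simp
  have lk: "length (T ! k) = is ! k" "k < length T" using k len by auto
  have "?C k = T ! k"
  proof (rule nth_equalityI)
    fix p assume "p < length (?C k)"
    then have p: "p < is ! k" by (simp del: upt_Suc)
    define m where "m = block_start is k + Suc p"
    have "m \<le> block_start is (Suc k)" using p k by (simp add: m_def block_start_Suc)
    also have "\<dots> \<le> N" using k by (intro block_start_le) simp
    finally have m: "1 \<le> m" "m \<le> N" by (simp_all add: m_def)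
    have "column_letter g n N m (wall_of (concat T) m) = concat T ! (m - 1)"
      using column_letter_col[OF m fill_good[OF fill_concat[OF T] m]] m by (simp add: wall_of_def)
    also have "\<dots> = T ! k ! p" using concat_nth[OF len lk(2) p] by (simp add: m_def)
    finally show "?C k ! p = T ! k ! p" using p by (simp add: m_def Let_def del: upt_Suc)
  qed (use lk in \<open>simp del: upt_Suc\<close>)
  then show "map ?C [0..<length is] ! k = T ! k" using k by (simp del: upt_Suc)
qed

end

theorem theorem3p12:
  fixes g :: cartan and n :: nat and lam :: weight
  assumes "g = TypeA \<and> n \<ge> 1 \<or> g = TypeC \<and> n \<ge> 3"
    and "dominant_weight n lam"
  shows "crystal_iso n (wall_crystal g n lam) (tableau_crystal g n lam) (tableau_of_wall g n lam)"
proof -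
  define "is" where "is = fund_parts n lam"
  have is_props: "sorted is" "set is \<subseteq> {1..n}"
    using fund_parts_iff[OF assms(2), of "is"] is_def by simp_all
  interpret wall_setting g n "is" by unfold_locales (use assms(1) is_props in auto)
  let ?Y = "\<lambda>T. wall_of (concat T)" and ?T = "tableaux g n is"
  let ?h = "tableau_of_wall g n lam"
  let ?CW = "wall_crystal g n lam" and ?CT = "tableau_crystal g n lam"
  note CW = wall_crystal_def is_def[symmetric] Let_def and CT = tableau_crystal_def is_def[symmetric]
  have hY: "?h (?Y T) = T" if "T \<in> ?T" for T
    using map_block_wall_of[OF that] by (simp add: tableau_of_wall_def is_def[symmetric] Let_def)
  have elems: "elems ?CW = ?Y ` ?T" "elems ?CT = ?T" by (simp_all add: CW CT wall_component_eq)
  have read: "rev (concat T) = reading T" "rev (reading T) = concat T" for T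
    by (simp_all add: reading_eq)
  \<comment> \<open>Both operators are treated together: \<open>P\<close> acts on walls and
    \<open>Q\<close> is its counterpart on tableaux.\<close>
  have ops: "set_option (Q i T) \<subseteq> ?T \<and> P i (?Y T) = map_option ?Y (Q i T)"
    if T: "T \<in> ?T" and i: "i \<in> {1..n}" and PQ: "(P, Q) \<in> {(e_op ?CW, e_op ?CT), (f_op ?CW, f_op ?CT)}" for T i P Q
  proof -
    have len: "map length T' = is" if "T' \<in> ?T" for T'
      using that unfolding tableaux_iff[OF is_props(1)] by simp
    from PQ obtain W where W: "Q i T = map_option (unread is) W"
      "P i (?Y T) = map_option (\<lambda>w. wall_of (rev w)) W" "\<And>w. W = Some w \<Longrightarrow> \<exists>T'\<in>?T. reading T' = w"
      using wall_f_wall_of[OF fill_concat[OF T], of i] wall_e_wall_of[OF fill_concat[OF T], of i]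
        i tableaux_word_e[OF is_props(1) T i] tableaux_word_f[OF is_props(1) T i] len[OF T]
      by (auto simp: CW CT read)
    show ?thesis
    proof (cases W)
      case (Some w)
      with W(3) obtain T' where "T' \<in> ?T" "reading T' = w" by blast
      then show ?thesis using W Some unread_eq[OF len, of T' w] read(2)[of T'] by simp
    qed (use W in simp)
  qed
  have lens: "e_len ?CW i (?Y T) = e_len ?CT i T" "f_len ?CW i (?Y T) = f_len ?CT i T"
    if "T \<in> ?T" "i \<in> {1..n}" for T i
    using length_places_wall_of[OF fill_concat[OF that(1)], of i] that(2) by (simp_all add: CW CT read)
  have wts: "wt ?CW (?Y T) = wt ?CT T" if "T \<in> ?T" for T
  proof
    fix j
    have "(\<Sum>x\<leftarrow>rev (concat T). vec_wt n x j) = (\<Sum>x\<leftarrow>concat T. vec_wt n x j)"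
      by (simp add: rev_map[symmetric] sum_list_rev)
    then show "wt ?CW (?Y T) j = wt ?CT T j"
      using wall_wt_wall_of[OF fill_concat[OF that], of j] by (simp add: CW CT read)
  qed
  have map_h: "map_option ?h (map_option ?Y F) = F \<and> set_option (map_option ?Y F) \<subseteq> ?Y ` ?T"
    if "set_option F \<subseteq> ?T" for F
    using that hY by (cases F) auto
  have e: "map_option ?h (e_op ?CW i (?Y T)) = e_op ?CT i T \<and> set_option (e_op ?CT i T) \<subseteq> ?T \<and>
      set_option (e_op ?CW i (?Y T)) \<subseteq> ?Y ` ?T"
    and f: "map_option ?h (f_op ?CW i (?Y T)) = f_op ?CT i T \<and> set_option (f_op ?CT i T) \<subseteq> ?T \<and>
      set_option (f_op ?CW i (?Y T)) \<subseteq> ?Y ` ?T" if "T \<in> ?T" "i \<in> {1..n}" for T i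
    using ops[OF that, of "e_op ?CW" "e_op ?CT"] ops[OF that, of "f_op ?CW" "f_op ?CT"] map_h by simp_all
  \<comment> \<open>The component is the image of \<open>?Y\<close>, so the left inverse
    \<open>?h\<close> of \<open>?Y\<close> on tableaux is a bijection back.\<close>
  have "bij_betw ?h (?Y ` ?T) ?T"
    by (rule bij_betw_byWitness[of _ ?Y]) (use hY in auto)
  then show ?thesis
    unfolding crystal_iso_def ops_closed_def elems ball_simps(9)[symmetric] using e f hY wts lens by simp
qed

end
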